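(* Let $(R,\mathfrak m)$ be a Cohen-Macaulay local ring of positive dimension and of prime characteristic $p>0$. Let $M$ be a finitely generated $R$-module which has a rank. Assume $F^n(M)$ is maximal Cohen-Macaulay for some $n\geq \kappa(R)$. Then $M$ is free.
   Context: $f\colon R\to R$, $f(r)=r^p$, is the Frobenius endomorphism; ${}^{f^n}\!R$ denotes $R$ viewed as an $R$-module via $f^n$. The Frobenius functor is $F^n(M)=M\otimes_R {}^{f^n}\!R$, regarded as an $R$-module via the right factor. $q=p^n$; for an ideal $I$, $I^{[q]}$ is the ideal generated by $q$-th powers of generators of $I$. $\kappa(R)=\inf\{t : \text{there is a system of parameters }\mathbf x\text{ of }R\text{ with }\mathfrak m^{[p^t]}\subseteq(\mathbf x)\}$. $M$ has a rank $r$ if $S^{-1}M\cong (S^{-1}R)^r$, where $S$ is the set of nonzerodivisors of $R$. *)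

theory Defs
  imports "HOL-Algebra.Algebra" "HOL-Library.Extended_Nat" "HOL-Library.Function_Algebras"
begin

definition local_ring :: "('a, 'b) ring_scheme \<Rightarrow> 'a set \<Rightarrow> bool" where
  "local_ring R m \<longleftrightarrow> cring R \<and> maximalideal m R \<and> (\<forall>I. maximalideal I R \<longrightarrow> I = m)"

definition krull_dim :: "('a, 'b) ring_scheme \<Rightarrow> enat" where
  "krull_dim R = Sup {enat n | n. \<exists>P :: nat \<Rightarrow> 'a set.
      (\<forall>i\<le>n. primeideal (P i) R) \<and> (\<forall>i<n. P i \<subset> P (Suc i))}"

definition ring_char_p :: "('a, 'b) ring_scheme \<Rightarrow> nat \<Rightarrow> bool" where
  "ring_char_p R p \<longleftrightarrow> Factorial_Ring.prime p \<and> add_pow R p \<one>\<^bsub>R\<^esub> = \<zero>\<^bsub>R\<^esub>"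

definition ideal_mult_module :: "('a, 'b) ring_scheme \<Rightarrow> ('a, 'c) module \<Rightarrow> 'a list \<Rightarrow> 'c set" where
  "ideal_mult_module R M xs =
     {finsum M (\<lambda>i. (xs ! i) \<odot>\<^bsub>M\<^esub> v i) {..<length xs} | v. \<forall>i<length xs. v i \<in> carrier M}"

definition regular_seq :: "('a, 'b) ring_scheme \<Rightarrow> ('a, 'c) module \<Rightarrow> 'a set \<Rightarrow> 'a list \<Rightarrow> bool" where
  "regular_seq R M m xs \<longleftrightarrow> set xs \<subseteq> m \<and> ideal_mult_module R M xs \<noteq> carrier M \<and>
     (\<forall>i<length xs. \<forall>v\<in>carrier M.
        (xs ! i) \<odot>\<^bsub>M\<^esub> v \<in> ideal_mult_module R M (take i xs) \<longrightarrow> v \<in> ideal_mult_module R M (take i xs))"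

definition depth :: "('a, 'b) ring_scheme \<Rightarrow> 'a set \<Rightarrow> ('a, 'c) module \<Rightarrow> enat" where
  "depth R m M = Sup {enat (length xs) | xs. regular_seq R M m xs}"

definition ring_as_module :: "('a, 'b) ring_scheme \<Rightarrow> ('a, 'a) module" where
  "ring_as_module R = \<lparr>carrier = carrier R, monoid.mult = (\<lambda>x y. x \<otimes>\<^bsub>R\<^esub> y), monoid.one = \<one>\<^bsub>R\<^esub>,
     ring.zero = \<zero>\<^bsub>R\<^esub>, ring.add = (\<lambda>x y. x \<oplus>\<^bsub>R\<^esub> y), module.smult = (\<lambda>x y. x \<otimes>\<^bsub>R\<^esub> y)\<rparr>"

definition cohen_macaulay_local :: "('a, 'b) ring_scheme \<Rightarrow> 'a set \<Rightarrow> bool" where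
  "cohen_macaulay_local R m \<longleftrightarrow> noetherian_ring R \<and> local_ring R m \<and>
     depth R m (ring_as_module R) = krull_dim R"

definition max_cohen_macaulay :: "('a, 'b) ring_scheme \<Rightarrow> 'a set \<Rightarrow> ('a, 'c) module \<Rightarrow> bool" where
  "max_cohen_macaulay R m M \<longleftrightarrow> carrier M \<noteq> {\<zero>\<^bsub>M\<^esub>} \<and> depth R m M = krull_dim R"

definition finitely_generated :: "('a, 'b) ring_scheme \<Rightarrow> ('a, 'c) module \<Rightarrow> bool" where
  "finitely_generated R M \<longleftrightarrow> (\<exists>vs. set vs \<subseteq> carrier M \<and>
     (\<forall>x\<in>carrier M. \<exists>a. (\<forall>i<length vs. a i \<in> carrier R) \<and>
        x = finsum M (\<lambda>i. a i \<odot>\<^bsub>M\<^esub> vs ! i) {..<length vs}))"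

definition free_module :: "('a, 'b) ring_scheme \<Rightarrow> ('a, 'c) module \<Rightarrow> bool" where
  "free_module R M \<longleftrightarrow> (\<exists>B \<subseteq> carrier M. \<forall>x\<in>carrier M. \<exists>!c.
     c \<in> B \<rightarrow>\<^sub>E carrier R \<and> finite {b\<in>B. c b \<noteq> \<zero>\<^bsub>R\<^esub>} \<and>
     x = finsum M (\<lambda>b. c b \<odot>\<^bsub>M\<^esub> b) {b\<in>B. c b \<noteq> \<zero>\<^bsub>R\<^esub>})"

definition nonzerodivisors :: "('a, 'b) ring_scheme \<Rightarrow> 'a set" where
  "nonzerodivisors R = {s\<in>carrier R. \<forall>a\<in>carrier R. s \<otimes>\<^bsub>R\<^esub> a = \<zero>\<^bsub>R\<^esub> \<longrightarrow> a = \<zero>\<^bsub>R\<^esub>}"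

definition rep_of :: "'x set \<Rightarrow> 'x" where "rep_of A = (SOME e. e \<in> A)"

definition frac_rel :: "('a, 'b) ring_scheme \<Rightarrow> ('a, 'c) module \<Rightarrow> (('c \<times> 'a) \<times> ('c \<times> 'a)) set" where
  "frac_rel R M = {((x, s), (y, t)). x \<in> carrier M \<and> y \<in> carrier M \<and>
     s \<in> nonzerodivisors R \<and> t \<in> nonzerodivisors R \<and>
     (\<exists>u\<in>nonzerodivisors R. u \<odot>\<^bsub>M\<^esub> (t \<odot>\<^bsub>M\<^esub> x \<ominus>\<^bsub>M\<^esub> s \<odot>\<^bsub>M\<^esub> y) = \<zero>\<^bsub>M\<^esub>)}"

definition frac_class :: "('a, 'b) ring_scheme \<Rightarrow> ('a, 'c) module \<Rightarrow> 'c \<Rightarrow> 'a \<Rightarrow> ('c \<times> 'a) set" where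
  "frac_class R M x s = frac_rel R M `` {(x, s)}"

definition total_frac_ring :: "('a, 'b) ring_scheme \<Rightarrow> ('a \<times> 'a) set ring" where
  "total_frac_ring R = (let A = ring_as_module R in
     \<lparr>carrier = (carrier R \<times> nonzerodivisors R) // frac_rel R A,
      monoid.mult = (\<lambda>U V. case (rep_of U, rep_of V) of ((a, s), (b, t)) \<Rightarrow>
                frac_class R A (a \<otimes>\<^bsub>R\<^esub> b) (s \<otimes>\<^bsub>R\<^esub> t)),
      monoid.one = frac_class R A \<one>\<^bsub>R\<^esub> \<one>\<^bsub>R\<^esub>,
      ring.zero = frac_class R A \<zero>\<^bsub>R\<^esub> \<one>\<^bsub>R\<^esub>,
      ring.add = (\<lambda>U V. case (rep_of U, rep_of V) of ((a, s), (b, t)) \<Rightarrow>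
                frac_class R A (t \<otimes>\<^bsub>R\<^esub> a \<oplus>\<^bsub>R\<^esub> s \<otimes>\<^bsub>R\<^esub> b) (s \<otimes>\<^bsub>R\<^esub> t))\<rparr>)"

definition loc_module :: "('a, 'b) ring_scheme \<Rightarrow> ('a, 'c) module \<Rightarrow> (('a \<times> 'a) set, ('c \<times> 'a) set) module" where
  "loc_module R M =
     \<lparr>carrier = (carrier M \<times> nonzerodivisors R) // frac_rel R M,
      monoid.mult = (\<lambda>U V. frac_class R M \<zero>\<^bsub>M\<^esub> \<one>\<^bsub>R\<^esub>),
      monoid.one = frac_class R M \<zero>\<^bsub>M\<^esub> \<one>\<^bsub>R\<^esub>,
      ring.zero = frac_class R M \<zero>\<^bsub>M\<^esub> \<one>\<^bsub>R\<^esub>,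
      ring.add = (\<lambda>U V. case (rep_of U, rep_of V) of ((x, s), (y, t)) \<Rightarrow>
                frac_class R M (t \<odot>\<^bsub>M\<^esub> x \<oplus>\<^bsub>M\<^esub> s \<odot>\<^bsub>M\<^esub> y) (s \<otimes>\<^bsub>R\<^esub> t)),
      module.smult = (\<lambda>W U. case (rep_of W, rep_of U) of ((a, s), (x, t)) \<Rightarrow>
                frac_class R M (a \<odot>\<^bsub>M\<^esub> x) (s \<otimes>\<^bsub>R\<^esub> t))\<rparr>"

definition free_rank_module :: "('x, 'y) ring_scheme \<Rightarrow> nat \<Rightarrow> ('x, nat \<Rightarrow> 'x) module" where
  "free_rank_module A r =
     \<lparr>carrier = {..<r} \<rightarrow>\<^sub>E carrier A,
      monoid.mult = (\<lambda>f g. restrict (\<lambda>i. \<zero>\<^bsub>A\<^esub>) {..<r}),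
      monoid.one = restrict (\<lambda>i. \<zero>\<^bsub>A\<^esub>) {..<r},
      ring.zero = restrict (\<lambda>i. \<zero>\<^bsub>A\<^esub>) {..<r},
      ring.add = (\<lambda>f g. restrict (\<lambda>i. f i \<oplus>\<^bsub>A\<^esub> g i) {..<r}),
      module.smult = (\<lambda>a f. restrict (\<lambda>i. a \<otimes>\<^bsub>A\<^esub> f i) {..<r})\<rparr>"

definition module_iso :: "('x, 'y) ring_scheme \<Rightarrow> ('x, 'u) module \<Rightarrow> ('x, 'v) module \<Rightarrow> ('u \<Rightarrow> 'v) \<Rightarrow> bool" where
  "module_iso A N P \<phi> \<longleftrightarrow> bij_betw \<phi> (carrier N) (carrier P) \<and>
     (\<forall>x\<in>carrier N. \<forall>y\<in>carrier N. \<phi> (x \<oplus>\<^bsub>N\<^esub> y) = \<phi> x \<oplus>\<^bsub>P\<^esub> \<phi> y) \<and>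
     (\<forall>a\<in>carrier A. \<forall>x\<in>carrier N. \<phi> (a \<odot>\<^bsub>N\<^esub> x) = a \<odot>\<^bsub>P\<^esub> \<phi> x)"

definition has_rank :: "('a, 'b) ring_scheme \<Rightarrow> ('a, 'c) module \<Rightarrow> nat \<Rightarrow> bool" where
  "has_rank R M r \<longleftrightarrow> (\<exists>\<phi>. module_iso (total_frac_ring R) (loc_module R M)
       (free_rank_module (total_frac_ring R) r) \<phi>)"

definition fdelta :: "'k \<Rightarrow> ('k \<Rightarrow> int)" where
  "fdelta k = (\<lambda>k'. if k' = k then 1 else 0)"

definition formal_sums :: "('a, 'b) ring_scheme \<Rightarrow> ('a, 'c) module \<Rightarrow> ('c \<times> 'a \<Rightarrow> int) set" where
  "formal_sums R M = {f. finite {k. f k \<noteq> 0} \<and> {k. f k \<noteq> 0} \<subseteq> carrier M \<times> carrier R}"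

text \<open>Relations of the tensor product M \<otimes>_R {}^{f^n}R, with q = p^n:
  r x \<otimes> s = x \<otimes> r^q s.\<close>
inductive_set tensor_rels :: "('a, 'b) ring_scheme \<Rightarrow> ('a, 'c) module \<Rightarrow> nat \<Rightarrow> ('c \<times> 'a \<Rightarrow> int) set"
  for R M q where
  tr_zero: "0 \<in> tensor_rels R M q"
| tr_addl: "\<lbrakk>x \<in> carrier M; y \<in> carrier M; s \<in> carrier R\<rbrakk> \<Longrightarrow>
     fdelta (x \<oplus>\<^bsub>M\<^esub> y, s) - fdelta (x, s) - fdelta (y, s) \<in> tensor_rels R M q"
| tr_addr: "\<lbrakk>x \<in> carrier M; s \<in> carrier R; t \<in> carrier R\<rbrakk> \<Longrightarrow>
     fdelta (x, s \<oplus>\<^bsub>R\<^esub> t) - fdelta (x, s) - fdelta (x, t) \<in> tensor_rels R M q"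
| tr_bal: "\<lbrakk>x \<in> carrier M; r \<in> carrier R; s \<in> carrier R\<rbrakk> \<Longrightarrow>
     fdelta (r \<odot>\<^bsub>M\<^esub> x, s) - fdelta (x, (r [^]\<^bsub>R\<^esub> q) \<otimes>\<^bsub>R\<^esub> s) \<in> tensor_rels R M q"
| tr_plus: "\<lbrakk>f \<in> tensor_rels R M q; g \<in> tensor_rels R M q\<rbrakk> \<Longrightarrow> f + g \<in> tensor_rels R M q"
| tr_uminus: "f \<in> tensor_rels R M q \<Longrightarrow> - f \<in> tensor_rels R M q"

definition tensor_class :: "('a, 'b) ring_scheme \<Rightarrow> ('a, 'c) module \<Rightarrow> nat \<Rightarrow> ('c \<times> 'a \<Rightarrow> int) \<Rightarrow> ('c \<times> 'a \<Rightarrow> int) set" where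
  "tensor_class R M q f = {g \<in> formal_sums R M. g - f \<in> tensor_rels R M q}"

text \<open>F^n(M), an R-module via the right factor: r (x \<otimes> s) = x \<otimes> r s.\<close>
definition frobenius_functor :: "('a, 'b) ring_scheme \<Rightarrow> nat \<Rightarrow> nat \<Rightarrow> ('a, 'c) module \<Rightarrow> ('a, ('c \<times> 'a \<Rightarrow> int) set) module" where
  "frobenius_functor R p n M = (let q = p ^ n in
     \<lparr>carrier = tensor_class R M q ` formal_sums R M,
      monoid.mult = (\<lambda>U V. tensor_class R M q 0),
      monoid.one = tensor_class R M q 0,
      ring.zero = tensor_class R M q 0,
      ring.add = (\<lambda>U V. tensor_class R M q (rep_of U + rep_of V)),
      module.smult = (\<lambda>r U. tensor_class R M q
         (\<lambda>k'. sum (rep_of U) {k. rep_of U k \<noteq> 0 \<and> (fst k, r \<otimes>\<^bsub>R\<^esub> snd k) = k'}))\<rparr>)"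

text \<open>System of parameters: dim R elements of m generating an m-primary ideal.\<close>
definition system_of_parameters :: "('a, 'b) ring_scheme \<Rightarrow> 'a set \<Rightarrow> 'a list \<Rightarrow> bool" where
  "system_of_parameters R m xs \<longleftrightarrow> enat (length xs) = krull_dim R \<and> set xs \<subseteq> m \<and>
     (\<forall>a\<in>m. \<exists>k::nat. a [^]\<^bsub>R\<^esub> k \<in> Idl\<^bsub>R\<^esub> (set xs))"

definition frob_power :: "('a, 'b) ring_scheme \<Rightarrow> 'a set \<Rightarrow> nat \<Rightarrow> 'a set" where
  "frob_power R I q = Idl\<^bsub>R\<^esub> {a [^]\<^bsub>R\<^esub> q | a. a \<in> I}"

definition kappa :: "('a, 'b) ring_scheme \<Rightarrow> 'a set \<Rightarrow> nat \<Rightarrow> nat" where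
  "kappa R m p = Inf {t. \<exists>xs. system_of_parameters R m xs \<and>
      frob_power R m (p ^ t) \<subseteq> Idl\<^bsub>R\<^esub> (set xs)}"

end

theory Submission
  imports Defs
begin

text \<open>Let \<open>e\<^sub>1, \<dots>, e\<^sub>k\<close> be minimal generators of \<open>M\<close>, let \<open>q = p\<^sup>n\<close> and let \<open>I\<close> be the ideal of a system of
  parameters \<open>x\<close> with \<open>m\<^sup>[\<^sup>q\<^sup>] \<subseteq> I\<close>. The \<open>e\<^sub>i \<otimes> 1\<close> present \<open>F\<^sup>n(M)\<close> as a quotient of \<open>R\<^sup>k\<close> by a module of relations \<open>K\<close>,
  and \<open>K \<subseteq> I R\<^sup>k\<close> because relations of \<open>M\<close> have coefficients in \<open>m\<close>. A regular sequence on \<open>F\<^sup>n(M)\<close> that is as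
  long as \<open>x\<close> makes the Koszul complex of \<open>x\<close> on \<open>F\<^sup>n(M)\<close> exact in positive degrees; exactness in degree
  one says \<open>K \<inter> I R\<^sup>k = I K\<close>, so \<open>K = I K\<close> and \<open>K = 0\<close> by Nakayama. Hence every relation \<open>\<Sum> a\<^sub>i e\<^sub>i = 0\<close> of \<open>M\<close>
  has \<open>a\<^sub>i\<^sup>q = 0\<close>. Since \<open>M\<close> has a rank, relations with nilpotent coefficients are trivial, and the
  \<open>e\<^sub>i\<close> form a basis.\<close>

section \<open>Finitely generated modules\<close>

text \<open>Maximal Cohen-Macaulayness supplies some regular sequence \<open>ys\<close> on N =
  F^n(M), not regularity of the chosen \<open>xs\<close>. The link is the long exact sequence of the
  Koszul homology of \<open>xs\<close>: the kernel of y on H_j(N) is the image of H_(j+1)(N/yN), and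
  y acts nilpotently on H_j(N) because a power of y lies in the ideal of \<open>xs\<close>. So every
  member of \<open>ys\<close> pushes the vanishing one degree down, from degree
  \<open>length xs + 1\<close> to degree 1. The bound on n enters through coordinates. With respect
  to minimal generators, coordinates in M are unique only modulo m; their q-th powers are unique
  modulo I, since m^[q] lies in I. This gives maps from F^n(M) to R/I that read off coefficients,
  and hence the inclusion of K in I R^k. Vanishing of the a_i^q does not finish the argument when R
  has nilpotents. For R = k[[t,u]]/(u^2) with k of characteristic p and M = R/(u), F^n(M) = R for
  every n > 0, yet M is not free; it has no rank.\<close>

primrec lin_span :: "('a, 'c, 'd) module_scheme \<Rightarrow> 'a set \<Rightarrow> 'c list \<Rightarrow> 'c set" where
  "lin_span M J [] = {\<zero>\<^bsub>M\<^esub>}"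
| "lin_span M J (v # vs) = {a \<odot>\<^bsub>M\<^esub> v \<oplus>\<^bsub>M\<^esub> w | a w. a \<in> J \<and> w \<in> lin_span M J vs}"

text \<open>For a submodule L this is the product of L with the ideal of \<open>xs\<close>. The
  recursion runs parallel to that of \<open>koszul_d\<close>, because these sums are the values of
  the differential at the index of the empty set.\<close>

primrec scaled_span :: "('a, 'c, 'd) module_scheme \<Rightarrow> 'a list \<Rightarrow> 'c set \<Rightarrow> 'c set" where
  "scaled_span M [] L = {\<zero>\<^bsub>M\<^esub>}"
| "scaled_span M (x # xs) L = {x \<odot>\<^bsub>M\<^esub> v \<oplus>\<^bsub>M\<^esub> w | v w. v \<in> L \<and> w \<in> scaled_span M xs L}"

context module
begin

lemma submodule_zero: "submodule L R M \<Longrightarrow> \<zero>\<^bsub>M\<^esub> \<in> L"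
  by (metis submoduleE(1,2,4) R.zero_closed smult_l_null all_not_in_conv subsetD)

lemma submodule_minus: "submodule L R M \<Longrightarrow> a \<in> L \<Longrightarrow> b \<in> L \<Longrightarrow> a \<ominus>\<^bsub>M\<^esub> b \<in> L"
  unfolding a_minus_def by (simp add: submoduleE)

lemma add_add_swap: "\<lbrakk>a \<in> carrier M; b \<in> carrier M; c \<in> carrier M; d \<in> carrier M\<rbrakk> \<Longrightarrow>
   (a \<oplus>\<^bsub>M\<^esub> b) \<oplus>\<^bsub>M\<^esub> (c \<oplus>\<^bsub>M\<^esub> d) = (a \<oplus>\<^bsub>M\<^esub> c) \<oplus>\<^bsub>M\<^esub> (b \<oplus>\<^bsub>M\<^esub> d)"
  by (simp add: M.a_ac)

lemma lin_span_ConsI: "a \<in> J \<Longrightarrow> w \<in> lin_span M J vs \<Longrightarrow> a \<odot>\<^bsub>M\<^esub> v \<oplus>\<^bsub>M\<^esub> w \<in> lin_span M J (v # vs)"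
  by auto

lemma lin_span_subset:
  assumes "J \<subseteq> carrier R" "set vs \<subseteq> carrier M" shows "lin_span M J vs \<subseteq> carrier M"
  using assms by (induction vs) auto

lemma lin_span_submodule:
  assumes J: "ideal J R" and "set vs \<subseteq> carrier M"
  shows "submodule (lin_span M J vs) R M"
  using assms(2)
proof (induction vs)
  case Nil
  then show ?case by (intro submoduleI) auto
next
  case (Cons v vs)
  interpret J: ideal J R by fact
  have JR: "a \<in> carrier R" if "a \<in> J" for a using that by (rule J.Icarr)
  have v: "v \<in> carrier M" and IH: "submodule (lin_span M J vs) R M" using Cons by auto
  have sub: "w \<in> carrier M" if "w \<in> lin_span M J vs" for w using submoduleE(1)[OF IH] that by auto
  show ?case
  proof (intro submoduleI)
    show "lin_span M J (v # vs) \<subseteq> carrier M" using v JR sub by auto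
    have "\<zero>\<^bsub>M\<^esub> = \<zero> \<odot>\<^bsub>M\<^esub> v \<oplus>\<^bsub>M\<^esub> \<zero>\<^bsub>M\<^esub>" using v by simp
    then show "\<zero>\<^bsub>M\<^esub> \<in> lin_span M J (v # vs)"
      using J.zero_closed submodule_zero[OF IH] lin_span_ConsI by metis
  next
    fix a assume "a \<in> lin_span M J (v # vs)"
    then obtain c w where c: "c \<in> J" "w \<in> lin_span M J vs" "a = c \<odot>\<^bsub>M\<^esub> v \<oplus>\<^bsub>M\<^esub> w" by auto
    have "\<ominus>\<^bsub>M\<^esub> a = (\<ominus> c) \<odot>\<^bsub>M\<^esub> v \<oplus>\<^bsub>M\<^esub> (\<ominus>\<^bsub>M\<^esub> w)"
      using c JR sub v by (simp add: M.minus_add smult_l_minus)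
    then show "\<ominus>\<^bsub>M\<^esub> a \<in> lin_span M J (v # vs)"
      using c submoduleE(3)[OF IH] J.a_inv_closed by (simp only: lin_span_ConsI)
  next
    fix a b assume "a \<in> lin_span M J (v # vs)" "b \<in> lin_span M J (v # vs)"
    then obtain c w d u where c: "c \<in> J" "w \<in> lin_span M J vs" "a = c \<odot>\<^bsub>M\<^esub> v \<oplus>\<^bsub>M\<^esub> w"
      "d \<in> J" "u \<in> lin_span M J vs" "b = d \<odot>\<^bsub>M\<^esub> v \<oplus>\<^bsub>M\<^esub> u" by auto
    have "a \<oplus>\<^bsub>M\<^esub> b = (c \<oplus> d) \<odot>\<^bsub>M\<^esub> v \<oplus>\<^bsub>M\<^esub> (w \<oplus>\<^bsub>M\<^esub> u)"
      using c JR sub v by (simp add: smult_l_distr add_add_swap)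
    then show "a \<oplus>\<^bsub>M\<^esub> b \<in> lin_span M J (v # vs)"
      using c submoduleE(5)[OF IH] J.a_closed by (simp only: lin_span_ConsI)
  next
    fix a x assume a: "a \<in> carrier R" and "x \<in> lin_span M J (v # vs)"
    then obtain c w where c: "c \<in> J" "w \<in> lin_span M J vs" "x = c \<odot>\<^bsub>M\<^esub> v \<oplus>\<^bsub>M\<^esub> w" by auto
    have "a \<odot>\<^bsub>M\<^esub> x = (a \<otimes> c) \<odot>\<^bsub>M\<^esub> v \<oplus>\<^bsub>M\<^esub> (a \<odot>\<^bsub>M\<^esub> w)"
      using a c JR sub v by (simp add: smult_r_distr smult_assoc1)
    then show "a \<odot>\<^bsub>M\<^esub> x \<in> lin_span M J (v # vs)"
      using a c submoduleE(4)[OF IH] J.I_l_closed by (simp only: lin_span_ConsI)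
  qed
qed

lemma lin_span_mono: "J \<subseteq> J' \<Longrightarrow> lin_span M J vs \<subseteq> lin_span M J' vs"
  by (induction vs) auto

lemma lin_span_Cons_superset:
  assumes "ideal J R" "v \<in> carrier M" "set vs \<subseteq> carrier M"
  shows "lin_span M J vs \<subseteq> lin_span M J (v # vs)"
proof
  interpret J: ideal J R by fact
  fix w assume w: "w \<in> lin_span M J vs"
  then have "w = \<zero> \<odot>\<^bsub>M\<^esub> v \<oplus>\<^bsub>M\<^esub> w"
    using assms submoduleE(1)[OF lin_span_submodule[OF assms(1,3)]] by auto
  then show "w \<in> lin_span M J (v # vs)" using w J.zero_closed lin_span_ConsI by metis
qed

lemma lin_span_superset:
  assumes "set vs \<subseteq> carrier M" shows "set vs \<subseteq> lin_span M (carrier R) vs"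
  using assms
proof (induction vs)
  case (Cons v vs)
  have "v = \<one> \<odot>\<^bsub>M\<^esub> v \<oplus>\<^bsub>M\<^esub> \<zero>\<^bsub>M\<^esub>" using Cons.prems by simp
  moreover have "\<zero>\<^bsub>M\<^esub> \<in> lin_span M (carrier R) vs"
    using lin_span_submodule[OF oneideal] Cons.prems submodule_zero by auto
  ultimately have "v \<in> lin_span M (carrier R) (v # vs)" using lin_span_ConsI R.one_closed by metis
  then show ?case using lin_span_Cons_superset[OF oneideal, of v vs] Cons by auto
qed simp

lemma lin_span_minimal:
  assumes "submodule L R M" "set vs \<subseteq> L" shows "lin_span M (carrier R) vs \<subseteq> L"
  using assms(2)
proof (induction vs)
  case Nil then show ?case using submodule_zero[OF assms(1)] by simp
next
  case (Cons v vs) then show ?case using submoduleE(4,5)[OF assms(1)] by auto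
qed

lemma smult_lin_span:
  assumes "ideal J R" "set vs \<subseteq> carrier M" "x \<in> J" "v \<in> lin_span M (carrier R) vs"
  shows "x \<odot>\<^bsub>M\<^esub> v \<in> lin_span M J vs"
  using assms(2,4)
proof (induction vs arbitrary: v)
  case Nil
  interpret J: ideal J R by fact
  show ?case using Nil assms(3) J.Icarr by simp
next
  case (Cons u vs)
  interpret J: ideal J R by fact
  obtain a w where a: "a \<in> carrier R" "w \<in> lin_span M (carrier R) vs" "v = a \<odot>\<^bsub>M\<^esub> u \<oplus>\<^bsub>M\<^esub> w"
    using Cons.prems by auto
  have w: "w \<in> carrier M" using lin_span_subset[of "carrier R" vs] Cons.prems a by auto
  have "x \<odot>\<^bsub>M\<^esub> v = (x \<otimes> a) \<odot>\<^bsub>M\<^esub> u \<oplus>\<^bsub>M\<^esub> (x \<odot>\<^bsub>M\<^esub> w)"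
    using a w Cons.prems J.Icarr[OF assms(3)] by (simp add: smult_r_distr smult_assoc1)
  moreover have "x \<odot>\<^bsub>M\<^esub> w \<in> lin_span M J vs" using Cons a by auto
  ultimately show ?case using a J.I_r_closed assms(3) by (simp only: lin_span_ConsI)
qed

lemma scaled_span_subset_lin_span:
  assumes "ideal J R" "set vs \<subseteq> carrier M" "set xs \<subseteq> J" "L \<subseteq> lin_span M (carrier R) vs"
  shows "scaled_span M xs L \<subseteq> lin_span M J vs"
  using assms(3)
proof (induction xs)
  case Nil
  then show ?case using submodule_zero[OF lin_span_submodule[OF assms(1,2)]] by simp
next
  case (Cons x xs)
  then show ?case using submoduleE(5)[OF lin_span_submodule[OF assms(1,2)]]
    smult_lin_span[OF assms(1,2)] assms(4) by (auto simp: subset_iff)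
qed

text \<open>The first generator is redundant: \<open>sub\<close> gives v = a v + w with a in m and w
  in the span of the others, and 1 - a is a unit. L stays fixed while its generating list shrinks,
  so \<open>sub\<close> survives the induction unchanged until the list is empty.\<close>

lemma nakayama:
  assumes m: "ideal m R" and units: "\<And>a. a \<in> m \<Longrightarrow> \<one> \<ominus> a \<in> Units R"
    and vs: "set vs \<subseteq> carrier M" and L: "L = lin_span M (carrier R) vs" and xs: "set xs \<subseteq> m"
    and sub: "L \<subseteq> scaled_span M xs L"
  shows "L = {\<zero>\<^bsub>M\<^esub>}"
  using vs L
proof (induction vs)
  case (Cons v vs)
  let ?S = "lin_span M (carrier R) vs"
  interpret m: ideal m R by fact
  have v: "v \<in> carrier M" and vs: "set vs \<subseteq> carrier M" using Cons by auto
  have S: "submodule ?S R M" by (rule lin_span_submodule[OF oneideal vs])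
  have "v \<in> L" using lin_span_superset[OF Cons.prems(1)] Cons.prems(2) by auto
  then have "v \<in> lin_span M m (v # vs)"
    using sub scaled_span_subset_lin_span[OF m Cons.prems(1) xs, of L] Cons.prems(2) by blast
  then obtain a w where a: "a \<in> m" "w \<in> lin_span M m vs" "v = a \<odot>\<^bsub>M\<^esub> v \<oplus>\<^bsub>M\<^esub> w" by auto
  have aR: "a \<in> carrier R" using a m.Icarr by auto
  have wS: "w \<in> ?S" using a lin_span_mono[OF m.a_subset] by auto
  then have w: "w \<in> carrier M" using submoduleE(1)[OF S] by auto
  have "w = v \<ominus>\<^bsub>M\<^esub> a \<odot>\<^bsub>M\<^esub> v"
    using a v w aR by (metis M.add.inv_solve_right M.a_comm M.minus_eq smult_closed)
  also have "\<dots> = (\<one> \<ominus> a) \<odot>\<^bsub>M\<^esub> v" using v aR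
    by (simp add: R.minus_eq M.minus_eq smult_l_distr smult_l_minus)
  finally have "inv (\<one> \<ominus> a) \<odot>\<^bsub>M\<^esub> w = v"
    using units[OF a(1)] v
    by (metis R.Units_closed R.Units_inv_closed R.Units_l_inv smult_assoc1 smult_one)
  then have "v \<in> ?S" using submoduleE(4)[OF S _ wS] units[OF a(1)] by auto
  then have "lin_span M (carrier R) (v # vs) \<subseteq> ?S"
    using lin_span_superset[OF vs] by (intro lin_span_minimal[OF S]) auto
  then have "L = ?S" using lin_span_Cons_superset[OF oneideal v vs] Cons.prems(2) by auto
  then show ?case using Cons.IH vs by auto
qed simp

lemma finsum_smult_diff:
  assumes "a \<in> A \<rightarrow> carrier R" "b \<in> A \<rightarrow> carrier R" "e \<in> A \<rightarrow> carrier M"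
  shows "finsum M (\<lambda>i. (a i \<ominus> b i) \<odot>\<^bsub>M\<^esub> e i) A =
    finsum M (\<lambda>i. a i \<odot>\<^bsub>M\<^esub> e i) A \<ominus>\<^bsub>M\<^esub> finsum M (\<lambda>i. b i \<odot>\<^bsub>M\<^esub> e i) A"
proof -
  let ?d = "finsum M (\<lambda>i. (a i \<ominus> b i) \<odot>\<^bsub>M\<^esub> e i) A" and ?b = "finsum M (\<lambda>i. b i \<odot>\<^bsub>M\<^esub> e i) A"
  have "finsum M (\<lambda>i. a i \<odot>\<^bsub>M\<^esub> e i) A = finsum M (\<lambda>i. (a i \<ominus> b i) \<odot>\<^bsub>M\<^esub> e i \<oplus>\<^bsub>M\<^esub> b i \<odot>\<^bsub>M\<^esub> e i) A"
    using assms by (intro M.finsum_cong')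
      (auto simp: Pi_def smult_l_distr[symmetric] R.minus_eq R.a_assoc R.l_neg)
  also have "\<dots> = ?d \<oplus>\<^bsub>M\<^esub> ?b" using assms by (intro M.finsum_addf) (auto simp: Pi_def)
  finally have "finsum M (\<lambda>i. a i \<odot>\<^bsub>M\<^esub> e i) A = ?d \<oplus>\<^bsub>M\<^esub> ?b" .
  moreover have "?d \<in> carrier M" "?b \<in> carrier M" using assms by (auto intro!: M.finsum_closed)
  ultimately show ?thesis by (simp add: M.minus_eq M.a_assoc M.r_neg)
qed

lemma finsum_smult_delta:
  assumes "finite A" "j \<in> A" "c \<in> carrier R" "e \<in> A \<rightarrow> carrier M"
  shows "finsum M (\<lambda>i. (if i = j then c else \<zero>) \<odot>\<^bsub>M\<^esub> e i) A = c \<odot>\<^bsub>M\<^esub> e j"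
proof -
  have "finsum M (\<lambda>i. (if i = j then c else \<zero>) \<odot>\<^bsub>M\<^esub> e i) A = finsum M (\<lambda>i. if j = i then c \<odot>\<^bsub>M\<^esub> e i else \<zero>\<^bsub>M\<^esub>) A"
    using assms by (intro M.finsum_cong') (auto simp: Pi_def)
  also have "\<dots> = c \<odot>\<^bsub>M\<^esub> e j" using assms by (intro M.add.finprod_singleton) (auto simp: Pi_def)
  finally show ?thesis .
qed

text \<open>Associativity b (C e) = (b C) e for a row vector, a matrix and a column of module
  elements. In \<open>relations_trivial\<close> it is applied to M and also to R as a module over
  itself.\<close>

lemma finsum_smult_finsum:
  assumes "finite A" "finite B" "b \<in> A \<rightarrow> carrier R" "\<And>i l. i \<in> A \<Longrightarrow> l \<in> B \<Longrightarrow> c i l \<in> carrier R" "e \<in> B \<rightarrow> carrier M"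
  shows "finsum M (\<lambda>i. b i \<odot>\<^bsub>M\<^esub> finsum M (\<lambda>l. c i l \<odot>\<^bsub>M\<^esub> e l) B) A =
    finsum M (\<lambda>l. finsum R (\<lambda>i. b i \<otimes> c i l) A \<odot>\<^bsub>M\<^esub> e l) B"
  using assms(1,3,4)
proof (induction A rule: finite_induct)
  case empty
  show ?case using assms(5) by (auto simp: Pi_def intro!: M.add.finprod_one_eqI[symmetric])
next
  case (insert i A)
  have cl: "b j \<in> carrier R" "l \<in> B \<Longrightarrow> c j l \<in> carrier R" if "j \<in> insert i A" for j l
    using insert.prems that by auto
  have e: "e l \<in> carrier M" if "l \<in> B" for l using assms(5) that by auto
  have s: "finsum R (\<lambda>i. b i \<otimes> c i l) A \<in> carrier R" if "l \<in> B" for l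
    using cl that by (intro R.finsum_closed) auto
  have "finsum M (\<lambda>i. b i \<odot>\<^bsub>M\<^esub> finsum M (\<lambda>l. c i l \<odot>\<^bsub>M\<^esub> e l) B) (insert i A) =
    b i \<odot>\<^bsub>M\<^esub> finsum M (\<lambda>l. c i l \<odot>\<^bsub>M\<^esub> e l) B \<oplus>\<^bsub>M\<^esub> finsum M (\<lambda>i. b i \<odot>\<^bsub>M\<^esub> finsum M (\<lambda>l. c i l \<odot>\<^bsub>M\<^esub> e l) B) A"
    using insert.hyps cl e by (intro M.finsum_insert) (auto intro!: smult_closed M.finsum_closed)
  also have "b i \<odot>\<^bsub>M\<^esub> finsum M (\<lambda>l. c i l \<odot>\<^bsub>M\<^esub> e l) B = finsum M (\<lambda>l. (b i \<otimes> c i l) \<odot>\<^bsub>M\<^esub> e l) B"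
    using assms(2) cl[of i] e by (subst finsum_smult_ldistr) (auto simp: smult_assoc1 intro!: M.finsum_cong')
  also have "finsum M (\<lambda>i. b i \<odot>\<^bsub>M\<^esub> finsum M (\<lambda>l. c i l \<odot>\<^bsub>M\<^esub> e l) B) A =
    finsum M (\<lambda>l. finsum R (\<lambda>i. b i \<otimes> c i l) A \<odot>\<^bsub>M\<^esub> e l) B"
    by (rule insert.IH) (use cl in auto)
  also have "finsum M (\<lambda>l. (b i \<otimes> c i l) \<odot>\<^bsub>M\<^esub> e l) B \<oplus>\<^bsub>M\<^esub> \<dots> =
    finsum M (\<lambda>l. (b i \<otimes> c i l) \<odot>\<^bsub>M\<^esub> e l \<oplus>\<^bsub>M\<^esub> finsum R (\<lambda>i. b i \<otimes> c i l) A \<odot>\<^bsub>M\<^esub> e l) B"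
    using cl[of i] e s by (intro M.finsum_addf[symmetric]) auto
  also have "\<dots> = finsum M (\<lambda>l. finsum R (\<lambda>i. b i \<otimes> c i l) (insert i A) \<odot>\<^bsub>M\<^esub> e l) B"
  proof -
    have "finsum R (\<lambda>i. b i \<otimes> c i l) (insert i A) = b i \<otimes> c i l \<oplus> finsum R (\<lambda>i. b i \<otimes> c i l) A" if "l \<in> B" for l
      using insert.hyps cl that by (intro R.finsum_insert) auto
    then show ?thesis using cl[of i] e s by (intro M.finsum_cong') (auto simp: smult_l_distr)
  qed
  finally show ?case .
qed

end

section \<open>The Koszul complex\<close>

text \<open>A chain of the Koszul complex of \<open>x\<^sub>1, \<dots>, x\<^sub>g\<close> assigns a module element to every subset of the
  indices, coded as a boolean list of length \<open>g\<close>. The differential is the one of the mapping cone of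
  \<open>x\<^sub>1\<close> on the Koszul complex of \<open>x\<^sub>2, \<dots>, x\<^sub>g\<close>, so that no sign bookkeeping is needed.\<close>

primrec koszul_d :: "('a, 'c, 'd) module_scheme \<Rightarrow> 'a list \<Rightarrow> (bool list \<Rightarrow> 'c) \<Rightarrow> bool list \<Rightarrow> 'c" where
  "koszul_d M [] f s = \<zero>\<^bsub>M\<^esub>"
| "koszul_d M (x # xs) f s = (case s of [] \<Rightarrow> \<zero>\<^bsub>M\<^esub> | b # t \<Rightarrow>
     if b then \<ominus>\<^bsub>M\<^esub> koszul_d M xs (\<lambda>u. f (True # u)) t
     else koszul_d M xs (\<lambda>u. f (False # u)) t \<oplus>\<^bsub>M\<^esub> x \<odot>\<^bsub>M\<^esub> f (True # t))"

text \<open>With \<open>y = \<Sum> a\<^sub>i x\<^sub>i\<close> this satisfies \<open>d h + h d = y\<close>.\<close>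

primrec koszul_h :: "('a, 'c, 'd) module_scheme \<Rightarrow> 'a list \<Rightarrow> (bool list \<Rightarrow> 'c) \<Rightarrow> bool list \<Rightarrow> 'c" where
  "koszul_h M [] f s = \<zero>\<^bsub>M\<^esub>"
| "koszul_h M (a # as) f s = (case s of [] \<Rightarrow> \<zero>\<^bsub>M\<^esub> | b # t \<Rightarrow>
     if b then a \<odot>\<^bsub>M\<^esub> f (False # t) \<ominus>\<^bsub>M\<^esub> koszul_h M as (\<lambda>u. f (True # u)) t
     else koszul_h M as (\<lambda>u. f (False # u)) t)"

abbreviation weight :: "bool list \<Rightarrow> nat" where "weight s \<equiv> count_list s True"

text \<open>The complex with coefficients in the quotient by \<open>L\<close> is exact in all degrees from \<open>j\<close> on. Chains are
  not required to be homogeneous: weight bounds from below suffice.\<close>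

definition koszul_exact :: "('a, 'c, 'd) module_scheme \<Rightarrow> 'a list \<Rightarrow> 'c set \<Rightarrow> nat \<Rightarrow> bool" where
  "koszul_exact M xs L j \<longleftrightarrow>
    (\<forall>f. (\<forall>s. f s \<in> carrier M) \<and> (\<forall>s. weight s < j \<longrightarrow> f s = \<zero>\<^bsub>M\<^esub>) \<and>
         (\<forall>s. length s = length xs \<longrightarrow> koszul_d M xs f s \<in> L) \<longrightarrow>
      (\<exists>h. (\<forall>s. h s \<in> carrier M) \<and> (\<forall>s. weight s < Suc j \<longrightarrow> h s = \<zero>\<^bsub>M\<^esub>) \<and>
         (\<forall>s. length s = length xs \<longrightarrow> f s \<ominus>\<^bsub>M\<^esub> koszul_d M xs h s \<in> L)))"

context module
begin

lemma a_inv_zero [simp]: "\<ominus>\<^bsub>M\<^esub> \<zero>\<^bsub>M\<^esub> = \<zero>\<^bsub>M\<^esub>"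
  using M.l_neg[OF M.zero_closed] M.r_zero[OF M.a_inv_closed[OF M.zero_closed]] by simp

lemma add_diff_cancel_left: "a \<in> carrier M \<Longrightarrow> b \<in> carrier M \<Longrightarrow> b = (a \<oplus>\<^bsub>M\<^esub> b) \<ominus>\<^bsub>M\<^esub> a"
  by (simp add: M.minus_eq M.a_comm[of a b] M.a_assoc M.r_neg)

lemma diff_add_diff: "\<lbrakk>a \<in> carrier M; b \<in> carrier M; c \<in> carrier M\<rbrakk> \<Longrightarrow>
   (a \<ominus>\<^bsub>M\<^esub> b) \<oplus>\<^bsub>M\<^esub> (b \<ominus>\<^bsub>M\<^esub> c) = a \<ominus>\<^bsub>M\<^esub> c"
  by (simp add: M.minus_eq M.a_assoc M.r_neg1)

lemma smult_r_diff: "\<lbrakk>a \<in> carrier R; b \<in> carrier M; c \<in> carrier M\<rbrakk> \<Longrightarrow>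
   a \<odot>\<^bsub>M\<^esub> (b \<ominus>\<^bsub>M\<^esub> c) = a \<odot>\<^bsub>M\<^esub> b \<ominus>\<^bsub>M\<^esub> a \<odot>\<^bsub>M\<^esub> c"
  unfolding M.minus_eq by (simp add: smult_r_distr smult_r_minus)

lemma smult_commute: "\<lbrakk>a \<in> carrier R; b \<in> carrier R; c \<in> carrier M\<rbrakk> \<Longrightarrow>
   a \<odot>\<^bsub>M\<^esub> (b \<odot>\<^bsub>M\<^esub> c) = b \<odot>\<^bsub>M\<^esub> (a \<odot>\<^bsub>M\<^esub> c)"
  by (metis smult_assoc1 R.m_comm)

lemma koszul_d_closed:
  "set xs \<subseteq> carrier R \<Longrightarrow> (\<And>s. f s \<in> carrier M) \<Longrightarrow> koszul_d M xs f s \<in> carrier M"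
  by (induction xs arbitrary: f s) (auto split: list.split)

lemma koszul_h_closed:
  "set as \<subseteq> carrier R \<Longrightarrow> (\<And>s. f s \<in> carrier M) \<Longrightarrow> koszul_h M as f s \<in> carrier M"
  by (induction as arbitrary: f s) (auto split: list.split)

text \<open>At a list as long as \<open>xs\<close> the differential reads only entries at lists of
  that same length. Chains are total functions, so membership in L must be restricted to these
  lists, while membership in the carrier is demanded everywhere to keep closure facts free of side
  conditions.\<close>

lemma koszul_d_mem:
  assumes L: "submodule L R M" and "set xs \<subseteq> carrier R" "\<And>s. length s = length xs \<Longrightarrow> f s \<in> L"
    "length s = length xs"
  shows "koszul_d M xs f s \<in> L"
  using assms(2-)
proof (induction xs arbitrary: f s)
  case Nil then show ?case using submodule_zero[OF L] by simp
next
  case (Cons x xs)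
  then obtain b t where s: "s = b # t" "length t = length xs" by (auto simp: length_Suc_conv)
  have 1: "koszul_d M xs (\<lambda>u. f (b # u)) t \<in> L" for b by (rule Cons.IH) (use Cons.prems s in auto)
  show ?case using Cons.prems s 1 submoduleE(3,4,5)[OF L] by auto
qed

lemma koszul_h_mem:
  assumes L: "submodule L R M" and "set as \<subseteq> carrier R" "\<And>s. length s = length as \<Longrightarrow> f s \<in> L"
    "length s = length as"
  shows "koszul_h M as f s \<in> L"
  using assms(2-)
proof (induction as arbitrary: f s)
  case Nil then show ?case using submodule_zero[OF L] by simp
next
  case (Cons x xs)
  then obtain b t where s: "s = b # t" "length t = length xs" by (auto simp: length_Suc_conv)
  have 1: "koszul_h M xs (\<lambda>u. f (b # u)) t \<in> L" for b by (rule Cons.IH) (use Cons.prems s in auto)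
  show ?case using Cons.prems s 1 submodule_minus[OF L] submoduleE(4)[OF L] by auto
qed

lemma koszul_d_add:
  assumes "set xs \<subseteq> carrier R" "\<And>s. f s \<in> carrier M" "\<And>s. g s \<in> carrier M"
  shows "koszul_d M xs (\<lambda>s. f s \<oplus>\<^bsub>M\<^esub> g s) s = koszul_d M xs f s \<oplus>\<^bsub>M\<^esub> koszul_d M xs g s"
  using assms
proof (induction xs arbitrary: f g s)
  case (Cons x xs)
  have IH: "koszul_d M xs (\<lambda>s. f (b # s) \<oplus>\<^bsub>M\<^esub> g (b # s)) s =
     koszul_d M xs (\<lambda>u. f (b # u)) s \<oplus>\<^bsub>M\<^esub> koszul_d M xs (\<lambda>u. g (b # u)) s" for b s
    by (rule Cons.IH) (use Cons.prems in auto)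
  have "koszul_d M xs (\<lambda>u. f (b # u)) s \<in> carrier M" "koszul_d M xs (\<lambda>u. g (b # u)) s \<in> carrier M" for b s
    using Cons.prems by (auto intro: koszul_d_closed)
  then show ?case using Cons.prems
    by (auto split: list.split simp: IH M.minus_add smult_r_distr add_add_swap)
qed simp

lemma koszul_d_smult:
  assumes "set xs \<subseteq> carrier R" "\<And>s. f s \<in> carrier M" "a \<in> carrier R"
  shows "koszul_d M xs (\<lambda>s. a \<odot>\<^bsub>M\<^esub> f s) s = a \<odot>\<^bsub>M\<^esub> koszul_d M xs f s"
  using assms
proof (induction xs arbitrary: f s)
  case (Cons x xs)
  have IH: "koszul_d M xs (\<lambda>s. a \<odot>\<^bsub>M\<^esub> f (b # s)) s = a \<odot>\<^bsub>M\<^esub> koszul_d M xs (\<lambda>u. f (b # u)) s" for b s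
    by (rule Cons.IH) (use Cons.prems in auto)
  have "koszul_d M xs (\<lambda>u. f (b # u)) s \<in> carrier M" for b s
    using Cons.prems by (auto intro: koszul_d_closed)
  then show ?case using Cons.prems
    by (auto split: list.split simp: IH smult_r_distr smult_r_minus smult_commute)
qed simp

lemma koszul_d_uminus:
  assumes "set xs \<subseteq> carrier R" "\<And>s. f s \<in> carrier M"
  shows "koszul_d M xs (\<lambda>s. \<ominus>\<^bsub>M\<^esub> f s) s = \<ominus>\<^bsub>M\<^esub> koszul_d M xs f s"
proof -
  have 1: "\<ominus>\<^bsub>M\<^esub> v = (\<ominus> \<one>) \<odot>\<^bsub>M\<^esub> v" if "v \<in> carrier M" for v using that by (simp add: smult_l_minus)
  show ?thesis using koszul_d_smult[of xs f "\<ominus> \<one>" s] assms koszul_d_closed[of xs f s]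
    by (simp add: 1[symmetric])
qed

lemma koszul_d_diff:
  assumes "set xs \<subseteq> carrier R" "\<And>s. f s \<in> carrier M" "\<And>s. g s \<in> carrier M"
  shows "koszul_d M xs (\<lambda>s. f s \<ominus>\<^bsub>M\<^esub> g s) s = koszul_d M xs f s \<ominus>\<^bsub>M\<^esub> koszul_d M xs g s"
  unfolding M.minus_eq using assms by (simp add: koszul_d_add koszul_d_uminus)

lemma koszul_h_add:
  assumes "set as \<subseteq> carrier R" "\<And>s. f s \<in> carrier M" "\<And>s. g s \<in> carrier M"
  shows "koszul_h M as (\<lambda>s. f s \<oplus>\<^bsub>M\<^esub> g s) s = koszul_h M as f s \<oplus>\<^bsub>M\<^esub> koszul_h M as g s"
  using assms
proof (induction as arbitrary: f g s)
  case (Cons x as)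
  have IH: "koszul_h M as (\<lambda>s. f (b # s) \<oplus>\<^bsub>M\<^esub> g (b # s)) s =
     koszul_h M as (\<lambda>u. f (b # u)) s \<oplus>\<^bsub>M\<^esub> koszul_h M as (\<lambda>u. g (b # u)) s" for b s
    by (rule Cons.IH) (use Cons.prems in auto)
  have "koszul_h M as (\<lambda>u. f (b # u)) s \<in> carrier M" "koszul_h M as (\<lambda>u. g (b # u)) s \<in> carrier M" for b s
    using Cons.prems by (auto intro: koszul_h_closed)
  then show ?case using Cons.prems
    by (auto split: list.split simp: IH M.minus_eq M.minus_add smult_r_distr add_add_swap)
qed simp

lemma koszul_h_smult:
  assumes "set as \<subseteq> carrier R" "\<And>s. f s \<in> carrier M" "a \<in> carrier R"
  shows "koszul_h M as (\<lambda>s. a \<odot>\<^bsub>M\<^esub> f s) s = a \<odot>\<^bsub>M\<^esub> koszul_h M as f s"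
  using assms
proof (induction as arbitrary: f s)
  case (Cons x as)
  have IH: "koszul_h M as (\<lambda>s. a \<odot>\<^bsub>M\<^esub> f (b # s)) s = a \<odot>\<^bsub>M\<^esub> koszul_h M as (\<lambda>u. f (b # u)) s" for b s
    by (rule Cons.IH) (use Cons.prems in auto)
  have "koszul_h M as (\<lambda>u. f (b # u)) s \<in> carrier M" for b s
    using Cons.prems by (auto intro: koszul_h_closed)
  then show ?case using Cons.prems
    by (auto split: list.split simp: IH smult_r_diff smult_commute)
qed simp

lemma koszul_h_uminus:
  assumes "set as \<subseteq> carrier R" "\<And>s. f s \<in> carrier M"
  shows "koszul_h M as (\<lambda>s. \<ominus>\<^bsub>M\<^esub> f s) s = \<ominus>\<^bsub>M\<^esub> koszul_h M as f s"
proof -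
  have 1: "\<ominus>\<^bsub>M\<^esub> v = (\<ominus> \<one>) \<odot>\<^bsub>M\<^esub> v" if "v \<in> carrier M" for v using that by (simp add: smult_l_minus)
  show ?thesis using koszul_h_smult[of as f "\<ominus> \<one>" s] assms koszul_h_closed[of as f s]
    by (simp add: 1[symmetric])
qed

text \<open>With u and v the restrictions of f to lists beginning with \<open>False\<close> and
  \<open>True\<close>, the differential is (d u + x v, - d v). Applying it twice leaves d (x v) - x
  (d v) in the first component, which cancels by linearity; this is what the minus sign is
  for.\<close>

lemma koszul_d_d:
  assumes "set xs \<subseteq> carrier R" "\<And>s. f s \<in> carrier M"
  shows "koszul_d M xs (koszul_d M xs f) s = \<zero>\<^bsub>M\<^esub>"
  using assms
proof (induction xs arbitrary: f s)
  case (Cons x xs)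
  let ?u = "\<lambda>u. f (False # u)" and ?v = "\<lambda>u. f (True # u)"
  have cl: "koszul_d M xs ?u s \<in> carrier M" "koszul_d M xs ?v s \<in> carrier M" for s
    using Cons.prems by (auto intro: koszul_d_closed)
  have IH: "koszul_d M xs (koszul_d M xs ?u) s = \<zero>\<^bsub>M\<^esub>" "koszul_d M xs (koszul_d M xs ?v) s = \<zero>\<^bsub>M\<^esub>" for s
    using Cons by auto
  have T: "koszul_d M xs (\<lambda>u. koszul_d M (x # xs) f (True # u)) s = \<zero>\<^bsub>M\<^esub>" for s
    using koszul_d_uminus[of xs "koszul_d M xs ?v" s] Cons.prems cl IH by simp
  have F: "koszul_d M xs (\<lambda>u. koszul_d M (x # xs) f (False # u)) s = x \<odot>\<^bsub>M\<^esub> koszul_d M xs ?v s" for s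
    using koszul_d_add[of xs "koszul_d M xs ?u" "\<lambda>s. x \<odot>\<^bsub>M\<^esub> ?v s" s] koszul_d_smult[of xs ?v x s]
      Cons.prems cl IH by simp
  show ?case
  proof (cases s)
    case (Cons b t)
    have "koszul_d M (x # xs) (koszul_d M (x # xs) f) s = \<zero>\<^bsub>M\<^esub>" if "b"
      using that Cons T[of t] by (simp del: koszul_d.simps(2) add: koszul_d.simps(2)[of M x xs "koszul_d M (x # xs) f"])
    moreover have "koszul_d M (x # xs) (koszul_d M (x # xs) f) s = \<zero>\<^bsub>M\<^esub>" if "\<not> b"
    proof -
      have "koszul_d M (x # xs) (koszul_d M (x # xs) f) s =
        x \<odot>\<^bsub>M\<^esub> koszul_d M xs ?v t \<oplus>\<^bsub>M\<^esub> x \<odot>\<^bsub>M\<^esub> koszul_d M (x # xs) f (True # t)"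
        using that Cons F[of t] by (simp del: koszul_d.simps(2) add: koszul_d.simps(2)[of M x xs "koszul_d M (x # xs) f"])
      also have "\<dots> = \<zero>\<^bsub>M\<^esub>" using cl Cons.prems by (simp add: smult_r_minus M.r_neg)
      finally show ?thesis .
    qed
    ultimately show ?thesis by blast
  qed simp
qed simp

text \<open>Consequence: the ideal of \<open>xs\<close> annihilates Koszul homology. The list
  \<open>as\<close> holds the coefficients of y and is independent of the chain f. The identity is
  claimed only at lists as long as \<open>xs\<close>; at the wrong lengths d and h give the default
  value 0.\<close>

lemma koszul_homotopy:
  assumes "set xs \<subseteq> carrier R" "y \<in> lin_span (ring_as_module R) (carrier R) xs"
  shows "\<exists>as. length as = length xs \<and> set as \<subseteq> carrier R \<and>
    (\<forall>f s. (\<forall>s. f s \<in> carrier M) \<longrightarrow> length s = length xs \<longrightarrow>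
      koszul_d M xs (koszul_h M as f) s \<oplus>\<^bsub>M\<^esub> koszul_h M as (koszul_d M xs f) s = y \<odot>\<^bsub>M\<^esub> f s)"
  using assms
proof (induction xs arbitrary: y)
  case Nil
  then show ?case by (auto simp: ring_as_module_def)
next
  case (Cons x xs)
  obtain a z where a: "a \<in> carrier R" "z \<in> lin_span (ring_as_module R) (carrier R) xs" "y = a \<otimes> x \<oplus> z"
    using Cons.prems(2) by (auto simp: ring_as_module_def)
  obtain as where as: "length as = length xs" "set as \<subseteq> carrier R" and
    H: "\<And>f s. (\<And>s. f s \<in> carrier M) \<Longrightarrow> length s = length xs \<Longrightarrow>
      koszul_d M xs (koszul_h M as f) s \<oplus>\<^bsub>M\<^esub> koszul_h M as (koszul_d M xs f) s = z \<odot>\<^bsub>M\<^esub> f s"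
    using Cons.IH[of z] Cons.prems a by auto
  have x: "x \<in> carrier R" and xs: "set xs \<subseteq> carrier R" using Cons.prems by auto
  have z: "z \<in> carrier R" using a(2) xs
    by (induction xs arbitrary: z) (auto simp: ring_as_module_def)
  have "koszul_d M (x # xs) (koszul_h M (a # as) f) s \<oplus>\<^bsub>M\<^esub> koszul_h M (a # as) (koszul_d M (x # xs) f) s
      = y \<odot>\<^bsub>M\<^esub> f s"
    if f: "\<And>s. f s \<in> carrier M" and s: "length s = length (x # xs)" for f s
  proof -
    obtain b t where bt: "s = b # t" and t: "length t = length xs" using s by (auto simp: length_Suc_conv)
    let ?u = "\<lambda>u. f (False # u)" and ?v = "\<lambda>u. f (True # u)"
    let ?d = "koszul_d M xs" and ?h = "koszul_h M as"
    have cl: "?d ?u s \<in> carrier M" "?d ?v s \<in> carrier M" "?h ?u s \<in> carrier M" "?h ?v s \<in> carrier M"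
      "?d (?h ?u) s \<in> carrier M" "?d (?h ?v) s \<in> carrier M" "?h (?d ?u) s \<in> carrier M" "?h (?d ?v) s \<in> carrier M" for s
      using f xs as by (auto intro!: koszul_d_closed koszul_h_closed)
    have hf: "(\<lambda>u. koszul_h M (a # as) f (False # u)) = ?h ?u"
      "(\<lambda>u. koszul_h M (a # as) f (True # u)) = (\<lambda>u. a \<odot>\<^bsub>M\<^esub> ?u u \<ominus>\<^bsub>M\<^esub> ?h ?v u)" by auto
    have df: "(\<lambda>u. koszul_d M (x # xs) f (False # u)) = (\<lambda>u. ?d ?u u \<oplus>\<^bsub>M\<^esub> x \<odot>\<^bsub>M\<^esub> ?v u)"
      "(\<lambda>u. koszul_d M (x # xs) f (True # u)) = (\<lambda>u. \<ominus>\<^bsub>M\<^esub> ?d ?v u)" by auto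
    have yf: "y \<odot>\<^bsub>M\<^esub> f w = (a \<otimes> x) \<odot>\<^bsub>M\<^esub> f w \<oplus>\<^bsub>M\<^esub> z \<odot>\<^bsub>M\<^esub> f w" for w
      using a x z f by (simp add: smult_l_distr)
    note unf = koszul_d.simps(2)[of M x xs "koszul_h M (a # as) f"] koszul_h.simps(2)[of M a as "koszul_d M (x # xs) f"]
    show ?thesis
    proof (cases b)
      case True
      have 1: "?d (\<lambda>u. a \<odot>\<^bsub>M\<^esub> ?u u \<ominus>\<^bsub>M\<^esub> ?h ?v u) t = a \<odot>\<^bsub>M\<^esub> ?d ?u t \<ominus>\<^bsub>M\<^esub> ?d (?h ?v) t"
        using xs f cl a by (simp add: koszul_d_diff koszul_d_smult)
      have 2: "?h (\<lambda>u. \<ominus>\<^bsub>M\<^esub> ?d ?v u) t = \<ominus>\<^bsub>M\<^esub> ?h (?d ?v) t"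
        using as cl by (simp add: koszul_h_uminus)
      have "koszul_d M (x # xs) (koszul_h M (a # as) f) s \<oplus>\<^bsub>M\<^esub> koszul_h M (a # as) (koszul_d M (x # xs) f) s
        = \<ominus>\<^bsub>M\<^esub> (a \<odot>\<^bsub>M\<^esub> ?d ?u t \<ominus>\<^bsub>M\<^esub> ?d (?h ?v) t) \<oplus>\<^bsub>M\<^esub>
          (a \<odot>\<^bsub>M\<^esub> (?d ?u t \<oplus>\<^bsub>M\<^esub> x \<odot>\<^bsub>M\<^esub> ?v t) \<ominus>\<^bsub>M\<^esub> \<ominus>\<^bsub>M\<^esub> ?h (?d ?v) t)"
        using True bt unfolding unf by (simp del: koszul_d.simps(2) koszul_h.simps(2) add: hf df 1 2)
          (simp)
      also have "\<dots> = (\<ominus>\<^bsub>M\<^esub> (a \<odot>\<^bsub>M\<^esub> ?d ?u t) \<oplus>\<^bsub>M\<^esub> a \<odot>\<^bsub>M\<^esub> ?d ?u t) \<oplus>\<^bsub>M\<^esub> (a \<otimes> x) \<odot>\<^bsub>M\<^esub> ?v t \<oplus>\<^bsub>M\<^esub>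
          (?d (?h ?v) t \<oplus>\<^bsub>M\<^esub> ?h (?d ?v) t)"
        using cl a x f by (simp add: M.minus_eq M.minus_add smult_r_distr smult_assoc1 M.a_ac)
      also have "\<dots> = y \<odot>\<^bsub>M\<^esub> f s"
        using H[of ?v t] f t cl a x z True bt yf[of s] by (simp add: M.l_neg)
      finally show ?thesis .
    next
      case False
      have 1: "?h (\<lambda>u. ?d ?u u \<oplus>\<^bsub>M\<^esub> x \<odot>\<^bsub>M\<^esub> ?v u) t = ?h (?d ?u) t \<oplus>\<^bsub>M\<^esub> x \<odot>\<^bsub>M\<^esub> ?h ?v t"
        using as f cl x by (simp add: koszul_h_add koszul_h_smult)
      have "koszul_d M (x # xs) (koszul_h M (a # as) f) s \<oplus>\<^bsub>M\<^esub> koszul_h M (a # as) (koszul_d M (x # xs) f) s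
        = (?d (?h ?u) t \<oplus>\<^bsub>M\<^esub> x \<odot>\<^bsub>M\<^esub> (a \<odot>\<^bsub>M\<^esub> ?u t \<ominus>\<^bsub>M\<^esub> ?h ?v t)) \<oplus>\<^bsub>M\<^esub> (?h (?d ?u) t \<oplus>\<^bsub>M\<^esub> x \<odot>\<^bsub>M\<^esub> ?h ?v t)"
        using False bt unfolding unf by (simp del: koszul_d.simps(2) koszul_h.simps(2) add: hf df 1)
          (simp)
      also have "\<dots> = (?d (?h ?u) t \<oplus>\<^bsub>M\<^esub> ?h (?d ?u) t) \<oplus>\<^bsub>M\<^esub> (a \<otimes> x) \<odot>\<^bsub>M\<^esub> ?u t \<oplus>\<^bsub>M\<^esub>
          (\<ominus>\<^bsub>M\<^esub> (x \<odot>\<^bsub>M\<^esub> ?h ?v t) \<oplus>\<^bsub>M\<^esub> x \<odot>\<^bsub>M\<^esub> ?h ?v t)"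
        using cl a x f by (simp add: M.minus_eq smult_r_distr smult_r_minus smult_assoc1[symmetric] R.m_comm[of x a] M.a_ac)
      also have "\<dots> = y \<odot>\<^bsub>M\<^esub> f s"
        using H[of ?u t] f t cl a x z False bt yf[of s] by (simp add: M.l_neg M.r_neg M.a_comm)
      finally show ?thesis .
    qed
  qed
  then have "\<forall>f s. (\<forall>s. f s \<in> carrier M) \<longrightarrow> length s = length (x # xs) \<longrightarrow>
      koszul_d M (x # xs) (koszul_h M (a # as) f) s \<oplus>\<^bsub>M\<^esub> koszul_h M (a # as) (koszul_d M (x # xs) f) s
      = y \<odot>\<^bsub>M\<^esub> f s" by blast
  moreover have "length (a # as) = length (x # xs)" "set (a # as) \<subseteq> carrier R" using as a(1) by auto
  ultimately show ?case by blast
qed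

text \<open>The homotopy reads entries with one \<open>True\<close> fewer, the differential entries
  with one \<open>True\<close> more. This lemma and the next two are all the grading that the
  exactness arguments use.\<close>

lemma koszul_h_weight:
  assumes "set as \<subseteq> carrier R" "\<And>s. weight s < j \<Longrightarrow> f s = \<zero>\<^bsub>M\<^esub>" "weight s < Suc j"
  shows "koszul_h M as f s = \<zero>\<^bsub>M\<^esub>"
  using assms
proof (induction as arbitrary: f s j)
  case (Cons a as)
  show ?case
  proof (cases s)
    case s: (Cons b t)
    show ?thesis
    proof (cases b)
      case True
      then have t: "weight t < j" using Cons.prems s by simp
      then obtain j' where j: "j = Suc j'" by (cases j) auto
      have "koszul_h M as (\<lambda>u. f (True # u)) t = \<zero>\<^bsub>M\<^esub>"
        by (rule Cons.IH[of j']) (use Cons.prems t j in auto)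
      then show ?thesis using Cons.prems s True t by (simp add: M.minus_eq)
    next
      case False
      have "koszul_h M as (\<lambda>u. f (False # u)) t = \<zero>\<^bsub>M\<^esub>"
        by (rule Cons.IH[of j]) (use Cons.prems s False in auto)
      then show ?thesis using s False by simp
    qed
  qed simp
qed simp

lemma koszul_d_weight_below:
  assumes "set xs \<subseteq> carrier R" "\<And>s. weight s < Suc j \<Longrightarrow> f s = \<zero>\<^bsub>M\<^esub>" "weight s < j"
  shows "koszul_d M xs f s = \<zero>\<^bsub>M\<^esub>"
  using assms
proof (induction xs arbitrary: f s j)
  case (Cons x xs)
  show ?case
  proof (cases s)
    case s: (Cons b t)
    show ?thesis
    proof (cases b)
      case True
      then obtain j' where j: "j = Suc j'" using Cons.prems by (cases j) auto
      have "koszul_d M xs (\<lambda>u. f (True # u)) t = \<zero>\<^bsub>M\<^esub>"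
        by (rule Cons.IH[of j']) (use Cons.prems s True j in auto)
      then show ?thesis using s True by simp
    next
      case False
      have "koszul_d M xs (\<lambda>u. f (False # u)) t = \<zero>\<^bsub>M\<^esub>"
        by (rule Cons.IH[of j]) (use Cons.prems s False in auto)
      then show ?thesis using Cons.prems s False by simp
    qed
  qed simp
qed simp

lemma koszul_d_weight_above:
  assumes "set xs \<subseteq> carrier R" "\<And>s. j < weight s \<Longrightarrow> f s = \<zero>\<^bsub>M\<^esub>" "j \<le> weight s"
  shows "koszul_d M xs f s = \<zero>\<^bsub>M\<^esub>"
  using assms
proof (induction xs arbitrary: f s j)
  case (Cons x xs)
  show ?case
  proof (cases s)
    case s: (Cons b t)
    show ?thesis
    proof (cases b)
      case True
      have "koszul_d M xs (\<lambda>u. f (True # u)) t = \<zero>\<^bsub>M\<^esub>"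
      proof (cases j)
        case 0
        \<comment> \<open>There is no j - 1 to descend to. But every list beginning with
          \<open>True\<close> has positive weight, so all these entries vanish and the induction
          hypothesis for j = 0 applies to the zero chain.\<close>
        have "koszul_d M xs (\<lambda>u. f (True # u)) t = koszul_d M xs (\<lambda>u. \<zero>\<^bsub>M\<^esub>) t"
          by (rule arg_cong[where f = "\<lambda>f. koszul_d M xs f t"]) (use Cons.prems 0 in auto)
        also have "\<dots> = \<zero>\<^bsub>M\<^esub>" by (rule Cons.IH[of 0]) (use Cons.prems in auto)
        finally show ?thesis .
      next
        case (Suc j')
        then show ?thesis by (intro Cons.IH[of j']) (use Cons.prems s True in auto)
      qed
      then show ?thesis using s True by simp
    next
      case False
      have "koszul_d M xs (\<lambda>u. f (False # u)) t = \<zero>\<^bsub>M\<^esub>"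
        by (rule Cons.IH[of j]) (use Cons.prems s False in auto)
      then show ?thesis using Cons.prems s False by simp
    qed
  qed simp
qed simp

lemma koszul_d_zero: "set xs \<subseteq> carrier R \<Longrightarrow> koszul_d M xs (\<lambda>_. \<zero>\<^bsub>M\<^esub>) s = \<zero>\<^bsub>M\<^esub>"
  by (rule koszul_d_weight_above[where j = 0]) auto

text \<open>No list as long as \<open>xs\<close> has weight above \<open>length xs\<close>, so f
  vanishes wherever it is inspected and the zero chain bounds it. This starts the descending
  induction in \<open>koszul_exact_regular\<close>.\<close>

lemma koszul_exact_top:
  assumes xs: "set xs \<subseteq> carrier R" "length xs < j" and 0: "\<zero>\<^bsub>M\<^esub> \<in> L"
  shows "koszul_exact M xs L j"
  unfolding koszul_exact_def
proof (intro allI impI)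
  fix f assume f: "(\<forall>s. f s \<in> carrier M) \<and> (\<forall>s. weight s < j \<longrightarrow> f s = \<zero>\<^bsub>M\<^esub>) \<and>
         (\<forall>s. length s = length xs \<longrightarrow> koszul_d M xs f s \<in> L)"
  have "f s = \<zero>\<^bsub>M\<^esub>" if "length s = length xs" for s
    using f xs(2) that count_le_length[of s True] by auto
  then show "\<exists>h. (\<forall>s. h s \<in> carrier M) \<and> (\<forall>s. weight s < Suc j \<longrightarrow> h s = \<zero>\<^bsub>M\<^esub>) \<and>
         (\<forall>s. length s = length xs \<longrightarrow> f s \<ominus>\<^bsub>M\<^esub> koszul_d M xs h s \<in> L)"
    using 0 koszul_d_zero[OF xs(1)] by (intro exI[of _ "\<lambda>_. \<zero>\<^bsub>M\<^esub>"]) (auto simp: M.minus_eq)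
qed

text \<open>Together with L \<subseteq> L', the assumptions \<open>yL'\<close> and
  \<open>L'D\<close> say L' = L + yM; \<open>reg\<close> says that y is regular on M/L. In the long
  exact sequence of 0 -> M/L -> M/L -> M/L' -> 0, with y as the first map, vanishing of the homology
  of M/L' from degree j + 1 on makes y injective on the homology of M/L from degree j on. A power of
  y lies in the ideal of \<open>xs\<close> and annihilates that homology, which is therefore
  zero.\<close>

lemma koszul_exact_step:
  assumes xs: "set xs \<subseteq> carrier R" and L: "submodule L R M" and L': "submodule L' R M" "L \<subseteq> L'"
    and y: "y \<in> carrier R" "y [^] (k::nat) \<in> lin_span (ring_as_module R) (carrier R) xs"
    and yL': "\<And>v. v \<in> carrier M \<Longrightarrow> y \<odot>\<^bsub>M\<^esub> v \<in> L'"
    and L'D: "\<And>l. l \<in> L' \<Longrightarrow> \<exists>u \<in> carrier M. l \<ominus>\<^bsub>M\<^esub> y \<odot>\<^bsub>M\<^esub> u \<in> L"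
    and reg: "\<And>v. v \<in> carrier M \<Longrightarrow> y \<odot>\<^bsub>M\<^esub> v \<in> L \<Longrightarrow> v \<in> L"
    and ex: "koszul_exact M xs L' (Suc j)"
  shows "koszul_exact M xs L j"
proof -
  have LM: "v \<in> carrier M" if "v \<in> L" for v using submoduleE(1)[OF L] that by auto
  define cycle where "cycle f \<longleftrightarrow> (\<forall>s. f s \<in> carrier M) \<and> (\<forall>s. weight s < j \<longrightarrow> f s = \<zero>\<^bsub>M\<^esub>) \<and>
         (\<forall>s. length s = length xs \<longrightarrow> koszul_d M xs f s \<in> L)" for f
  define bdry where "bdry f \<longleftrightarrow> (\<exists>h. (\<forall>s. h s \<in> carrier M) \<and> (\<forall>s. weight s < Suc j \<longrightarrow> h s = \<zero>\<^bsub>M\<^esub>) \<and>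
         (\<forall>s. length s = length xs \<longrightarrow> f s \<ominus>\<^bsub>M\<^esub> koszul_d M xs h s \<in> L))" for f
  \<comment> \<open>Injectivity of y on homology, as a diagram chase. Modulo L let y f = d g. Then d
    g lies in L', so g is a cycle for M/L' and g = d w + y u modulo L. Applying d gives d g = y d u
    modulo L, hence y (f - d u) lies in L and y can be cancelled.\<close>
  have key: "bdry f" if f: "cycle f" and yf: "bdry (\<lambda>s. y \<odot>\<^bsub>M\<^esub> f s)" for f
  proof -
    have fM: "\<And>s. f s \<in> carrier M" and fj: "\<And>s. weight s < j \<Longrightarrow> f s = \<zero>\<^bsub>M\<^esub>"
      and df: "\<And>s. length s = length xs \<Longrightarrow> koszul_d M xs f s \<in> L" using f by (auto simp: cycle_def)
    obtain g where gM: "\<And>s. g s \<in> carrier M" and gj: "\<And>s. weight s < Suc j \<Longrightarrow> g s = \<zero>\<^bsub>M\<^esub>"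
      and yfg: "\<And>s. length s = length xs \<Longrightarrow> y \<odot>\<^bsub>M\<^esub> f s \<ominus>\<^bsub>M\<^esub> koszul_d M xs g s \<in> L"
      using yf by (auto simp: bdry_def)
    have dgM: "koszul_d M xs g s \<in> carrier M" for s using xs gM by (rule koszul_d_closed)
    have "koszul_d M xs g s \<in> L'" if s: "length s = length xs" for s
    proof -
      have "y \<odot>\<^bsub>M\<^esub> f s \<ominus>\<^bsub>M\<^esub> (y \<odot>\<^bsub>M\<^esub> f s \<ominus>\<^bsub>M\<^esub> koszul_d M xs g s) \<in> L'"
        by (rule submodule_minus[OF L'(1) yL'[OF fM] subsetD[OF L'(2) yfg[OF s]]])
      also have "y \<odot>\<^bsub>M\<^esub> f s \<ominus>\<^bsub>M\<^esub> (y \<odot>\<^bsub>M\<^esub> f s \<ominus>\<^bsub>M\<^esub> koszul_d M xs g s) = koszul_d M xs g s"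
        using dgM fM y by (simp add: M.minus_eq M.minus_add M.a_assoc[symmetric] M.r_neg)
      finally show ?thesis .
    qed
    then obtain w where wM: "\<And>s. w s \<in> carrier M" and wj: "\<And>s. weight s < Suc (Suc j) \<Longrightarrow> w s = \<zero>\<^bsub>M\<^esub>"
      and gw: "\<And>s. length s = length xs \<Longrightarrow> g s \<ominus>\<^bsub>M\<^esub> koszul_d M xs w s \<in> L'"
      using ex[unfolded koszul_exact_def, rule_format, of g] gM gj by auto
    have dwM: "koszul_d M xs w s \<in> carrier M" for s using xs wM by (rule koszul_d_closed)
    \<comment> \<open>The values of u are chosen list by list. Below weight \<open>Suc j\<close> the
      chain u has to vanish; there both g and d w vanish, so 0 is an admissible choice. At lists of
      the wrong length only the weight condition is imposed.\<close>
    have "\<exists>u\<in>carrier M. (weight s < Suc j \<longrightarrow> u = \<zero>\<^bsub>M\<^esub>) \<and>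
       (length s = length xs \<longrightarrow> (g s \<ominus>\<^bsub>M\<^esub> koszul_d M xs w s) \<ominus>\<^bsub>M\<^esub> y \<odot>\<^bsub>M\<^esub> u \<in> L)" for s
    proof (cases "weight s < Suc j")
      case True
      then have "g s \<ominus>\<^bsub>M\<^esub> koszul_d M xs w s = \<zero>\<^bsub>M\<^esub>"
        using gj koszul_d_weight_below[of xs "Suc j" w s] wj xs by (simp add: M.minus_eq)
      then show ?thesis using y submodule_zero[OF L] by (intro bexI[of _ "\<zero>\<^bsub>M\<^esub>"]) (auto simp: M.minus_eq)
    next
      case False
      show ?thesis
      proof (cases "length s = length xs")
        case True
        then show ?thesis using L'D[OF gw[OF True]] False by auto
      qed (use False in auto)
    qed
    then obtain u where uM: "\<And>s. u s \<in> carrier M" and uj: "\<And>s. weight s < Suc j \<Longrightarrow> u s = \<zero>\<^bsub>M\<^esub>"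
      and gu: "\<And>s. length s = length xs \<Longrightarrow> (g s \<ominus>\<^bsub>M\<^esub> koszul_d M xs w s) \<ominus>\<^bsub>M\<^esub> y \<odot>\<^bsub>M\<^esub> u s \<in> L"
      by metis
    have duM: "koszul_d M xs u s \<in> carrier M" for s using xs uM by (rule koszul_d_closed)
    have "f s \<ominus>\<^bsub>M\<^esub> koszul_d M xs u s \<in> L" if s: "length s = length xs" for s
    proof -
      let ?l = "\<lambda>s. (g s \<ominus>\<^bsub>M\<^esub> koszul_d M xs w s) \<ominus>\<^bsub>M\<^esub> y \<odot>\<^bsub>M\<^esub> u s"
      have lM: "\<And>s. ?l s \<in> carrier M" using gM dwM uM y by simp
      have dl: "koszul_d M xs ?l s \<in> L" by (rule koszul_d_mem[OF L xs gu s])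
      have "koszul_d M xs ?l s = (koszul_d M xs g s \<ominus>\<^bsub>M\<^esub> \<zero>\<^bsub>M\<^esub>) \<ominus>\<^bsub>M\<^esub> y \<odot>\<^bsub>M\<^esub> koszul_d M xs u s"
        using xs gM dwM uM y wM by (simp add: koszul_d_diff koszul_d_smult koszul_d_d)
      then have e: "koszul_d M xs ?l s = koszul_d M xs g s \<ominus>\<^bsub>M\<^esub> y \<odot>\<^bsub>M\<^esub> koszul_d M xs u s"
        using dgM by (simp add: M.minus_eq)
      have "y \<odot>\<^bsub>M\<^esub> (f s \<ominus>\<^bsub>M\<^esub> koszul_d M xs u s) =
         (y \<odot>\<^bsub>M\<^esub> f s \<ominus>\<^bsub>M\<^esub> koszul_d M xs g s) \<oplus>\<^bsub>M\<^esub> (koszul_d M xs g s \<ominus>\<^bsub>M\<^esub> y \<odot>\<^bsub>M\<^esub> koszul_d M xs u s)"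
        using y fM duM dgM by (simp only: smult_r_diff diff_add_diff smult_closed)
      also have "\<dots> \<in> L" using yfg[OF s] dl e submoduleE(5)[OF L] by simp
      finally have "y \<odot>\<^bsub>M\<^esub> (f s \<ominus>\<^bsub>M\<^esub> koszul_d M xs u s) \<in> L" .
      then show ?thesis by (rule reg[OF M.minus_closed[OF fM duM]])
    qed
    then show ?thesis unfolding bdry_def using uM uj by blast
  qed
  \<comment> \<open>Since y^i f is again a cycle, \<open>key\<close> strips one factor y at a
    time.\<close>
  have iter: "bdry f" if "cycle f" "bdry (\<lambda>s. (y [^] (i::nat)) \<odot>\<^bsub>M\<^esub> f s)" for f i
    using that
  proof (induction i)
    case 0
    then show ?case unfolding bdry_def cycle_def by simp
  next
    case (Suc i)
    have f: "\<And>s. f s \<in> carrier M" using Suc.prems by (simp add: cycle_def)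
    have "cycle (\<lambda>s. (y [^] i) \<odot>\<^bsub>M\<^esub> f s)"
      using Suc.prems(1) y xs submoduleE(4)[OF L] unfolding cycle_def by (auto simp: koszul_d_smult)
    moreover have "y [^] Suc i \<odot>\<^bsub>M\<^esub> f s = y \<odot>\<^bsub>M\<^esub> (y [^] i \<odot>\<^bsub>M\<^esub> f s)" for s
      using y f by (simp add: smult_assoc1[symmetric] R.m_comm)
    ultimately show ?case using key[of "\<lambda>s. (y [^] i) \<odot>\<^bsub>M\<^esub> f s"] Suc by simp
  qed
  obtain as where as: "length as = length xs" "set as \<subseteq> carrier R" and
    H: "\<And>f s. (\<And>s. f s \<in> carrier M) \<Longrightarrow> length s = length xs \<Longrightarrow>
      koszul_d M xs (koszul_h M as f) s \<oplus>\<^bsub>M\<^esub> koszul_h M as (koszul_d M xs f) s = y [^] k \<odot>\<^bsub>M\<^esub> f s"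
    using koszul_homotopy[OF xs y(2)] by blast
  \<comment> \<open>The homotopy for y^k gives y^k f - d (h f) = h (d f), and h (d f) has values in
    L because d f does.\<close>
  have "bdry (\<lambda>s. y [^] k \<odot>\<^bsub>M\<^esub> f s)" if "cycle f" for f
  proof -
    have f: "\<And>s. f s \<in> carrier M" "\<And>s. weight s < j \<Longrightarrow> f s = \<zero>\<^bsub>M\<^esub>"
      "\<And>s. length s = length xs \<Longrightarrow> koszul_d M xs f s \<in> L" using that by (auto simp: cycle_def)
    have cl: "koszul_h M as f s \<in> carrier M" "koszul_d M xs f s \<in> carrier M"
      "koszul_d M xs (koszul_h M as f) s \<in> carrier M" "koszul_h M as (koszul_d M xs f) s \<in> carrier M" for s
      using xs as(2) f(1) by (auto intro!: koszul_d_closed koszul_h_closed)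
    have "y [^] k \<odot>\<^bsub>M\<^esub> f s \<ominus>\<^bsub>M\<^esub> koszul_d M xs (koszul_h M as f) s \<in> L" if s: "length s = length xs" for s
    proof -
      have "koszul_h M as (koszul_d M xs f) s \<in> L" using L as f(3) s by (intro koszul_h_mem) auto
      also have "koszul_h M as (koszul_d M xs f) s = y [^] k \<odot>\<^bsub>M\<^esub> f s \<ominus>\<^bsub>M\<^esub> koszul_d M xs (koszul_h M as f) s"
        using add_diff_cancel_left[OF cl(3)[of s] cl(4)[of s]] H[of f s] f(1) s by simp
      finally show ?thesis .
    qed
    moreover have "koszul_h M as f s = \<zero>\<^bsub>M\<^esub>" if "weight s < Suc j" for s
      by (rule koszul_h_weight[OF as(2) f(2) that])
    ultimately show ?thesis unfolding bdry_def using cl(1) by (intro exI[of _ "koszul_h M as f"] conjI allI impI)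
  qed
  then have "\<forall>f. cycle f \<longrightarrow> bdry f" using iter by blast
  then show ?thesis by (simp only: koszul_exact_def cycle_def bdry_def)
qed

text \<open>The list \<open>replicate (length xs) False\<close> codes the empty set; there the
  differential of f is the sum of the x_i f({i}).\<close>

lemma koszul_d_replicate:
  assumes "set xs \<subseteq> carrier R" "L \<subseteq> carrier M" "\<And>s. length s = length xs \<Longrightarrow> f s \<in> L"
  shows "koszul_d M xs f (replicate (length xs) False) \<in> scaled_span M xs L"
  using assms(1,3)
proof (induction xs arbitrary: f)
  case (Cons x xs)
  let ?F = "replicate (length xs) False"
  have d: "koszul_d M xs (\<lambda>u. f (False # u)) ?F \<in> scaled_span M xs L"
    using Cons by auto
  have L: "f (True # ?F) \<in> L" using Cons.prems by simp
  have "scaled_span M xs L \<subseteq> carrier M"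
    using assms(2) Cons.prems(1) by (induction xs) auto
  then have "koszul_d M (x # xs) f (replicate (length (x # xs)) False) =
    x \<odot>\<^bsub>M\<^esub> f (True # ?F) \<oplus>\<^bsub>M\<^esub> koszul_d M xs (\<lambda>u. f (False # u)) ?F"
    using d L assms(2) Cons.prems(1) by (simp add: M.a_comm subset_iff)
  then show ?case using d L by auto
qed simp

text \<open>The coefficients of z are placed at the singletons. Concentration in weight one is
  recorded because it makes f a cycle in all positive weights.\<close>

lemma scaled_span_koszul_d:
  assumes "set xs \<subseteq> carrier R" "L \<subseteq> carrier M" "\<zero>\<^bsub>M\<^esub> \<in> L" "z \<in> scaled_span M xs L"
  shows "\<exists>f. (\<forall>s. f s \<in> L) \<and> (\<forall>s. weight s \<noteq> 1 \<longrightarrow> f s = \<zero>\<^bsub>M\<^esub>) \<and>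
    z = koszul_d M xs f (replicate (length xs) False)"
  using assms(1,4)
proof (induction xs arbitrary: z)
  case Nil
  then show ?case using assms(3) by (intro exI[of _ "\<lambda>_. \<zero>\<^bsub>M\<^esub>"]) auto
next
  case (Cons x xs)
  let ?F = "replicate (length xs) False"
  obtain v w where z: "v \<in> L" "w \<in> scaled_span M xs L" "z = x \<odot>\<^bsub>M\<^esub> v \<oplus>\<^bsub>M\<^esub> w" using Cons.prems by auto
  obtain f where f: "\<And>s. f s \<in> L" "\<And>s. weight s \<noteq> 1 \<Longrightarrow> f s = \<zero>\<^bsub>M\<^esub>" "w = koszul_d M xs f ?F"
    using Cons.IH[of w] Cons.prems z by auto
  define g where "g s = (case s of [] \<Rightarrow> \<zero>\<^bsub>M\<^esub> | b # t \<Rightarrow> if b then (if weight t = 0 then v else \<zero>\<^bsub>M\<^esub>) else f t)" for s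
  have "w \<in> carrier M" using koszul_d_closed[of xs f ?F] f assms(2) Cons.prems by auto
  moreover have "weight ?F = 0" by simp
  ultimately have "z = koszul_d M (x # xs) g (replicate (length (x # xs)) False)"
    using z f(3) Cons.prems assms(2) by (simp add: g_def subset_iff M.a_comm)
  moreover have "g s \<in> L" for s using z f assms(3) by (auto simp: g_def split: list.split)
  moreover have "g s = \<zero>\<^bsub>M\<^esub>" if "weight s \<noteq> 1" for s
    using that f(2) by (auto simp: g_def split: list.split)
  ultimately show ?case by blast
qed

text \<open>Exactness in degree one says that every relation among \<open>xs\<close> modulo \<open>L\<close> is, modulo \<open>L\<close>, a
  combination of the trivial ones.\<close>

lemma koszul_exact_1_scaled_span:
  assumes xs: "set xs \<subseteq> carrier R" and L: "submodule L R M" and ex: "koszul_exact M xs L 1"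
    and z: "z \<in> scaled_span M xs (carrier M)" "z \<in> L"
  shows "z \<in> scaled_span M xs L"
proof -
  let ?F = "replicate (length xs) False"
  have LM: "L \<subseteq> carrier M" by (rule submoduleE(1)[OF L])
  obtain f where f: "\<And>s. f s \<in> carrier M" "\<And>s. weight s \<noteq> 1 \<Longrightarrow> f s = \<zero>\<^bsub>M\<^esub>" "z = koszul_d M xs f ?F"
    using scaled_span_koszul_d[OF xs _ _ z(1)] by auto
  \<comment> \<open>Cycle condition modulo L: the only list of weight 0 codes the empty set, where
    the value is z itself; in positive weight the differential of a chain of weight one
    vanishes.\<close>
  have "koszul_d M xs f s \<in> L" if s: "length s = length xs" for s
  proof (cases "weight s = 0")
    case True
    then have "s = ?F" using s by (auto simp: list_eq_iff_nth_eq count_list_0_iff in_set_conv_nth)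
    then show ?thesis using z f by simp
  next
    case False
    then show ?thesis
      using koszul_d_weight_above[of xs 1 f s] xs f(2) submodule_zero[OF L] by simp
  qed
  then obtain h where h: "\<And>s. h s \<in> carrier M"
    "\<And>s. length s = length xs \<Longrightarrow> f s \<ominus>\<^bsub>M\<^esub> koszul_d M xs h s \<in> L"
    using ex[unfolded koszul_exact_def, rule_format, of f] f by auto
  \<comment> \<open>The chain f - d h has values in L, and its differential at the empty set is
    still z because d d = 0.\<close>
  have "koszul_d M xs (\<lambda>s. f s \<ominus>\<^bsub>M\<^esub> koszul_d M xs h s) ?F \<in> scaled_span M xs L"
    using xs LM h(2) by (rule koszul_d_replicate)
  also have "koszul_d M xs (\<lambda>s. f s \<ominus>\<^bsub>M\<^esub> koszul_d M xs h s) ?F = z"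
    using xs f h koszul_d_closed[OF xs, of h] koszul_d_closed[OF xs, of f]
    by (simp add: koszul_d_diff koszul_d_d) (simp add: M.minus_eq)
  finally show ?thesis .
qed

text \<open>Koszul homology in degree zero is M modulo the ideal of \<open>xs\<close> times M. The
  proof puts v at the empty set, which is always a cycle, and reads off v = d h there. For M = R and
  \<open>xs\<close> in m this is the contradiction behind
  \<open>regular_seq_length_le\<close>.\<close>

lemma koszul_exact_0_scaled_span:
  assumes xs: "set xs \<subseteq> carrier R" and ex: "koszul_exact M xs {\<zero>\<^bsub>M\<^esub>} 0"
  shows "carrier M \<subseteq> scaled_span M xs (carrier M)"
proof
  fix v assume v: "v \<in> carrier M"
  let ?F = "replicate (length xs) False"
  define f where "f s = (if weight s = 0 then v else \<zero>\<^bsub>M\<^esub>)" for s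
  have f: "f s \<in> carrier M" for s using v by (simp add: f_def)
  have "koszul_d M xs f s = \<zero>\<^bsub>M\<^esub>" for s
    using xs by (rule koszul_d_weight_above[where j = 0]) (auto simp: f_def)
  then obtain h where h: "\<And>s. h s \<in> carrier M"
    "\<And>s. length s = length xs \<Longrightarrow> f s \<ominus>\<^bsub>M\<^esub> koszul_d M xs h s = \<zero>\<^bsub>M\<^esub>"
    using ex[unfolded koszul_exact_def, rule_format, of f] f by auto
  have "v = koszul_d M xs h ?F"
    using h(2)[of ?F] koszul_d_closed[OF xs, of h ?F] h(1) v
    by (simp add: f_def M.minus_eq M.add.inv_solve_right' M.minus_equality) 
  then show "v \<in> scaled_span M xs (carrier M)" using koszul_d_replicate[OF xs _ h(1)] by simp
qed

text \<open>Each regular element lying in the radical of \<open>xs\<close> lowers the degree from which on the Koszul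
  complex of \<open>xs\<close> is exact.\<close>

lemma koszul_exact_regular:
  assumes xs: "set xs \<subseteq> carrier R" and L: "\<And>i. i \<le> length ys \<Longrightarrow> submodule (L i) R M"
    and mono: "\<And>i. i < length ys \<Longrightarrow> L i \<subseteq> L (Suc i)"
    and ys: "set ys \<subseteq> carrier R"
    and pow: "\<And>y. y \<in> set ys \<Longrightarrow> \<exists>k::nat. y [^] k \<in> lin_span (ring_as_module R) (carrier R) xs"
    and yL: "\<And>i v. i < length ys \<Longrightarrow> v \<in> carrier M \<Longrightarrow> ys ! i \<odot>\<^bsub>M\<^esub> v \<in> L (Suc i)"
    and LD: "\<And>i l. i < length ys \<Longrightarrow> l \<in> L (Suc i) \<Longrightarrow> \<exists>u \<in> carrier M. l \<ominus>\<^bsub>M\<^esub> (ys ! i) \<odot>\<^bsub>M\<^esub> u \<in> L i"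
    and reg: "\<And>i v. i < length ys \<Longrightarrow> v \<in> carrier M \<Longrightarrow> (ys ! i) \<odot>\<^bsub>M\<^esub> v \<in> L i \<Longrightarrow> v \<in> L i"
    and j: "length xs < j + length ys"
  shows "koszul_exact M xs (L 0) j"
proof -
  \<comment> \<open>Descending induction on i: replacing the quotient by \<open>L (Suc i)\<close>
    with the quotient by \<open>L i\<close> lowers the degree by one. For i =
    \<open>length ys\<close> the degree already exceeds \<open>length xs\<close>.\<close>
  have "koszul_exact M xs (L i) (j + i)" if "i \<le> length ys" for i
    using that
  proof (induction rule: inc_induct)
    case base
    show ?case using j submodule_zero[OF L] by (intro koszul_exact_top[OF xs]) auto
  next
    case (step i)
    then have i: "i < length ys" by simp
    then have y: "ys ! i \<in> carrier R" using ys by (auto dest: nth_mem)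
    obtain k where k: "(ys ! i) [^] (k::nat) \<in> lin_span (ring_as_module R) (carrier R) xs"
      using pow[of "ys ! i"] i by auto
    have ex: "koszul_exact M xs (L (Suc i)) (Suc (j + i))" using step.IH by simp
    show ?case
      by (rule koszul_exact_step[OF xs L[of i] L[of "Suc i"] mono[OF i] y k yL[OF i] LD[OF i] reg[OF i] ex])
        (use i in auto)
  qed
  from this[of 0] show ?thesis by simp
qed

end

section \<open>Submodules generated by multiples of a list of scalars\<close>

context
  fixes R :: "('a, 'b) ring_scheme" (structure) and M :: "('a, 'c) module"
  assumes module: "module R M"
begin

interpretation module R M by (rule module)

lemma ideal_mult_module_Nil: "ideal_mult_module R M [] = {\<zero>\<^bsub>M\<^esub>}"
  unfolding ideal_mult_module_def by auto

lemma ideal_mult_module_subset: 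
  assumes "set ys \<subseteq> carrier R" shows "ideal_mult_module R M ys \<subseteq> carrier M"
proof -
  have "i < length ys \<Longrightarrow> ys ! i \<in> carrier R" for i using assms by (auto dest: nth_mem)
  then show ?thesis unfolding ideal_mult_module_def by (auto intro!: M.finsum_closed)
qed

text \<open>The list is peeled from the end because \<open>regular_seq\<close> compares the
  successive prefixes \<open>take i xs\<close>.\<close>

lemma ideal_mult_module_snoc:
  assumes ys: "set ys \<subseteq> carrier R" "y \<in> carrier R"
  shows "ideal_mult_module R M (ys @ [y]) =
    {w \<oplus>\<^bsub>M\<^esub> y \<odot>\<^bsub>M\<^esub> u | w u. w \<in> ideal_mult_module R M ys \<and> u \<in> carrier M}" (is "?l = ?r")
proof -
  have nth: "i < length ys \<Longrightarrow> ys ! i \<in> carrier R" for i using ys by (auto dest: nth_mem)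
  have eq: "finsum M (\<lambda>i. (ys @ [y]) ! i \<odot>\<^bsub>M\<^esub> v i) {..<length (ys @ [y])} =
      finsum M (\<lambda>i. ys ! i \<odot>\<^bsub>M\<^esub> v i) {..<length ys} \<oplus>\<^bsub>M\<^esub> y \<odot>\<^bsub>M\<^esub> v (length ys)"
    if v: "\<forall>i<Suc (length ys). v i \<in> carrier M" for v
  proof -
    have "finsum M (\<lambda>i. (ys @ [y]) ! i \<odot>\<^bsub>M\<^esub> v i) {..<Suc (length ys)} =
       y \<odot>\<^bsub>M\<^esub> v (length ys) \<oplus>\<^bsub>M\<^esub> finsum M (\<lambda>i. (ys @ [y]) ! i \<odot>\<^bsub>M\<^esub> v i) {..<length ys}"
      unfolding lessThan_Suc using v ys nth
      by (subst M.finsum_insert) (auto simp: nth_append)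
    also have "finsum M (\<lambda>i. (ys @ [y]) ! i \<odot>\<^bsub>M\<^esub> v i) {..<length ys} =
       finsum M (\<lambda>i. ys ! i \<odot>\<^bsub>M\<^esub> v i) {..<length ys}"
      using v nth by (intro M.finsum_cong') (auto simp: nth_append)
    finally show ?thesis using v nth ys by (simp add: M.a_comm M.finsum_closed Pi_def)
  qed
  show ?thesis
  proof (intro equalityI subsetI)
    fix z assume "z \<in> ?l"
    then obtain v where v: "\<forall>i<Suc (length ys). v i \<in> carrier M"
      "z = finsum M (\<lambda>i. (ys @ [y]) ! i \<odot>\<^bsub>M\<^esub> v i) {..<length (ys @ [y])}"
      unfolding ideal_mult_module_def by auto
    have "finsum M (\<lambda>i. ys ! i \<odot>\<^bsub>M\<^esub> v i) {..<length ys} \<in> ideal_mult_module R M ys"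
      unfolding ideal_mult_module_def using v(1) by auto
    then show "z \<in> ?r" using eq[OF v(1)] v by auto
  next
    fix z assume "z \<in> ?r"
    then obtain v u where v: "\<forall>i<length ys. v i \<in> carrier M" "u \<in> carrier M"
      "z = finsum M (\<lambda>i. ys ! i \<odot>\<^bsub>M\<^esub> v i) {..<length ys} \<oplus>\<^bsub>M\<^esub> y \<odot>\<^bsub>M\<^esub> u"
      unfolding ideal_mult_module_def by auto
    let ?v = "v(length ys := u)"
    have "finsum M (\<lambda>i. ys ! i \<odot>\<^bsub>M\<^esub> ?v i) {..<length ys} = finsum M (\<lambda>i. ys ! i \<odot>\<^bsub>M\<^esub> v i) {..<length ys}"
      using v nth by (intro M.finsum_cong') auto
    then have "z = finsum M (\<lambda>i. (ys @ [y]) ! i \<odot>\<^bsub>M\<^esub> ?v i) {..<length (ys @ [y])}"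
      using eq[of ?v] v by simp
    then show "z \<in> ?l" unfolding ideal_mult_module_def using v(1,2)
      by (intro CollectI exI[of _ ?v]) auto
  qed
qed

lemma ideal_mult_module_submodule:
  "set ys \<subseteq> carrier R \<Longrightarrow> submodule (ideal_mult_module R M ys) R M"
proof (induction ys rule: rev_induct)
  case Nil
  then show ?case unfolding ideal_mult_module_Nil by (intro submoduleI) auto
next
  case (snoc y ys)
  then have ys: "set ys \<subseteq> carrier R" and y: "y \<in> carrier R"
    and S: "submodule (ideal_mult_module R M ys) R M" by auto
  let ?S = "ideal_mult_module R M ys"
  have SM: "w \<in> carrier M" if "w \<in> ?S" for w using submoduleE(1)[OF S] that by auto
  have I: "w \<oplus>\<^bsub>M\<^esub> y \<odot>\<^bsub>M\<^esub> u \<in> ideal_mult_module R M (ys @ [y])" if "w \<in> ?S" "u \<in> carrier M" for w u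
    using ideal_mult_module_snoc[OF ys y] that by auto
  have E: "\<exists>w u. z = w \<oplus>\<^bsub>M\<^esub> y \<odot>\<^bsub>M\<^esub> u \<and> w \<in> ?S \<and> u \<in> carrier M" if "z \<in> ideal_mult_module R M (ys @ [y])" for z
    using ideal_mult_module_snoc[OF ys y] that by auto
  show ?case
  proof (intro submoduleI)
    show "ideal_mult_module R M (ys @ [y]) \<subseteq> carrier M" using snoc by (intro ideal_mult_module_subset)
    show "\<zero>\<^bsub>M\<^esub> \<in> ideal_mult_module R M (ys @ [y])" using I[OF submodule_zero[OF S] M.zero_closed] y by simp
  next
    fix a assume "a \<in> ideal_mult_module R M (ys @ [y])"
    from E[OF this] obtain w u where a: "a = w \<oplus>\<^bsub>M\<^esub> y \<odot>\<^bsub>M\<^esub> u" "w \<in> ?S" "u \<in> carrier M" by (elim exE conjE)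
    have "\<ominus>\<^bsub>M\<^esub> a = (\<ominus>\<^bsub>M\<^esub> w) \<oplus>\<^bsub>M\<^esub> y \<odot>\<^bsub>M\<^esub> (\<ominus>\<^bsub>M\<^esub> u)" using a y SM by (simp add: M.minus_add smult_r_minus)
    then show "\<ominus>\<^bsub>M\<^esub> a \<in> ideal_mult_module R M (ys @ [y])" using I a submoduleE(3)[OF S] by simp
  next
    fix a b assume "a \<in> ideal_mult_module R M (ys @ [y])" "b \<in> ideal_mult_module R M (ys @ [y])"
    from E[OF this(1)] E[OF this(2)] obtain w u w' u' where a: "a = w \<oplus>\<^bsub>M\<^esub> y \<odot>\<^bsub>M\<^esub> u" "w \<in> ?S" "u \<in> carrier M"
      "b = w' \<oplus>\<^bsub>M\<^esub> y \<odot>\<^bsub>M\<^esub> u'" "w' \<in> ?S" "u' \<in> carrier M" by (elim exE conjE)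
    have "a \<oplus>\<^bsub>M\<^esub> b = (w \<oplus>\<^bsub>M\<^esub> w') \<oplus>\<^bsub>M\<^esub> y \<odot>\<^bsub>M\<^esub> (u \<oplus>\<^bsub>M\<^esub> u')"
      using a y SM by (simp add: smult_r_distr add_add_swap)
    then show "a \<oplus>\<^bsub>M\<^esub> b \<in> ideal_mult_module R M (ys @ [y])" using I a submoduleE(5)[OF S] by simp
  next
    fix c a assume c: "c \<in> carrier R" and a: "a \<in> ideal_mult_module R M (ys @ [y])"
    from E[OF a] obtain w u where a: "a = w \<oplus>\<^bsub>M\<^esub> y \<odot>\<^bsub>M\<^esub> u" "w \<in> ?S" "u \<in> carrier M" by (elim exE conjE)
    have "c \<odot>\<^bsub>M\<^esub> a = c \<odot>\<^bsub>M\<^esub> w \<oplus>\<^bsub>M\<^esub> y \<odot>\<^bsub>M\<^esub> (c \<odot>\<^bsub>M\<^esub> u)"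
      using a y c SM by (simp add: smult_r_distr smult_commute)
    then show "c \<odot>\<^bsub>M\<^esub> a \<in> ideal_mult_module R M (ys @ [y])" using I a c submoduleE(4)[OF S] by simp
  qed
qed

end

context module
begin

text \<open>N is treated as M modulo the kernel of \<phi>: the submodules (y_1, ..., y_i) N are
  pulled back along \<phi> to a chain of submodules of M. In this way the Koszul complex of F^n(M)
  is handled inside a free module R^k.\<close>

lemma koszul_exact_regular_seq:
  assumes xs: "set xs \<subseteq> carrier R" and N: "module R (N :: ('a, 'e) module)"
    and \<phi>: "\<phi> ` carrier M = carrier N" "\<phi> \<zero>\<^bsub>M\<^esub> = \<zero>\<^bsub>N\<^esub>"
      "\<And>u v. u \<in> carrier M \<Longrightarrow> v \<in> carrier M \<Longrightarrow> \<phi> (u \<oplus>\<^bsub>M\<^esub> v) = \<phi> u \<oplus>\<^bsub>N\<^esub> \<phi> v"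
      "\<And>a v. a \<in> carrier R \<Longrightarrow> v \<in> carrier M \<Longrightarrow> \<phi> (a \<odot>\<^bsub>M\<^esub> v) = a \<odot>\<^bsub>N\<^esub> \<phi> v"
    and ys: "set ys \<subseteq> carrier R" "regular_seq R N m ys"
    and pow: "\<And>y. y \<in> set ys \<Longrightarrow> \<exists>k::nat. y [^] k \<in> lin_span (ring_as_module R) (carrier R) xs"
    and j: "length xs < j + length ys"
  shows "koszul_exact M xs {v \<in> carrier M. \<phi> v = \<zero>\<^bsub>N\<^esub>} j"
proof -
  interpret N: module R N by fact
  have cl: "\<phi> v \<in> carrier N" if "v \<in> carrier M" for v using \<phi>(1) that by auto
  have neg: "\<phi> (\<ominus>\<^bsub>M\<^esub> v) = \<ominus>\<^bsub>N\<^esub> \<phi> v" if v: "v \<in> carrier M" for v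
    using \<phi>(4)[of "\<ominus> \<one>" v] v cl by (simp add: smult_l_minus N.smult_l_minus)
  define I where "I i = ideal_mult_module R N (take i ys)" for i
  have take: "set (take i ys) \<subseteq> carrier R" for i using ys(1) set_take_subset[of i ys] by auto
  have sub: "submodule (I i) R N" for i unfolding I_def by (rule ideal_mult_module_submodule[OF N take])
  have y: "ys ! i \<in> carrier R" if "i < length ys" for i using ys that by (auto dest: nth_mem)
  have Suc: "I (Suc i) = {w \<oplus>\<^bsub>N\<^esub> (ys ! i) \<odot>\<^bsub>N\<^esub> u | w u. w \<in> I i \<and> u \<in> carrier N}" if "i < length ys" for i
    unfolding I_def take_Suc_conv_app_nth[OF that]
    by (rule ideal_mult_module_snoc[OF N take y[OF that]])
  have reg: "v \<in> I i" if "i < length ys" "v \<in> carrier N" "(ys ! i) \<odot>\<^bsub>N\<^esub> v \<in> I i" for i v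
    using ys(2) that unfolding regular_seq_def I_def by simp
  define L where "L i = {v \<in> carrier M. \<phi> v \<in> I i}" for i
  have LS: "submodule (L i) R M" for i
    unfolding L_def using N.submodule_zero[OF sub] N.submoduleE(3,4,5)[OF sub]
    by (intro submoduleI) (auto simp: \<phi> neg)
  have "koszul_exact M xs (L 0) j"
  proof (rule koszul_exact_regular[OF xs _ _ ys(1) pow _ _ _ j])
    fix i assume i: "i < length ys"
    show "L i \<subseteq> L (Suc i)"
    proof
      fix v assume v: "v \<in> L i"
      have "\<phi> v = \<phi> v \<oplus>\<^bsub>N\<^esub> (ys ! i) \<odot>\<^bsub>N\<^esub> \<zero>\<^bsub>N\<^esub>" using v cl y[OF i] by (simp add: L_def)
      then have "\<phi> v \<in> I (Suc i)" unfolding Suc[OF i] using v by (auto simp: L_def)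
      then show "v \<in> L (Suc i)" using v by (simp add: L_def)
    qed
  next
    fix i v assume i: "i < length ys" and v: "v \<in> carrier M"
    have "\<phi> (ys ! i \<odot>\<^bsub>M\<^esub> v) = \<zero>\<^bsub>N\<^esub> \<oplus>\<^bsub>N\<^esub> (ys ! i) \<odot>\<^bsub>N\<^esub> \<phi> v" using v cl y[OF i] by (simp add: \<phi>)
    then have "\<phi> (ys ! i \<odot>\<^bsub>M\<^esub> v) \<in> I (Suc i)" unfolding Suc[OF i]
      using N.submodule_zero[OF sub] cl[OF v] by blast
    then show "ys ! i \<odot>\<^bsub>M\<^esub> v \<in> L (Suc i)" using v y[OF i] by (simp add: L_def)
  next
    fix i l assume i: "i < length ys" and l: "l \<in> L (Suc i)"
    then obtain w u where w: "\<phi> l = w \<oplus>\<^bsub>N\<^esub> (ys ! i) \<odot>\<^bsub>N\<^esub> u" "w \<in> I i" "u \<in> carrier N" 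
      unfolding L_def Suc[OF i] by blast
    have "u \<in> \<phi> ` carrier M" using w \<phi>(1) by simp
    then obtain u' where u': "u' \<in> carrier M" "\<phi> u' = u" by auto
    have wN: "w \<in> carrier N" by (rule subsetD[OF N.submoduleE(1)[OF sub] w(2)])
    have "\<phi> (l \<ominus>\<^bsub>M\<^esub> (ys ! i) \<odot>\<^bsub>M\<^esub> u') = w"
      using l u' w wN y[OF i] by (simp add: L_def M.minus_eq \<phi> neg N.a_assoc N.r_neg)
    then show "\<exists>u\<in>carrier M. l \<ominus>\<^bsub>M\<^esub> ys ! i \<odot>\<^bsub>M\<^esub> u \<in> L i"
      using u' w l y[OF i] by (intro bexI[of _ u']) (auto simp: L_def)
  next
    fix i v assume i: "i < length ys" and v: "v \<in> carrier M" "ys ! i \<odot>\<^bsub>M\<^esub> v \<in> L i"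
    then have "(ys ! i) \<odot>\<^bsub>N\<^esub> \<phi> v \<in> I i" using y[OF i] by (simp add: L_def \<phi>)
    then have "\<phi> v \<in> I i" using reg[OF i cl[OF v(1)]] by blast
    then show "v \<in> L i" using v by (simp add: L_def)
  qed (rule LS)
  moreover have "L 0 = {v \<in> carrier M. \<phi> v = \<zero>\<^bsub>N\<^esub>}"
    unfolding L_def I_def by (simp add: ideal_mult_module_Nil[OF N])
  ultimately show ?thesis by simp
qed

end

section \<open>Ideals and the Frobenius map\<close>

context cring
begin

lemma ring_module: "module R (ring_as_module R)"
proof (rule moduleI)
  show "abelian_group (ring_as_module R)"
    by (rule abelian_groupI) (auto simp: ring_as_module_def a_ac l_neg intro!: bexI[of _ "\<ominus> _"])
qed (auto simp: ring_as_module_def is_cring l_distr r_distr m_assoc)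

lemma ring_as_module_simps [simp]:
  "carrier (ring_as_module R) = carrier R" "\<zero>\<^bsub>ring_as_module R\<^esub> = \<zero>"
  "x \<oplus>\<^bsub>ring_as_module R\<^esub> y = x \<oplus> y" "x \<odot>\<^bsub>ring_as_module R\<^esub> y = x \<otimes> y"
  by (auto simp: ring_as_module_def)

lemma ring_as_module_derived [simp]:
  "finsum (ring_as_module R) f A = finsum R f A" "x \<ominus>\<^bsub>ring_as_module R\<^esub> y = x \<ominus> y"
  by (simp_all add: finsum_def finprod_def a_minus_def a_inv_def m_inv_def ring_as_module_def)

lemma ring_submodule_ideal:
  assumes "submodule J R (ring_as_module R)" shows "ideal J R"
proof -
  interpret M: module R "ring_as_module R" by (rule ring_module)
  note E = M.submoduleE[OF assms, simplified]
  have neg: "\<ominus> a \<in> J" if "a \<in> J" for a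
    using E(4)[of "\<ominus> \<one>" a] that E(1) by (auto simp: l_minus)
  show ?thesis
  proof (rule idealI[OF ring_axioms])
    show "subgroup J (add_monoid R)"
      using E neg M.submodule_zero[OF assms] by (intro add.subgroupI) (auto simp: a_inv_def[symmetric])
    fix a x assume "a \<in> J" "x \<in> carrier R"
    then show "x \<otimes> a \<in> J" "a \<otimes> x \<in> J" using E(4)[of x a] E(1) by (auto simp: m_comm)
  qed
qed

lemma ring_lin_span:
  assumes "set xs \<subseteq> carrier R"
  shows "lin_span (ring_as_module R) (carrier R) xs = Idl (set xs)"
proof
  interpret M: module R "ring_as_module R" by (rule ring_module)
  have "ideal (lin_span (ring_as_module R) (carrier R) xs) R"
    by (intro ring_submodule_ideal M.lin_span_submodule oneideal) (use assms in auto)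
  moreover have "set xs \<subseteq> lin_span (ring_as_module R) (carrier R) xs"
    by (rule M.lin_span_superset) (use assms in auto)
  ultimately show "Idl (set xs) \<subseteq> lin_span (ring_as_module R) (carrier R) xs"
    by (rule genideal_minimal)
  show "lin_span (ring_as_module R) (carrier R) xs \<subseteq> Idl (set xs)"
    using assms
  proof (induction xs)
    case Nil
    interpret I: ideal "Idl {}" R by (rule genideal_ideal) simp
    show ?case by simp
  next
    case (Cons x xs)
    interpret I: ideal "Idl (set (x # xs))" R by (rule genideal_ideal) (use Cons in simp)
    have "Idl (set xs) \<subseteq> Idl (set (x # xs))" using Cons.prems by (intro subset_Idl_subset) auto
    moreover have "x \<in> Idl (set (x # xs))" using genideal_self[OF Cons.prems] by auto
    moreover have "lin_span (ring_as_module R) (carrier R) xs \<subseteq> Idl (set xs)" using Cons by auto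
    ultimately show ?case by (auto intro!: I.a_closed I.I_l_closed simp del: list.set)
  qed
qed

lemma ring_ideal_mult_module:
  assumes "set ys \<subseteq> carrier R"
  shows "ideal_mult_module R (ring_as_module R) ys = Idl (set ys)"
  using assms
proof (induction ys rule: rev_induct)
  case Nil
  interpret I: ideal "Idl {}" R by (rule genideal_ideal) simp
  have "Idl {} \<subseteq> {\<zero>}" by (rule genideal_minimal) (auto intro: zeroideal)
  then show ?case by (auto simp: ideal_mult_module_Nil[OF ring_module])
next
  case (snoc y ys)
  then have ys: "set ys \<subseteq> carrier R" and y: "y \<in> carrier R" by auto
  let ?J = "ideal_mult_module R (ring_as_module R) (ys @ [y])"
  interpret I: ideal "Idl (set (ys @ [y]))" R by (rule genideal_ideal) (use snoc in simp)
  interpret I': ideal "Idl (set ys)" R by (rule genideal_ideal[OF ys])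
  have J: "?J = {w \<oplus> y \<otimes> u | w u. w \<in> Idl (set ys) \<and> u \<in> carrier R}"
    using ideal_mult_module_snoc[OF ring_module ys y] snoc.IH[OF ys] by simp
  have *: "Idl (set ys) \<subseteq> Idl (set (ys @ [y]))" using snoc.prems by (intro subset_Idl_subset) auto
  have **: "y \<in> Idl (set (ys @ [y]))" using genideal_self[OF snoc.prems] by auto
  have "?J \<subseteq> Idl (set (ys @ [y]))"
    unfolding J using * ** by (auto intro!: I.a_closed I.I_r_closed simp del: set_append)
  moreover have "Idl (set (ys @ [y])) \<subseteq> ?J"
  proof (rule genideal_minimal)
    show "ideal ?J R"
      by (intro ring_submodule_ideal ideal_mult_module_submodule ring_module) (use snoc.prems in auto)
    have "z \<in> ?J" if z: "z \<in> set ys" for z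
    proof -
      have "z \<in> Idl (set ys)" using genideal_self[OF ys] z by auto
      moreover have "z = z \<oplus> y \<otimes> \<zero>" using y z ys by auto
      ultimately show ?thesis unfolding J by blast
    qed
    moreover have "y \<in> ?J"
    proof -
      have "y = \<zero> \<oplus> y \<otimes> \<one>" using y by simp
      then show ?thesis unfolding J using I'.zero_closed by blast
    qed
    ultimately show "set (ys @ [y]) \<subseteq> ?J" by auto
  qed
  ultimately show ?case by blast
qed

lemma nat_pow_mem_ideal:
  assumes "ideal J R" "a \<in> carrier R" "a [^] (k::nat) \<in> J" "k \<le> l" shows "a [^] l \<in> J"
proof -
  have "a [^] l = a [^] k \<otimes> a [^] (l - k)" using assms by (simp add: nat_pow_mult)
  then show ?thesis using assms by (simp add: ideal.I_r_closed)
qed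

lemma add_pow_mult_zero:
  assumes p: "add_pow R p \<one> = \<zero>" and x: "x \<in> carrier R" and "p dvd (k::nat)"
  shows "add_pow R k x = \<zero>"
proof -
  obtain c where k: "k = p * c" using assms(3) by auto
  have "add_pow R p x = add_pow R p (\<one> \<otimes> x)" using x by simp
  also have "\<dots> = add_pow R p \<one> \<otimes> x" by (rule add_pow_ldistr[symmetric]) (use x in auto)
  finally have "add_pow R p x = \<zero>" using p x by simp
  then show ?thesis using add.nat_pow_pow[OF x, of c p] k by (simp add: add.nat_pow_one)
qed

lemma binomial:
  assumes "a \<in> carrier R" "b \<in> carrier R"
  shows "(a \<oplus> b) [^] (n::nat) = finsum R (\<lambda>k. add_pow R (n choose k) (a [^] k \<otimes> b [^] (n - k))) {..n}"
proof (induction n)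
  case 0
  show ?case using assms by simp
next
  case (Suc n)
  let ?f = "\<lambda>k. add_pow R (n choose k) (a [^] k \<otimes> b [^] (n - k))"
  let ?g = "\<lambda>k. add_pow R (n choose k) (a [^] k \<otimes> b [^] (Suc n - k))"
  let ?h = "\<lambda>k. add_pow R (n choose k) (a [^] Suc k \<otimes> b [^] (n - k))"
  let ?e = "\<lambda>k. add_pow R (n choose Suc k) (a [^] Suc k \<otimes> b [^] (n - k))"
  have cl: "?f \<in> {..n} \<rightarrow> carrier R" "?g \<in> A \<rightarrow> carrier R" "?h \<in> {..n} \<rightarrow> carrier R" "?e \<in> {..n} \<rightarrow> carrier R" for A
    using assms by auto
  have h: "?f k \<otimes> a = ?h k" if "k \<le> n" for k
    using assms add_pow_ldistr[of "a [^] k \<otimes> b [^] (n - k)" a "n choose k"]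
    by (simp add: m_ac)
  have g: "?f k \<otimes> b = ?g k" if "k \<le> n" for k
    using assms add_pow_ldistr[of "a [^] k \<otimes> b [^] (n - k)" b "n choose k"] that
    by (simp add: m_assoc Suc_diff_le)
  have "(a \<oplus> b) [^] Suc n = finsum R ?f {..n} \<otimes> (a \<oplus> b)" using Suc by simp
  also have "\<dots> = finsum R ?f {..n} \<otimes> a \<oplus> finsum R ?f {..n} \<otimes> b"
    using assms cl by (intro r_distr) (auto intro!: finsum_closed)
  also have "finsum R ?f {..n} \<otimes> a = finsum R ?h {..n}"
    using assms cl h by (subst finsum_ldistr) (auto intro!: finsum_cong')
  also have "finsum R ?f {..n} \<otimes> b = finsum R ?g {..n}"
    using assms cl g by (subst finsum_ldistr) (auto intro!: finsum_cong')
  \<comment> \<open>The added summand has the coefficient \<open>n choose Suc n\<close> = 0. With it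
    the range can be shifted by one to give \<open>?e\<close>, ready for Pascal's rule.\<close>
  also have "finsum R ?g {..n} = finsum R ?g {..Suc n}"
    using assms cl by (simp add: binomial_eq_0)
  also have "\<dots> = finsum R ?e {..n} \<oplus> b [^] Suc n"
    using assms cl by (subst finsum_Suc2) auto
  also have "finsum R ?h {..n} \<oplus> (finsum R ?e {..n} \<oplus> b [^] Suc n) =
     finsum R (\<lambda>k. ?h k \<oplus> ?e k) {..n} \<oplus> b [^] Suc n"
    using assms cl by (subst finsum_addf) (auto simp: a_assoc intro!: finsum_closed)
  also have "finsum R (\<lambda>k. ?h k \<oplus> ?e k) {..n} =
     finsum R (\<lambda>k. add_pow R (Suc n choose Suc k) (a [^] Suc k \<otimes> b [^] (Suc n - Suc k))) {..n}"
    using assms by (intro finsum_cong') (auto simp: add.nat_pow_mult)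
  also have "\<dots> \<oplus> b [^] Suc n =
     finsum R (\<lambda>k. add_pow R (Suc n choose k) (a [^] k \<otimes> b [^] (Suc n - k))) {..Suc n}"
    using assms by (subst finsum_Suc2) (auto)
  finally show ?case .
qed

lemma frobenius_add:
  assumes p: "Factorial_Ring.prime (p::nat)" "add_pow R p \<one> = \<zero>" and a: "a \<in> carrier R" "b \<in> carrier R"
  shows "(a \<oplus> b) [^] p = a [^] p \<oplus> b [^] p"
proof -
  let ?f = "\<lambda>k. add_pow R (p choose k) (a [^] k \<otimes> b [^] (p - k))"
  have p0: "p > 0" using p(1) prime_gt_0_nat by blast
  have "?f k = \<zero>" if "k \<in> {..p} - {0, p}" for k
    using that by (intro add_pow_mult_zero[OF p(2)] dvd_choose_prime) (use p a in auto)
  then have "finsum R ?f {..p} = finsum R ?f {0, p}"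
    using a by (intro add.finprod_mono_neutral_cong_right) auto
  also have "\<dots> = b [^] p \<oplus> a [^] p" using a p0 by (subst finsum_insert) auto
  finally show ?thesis using a by (simp add: binomial a_comm)
qed

lemma frobenius_power_add:
  assumes p: "Factorial_Ring.prime (p::nat)" "add_pow R p \<one> = \<zero>" and a: "a \<in> carrier R" "b \<in> carrier R"
  shows "(a \<oplus> b) [^] (p ^ n) = a [^] (p ^ n) \<oplus> b [^] (p ^ n)"
  using a
proof (induction n arbitrary: a b)
  case (Suc n)
  then have "(a \<oplus> b) [^] (p ^ Suc n) = ((a \<oplus> b) [^] p) [^] (p ^ n)" by (simp add: nat_pow_pow)
  then show ?case using Suc frobenius_add[OF p] by (simp add: nat_pow_pow)
qed simp

text \<open>Additivity is applied to (a - b) + b, so that the sign (-1)^(p^n) never has to be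
  computed.\<close>

lemma frobenius_power_diff:
  assumes p: "Factorial_Ring.prime (p::nat)" "add_pow R p \<one> = \<zero>" and a: "a \<in> carrier R" "b \<in> carrier R"
  shows "(a \<ominus> b) [^] (p ^ n) = a [^] (p ^ n) \<ominus> b [^] (p ^ n)"
proof -
  have "(a \<ominus> b) [^] (p ^ n) \<oplus> b [^] (p ^ n) = ((a \<ominus> b) \<oplus> b) [^] (p ^ n)"
    using frobenius_power_add[OF p, of "a \<ominus> b" b n] a by simp
  also have "(a \<ominus> b) \<oplus> b = a" using a by (simp add: minus_eq a_assoc l_neg)
  finally have "a [^] (p ^ n) \<ominus> b [^] (p ^ n) = ((a \<ominus> b) [^] (p ^ n) \<oplus> b [^] (p ^ n)) \<ominus> b [^] (p ^ n)" by simp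
  then show ?thesis using a by (simp add: minus_eq) (simp add: a_assoc r_neg)
qed

lemma finsum_mem_ideal: "finite A \<Longrightarrow> ideal J R \<Longrightarrow> (\<And>i. i \<in> A \<Longrightarrow> f i \<in> J) \<Longrightarrow> finsum R f A \<in> J"
proof (induction rule: finite_induct)
  case empty
  then show ?case by (simp add: additive_subgroup.zero_closed ideal.axioms(1))
next
  case (insert x A)
  have "f i \<in> carrier R" if "i \<in> insert x A" for i
    using ideal.Icarr[OF insert.prems(1) insert.prems(2)[OF that]] .
  then have "f x \<in> carrier R" "f \<in> A \<rightarrow> carrier R" by auto
  then show ?case using insert by (subst finsum_insert) (auto simp: additive_subgroup.a_closed ideal.axioms(1))
qed

end

section \<open>Prime ideals, local rings and regular elements\<close>

context cring
begin

lemma exists_maximal_disjoint_ideal: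
  assumes I: "ideal I R" "I \<inter> S = {}"
  obtains Q where "ideal Q R" "I \<subseteq> Q" "Q \<inter> S = {}"
    "\<And>J. ideal J R \<Longrightarrow> Q \<subseteq> J \<Longrightarrow> J \<inter> S = {} \<Longrightarrow> J = Q"
proof -
  let ?A = "{J. ideal J R \<and> I \<subseteq> J \<and> J \<inter> S = {}}"
  have "\<exists>Q\<in>?A. \<forall>J\<in>?A. Q \<subseteq> J \<longrightarrow> J = Q"
  proof (rule subset_Zorn_nonempty)
    show "?A \<noteq> {}" using I by auto
    fix C assume C: "C \<noteq> {}" "subset.chain ?A C"
    then have "subset.chain {J. ideal J R} C" unfolding pred_on.chain_def by auto
    then have "ideal (\<Union>C) R" using chain_Union_is_ideal[of C] C(1) by simp
    moreover have "\<And>J. J \<in> C \<Longrightarrow> I \<subseteq> J \<and> J \<inter> S = {}" using C(2) unfolding pred_on.chain_def by auto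
    ultimately show "\<Union>C \<in> ?A" using C(1) by auto
  qed
  then show thesis using that by auto
qed

text \<open>An ideal Q maximal among those that miss S is prime: if a and b are not in Q, then Q +
  Ra and Q + Rb both meet S. The product of the two elements found lies in S, and it would lie in Q
  if a b did.\<close>

lemma exists_prime_disjoint:
  assumes I: "ideal I R" "I \<inter> S = {}" and S: "S \<subseteq> carrier R" "\<one> \<in> S" "\<And>a b. a \<in> S \<Longrightarrow> b \<in> S \<Longrightarrow> a \<otimes> b \<in> S"
  obtains Q where "primeideal Q R" "I \<subseteq> Q" "Q \<inter> S = {}"
proof -
  obtain Q where Q: "ideal Q R" "I \<subseteq> Q" "Q \<inter> S = {}"
    and max: "\<And>J. ideal J R \<Longrightarrow> Q \<subseteq> J \<Longrightarrow> J \<inter> S = {} \<Longrightarrow> J = Q"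
    using exists_maximal_disjoint_ideal[OF I] by metis
  interpret Q: ideal Q R by (rule Q(1))
  have meet: "\<exists>q\<in>Q. \<exists>r\<in>carrier R. q \<oplus> r \<otimes> a \<in> S" if a: "a \<in> carrier R" "a \<notin> Q" for a
  proof -
    define J where "J = {q \<oplus> r \<otimes> a | q r. q \<in> Q \<and> r \<in> carrier R}"
    have JI: "q \<oplus> r \<otimes> a \<in> J" if "q \<in> Q" "r \<in> carrier R" for q r using that by (auto simp: J_def)
    have "ideal J R"
    proof (rule idealI[OF ring_axioms])
      show "subgroup J (add_monoid R)"
      proof (rule add.subgroupI)
        show "J \<subseteq> carrier R" using a Q.Icarr by (auto simp: J_def)
        show "J \<noteq> {}" using JI[OF Q.zero_closed zero_closed] by auto
      next
        fix x assume "x \<in> J"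
        then obtain q r where x: "x = q \<oplus> r \<otimes> a" "q \<in> Q" "r \<in> carrier R" by (auto simp: J_def)
        have "\<ominus> x = (\<ominus> q) \<oplus> (\<ominus> r) \<otimes> a" using x a Q.Icarr by (simp add: minus_add l_minus)
        then show "\<ominus> x \<in> J" using JI[of "\<ominus> q" "\<ominus> r"] x Q.a_inv_closed by simp
      next
        fix x y assume "x \<in> J" "y \<in> J"
        then obtain q r q' r' where x: "x = q \<oplus> r \<otimes> a" "q \<in> Q" "r \<in> carrier R" 
          "y = q' \<oplus> r' \<otimes> a" "q' \<in> Q" "r' \<in> carrier R" by (auto simp: J_def)
        have "x \<oplus> y = (q \<oplus> q') \<oplus> (r \<oplus> r') \<otimes> a" using x a Q.Icarr by (simp add: l_distr a_ac)
        then show "x \<oplus> y \<in> J" using JI[of "q \<oplus> q'" "r \<oplus> r'"] x Q.a_closed by simp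
      qed
      fix x c assume "x \<in> J" and c: "c \<in> carrier R"
      then obtain q r where x: "x = q \<oplus> r \<otimes> a" "q \<in> Q" "r \<in> carrier R" by (auto simp: J_def)
      have "c \<otimes> x = c \<otimes> q \<oplus> (c \<otimes> r) \<otimes> a" using x a c Q.Icarr by (simp add: r_distr m_assoc)
      then show *: "c \<otimes> x \<in> J" using JI[of "c \<otimes> q" "c \<otimes> r"] x c Q.I_l_closed by simp
      have "x \<in> carrier R" using x a Q.Icarr by simp
      then show "x \<otimes> c \<in> J" using * c by (simp add: m_comm)
    qed
    moreover have "Q \<subseteq> J"
    proof
      fix q assume q: "q \<in> Q"
      then have "q = q \<oplus> \<zero> \<otimes> a" using a Q.Icarr by simp
      then show "q \<in> J" using JI[OF q zero_closed] by simp
    qed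
    moreover have "a \<in> J" using JI[OF Q.zero_closed one_closed] a by simp
    ultimately have "J \<inter> S \<noteq> {}" using max[of J] a(2) by auto
    then show ?thesis unfolding J_def by auto
  qed
  have "primeideal Q R"
  proof (rule primeidealI[OF Q(1) is_cring])
    show "carrier R \<noteq> Q" using Q(3) S by auto
    fix a b assume ab: "a \<in> carrier R" "b \<in> carrier R" "a \<otimes> b \<in> Q"
    show "a \<in> Q \<or> b \<in> Q"
    proof (rule ccontr)
      assume "\<not> (a \<in> Q \<or> b \<in> Q)"
      then obtain q r q' r' where q: "q \<in> Q" "r \<in> carrier R" "q \<oplus> r \<otimes> a \<in> S"
        "q' \<in> Q" "r' \<in> carrier R" "q' \<oplus> r' \<otimes> b \<in> S" using meet ab by metis
      have "(q \<oplus> r \<otimes> a) \<otimes> (q' \<oplus> r' \<otimes> b) = q \<otimes> (q' \<oplus> r' \<otimes> b) \<oplus> ((r \<otimes> a) \<otimes> q' \<oplus> (r \<otimes> r') \<otimes> (a \<otimes> b))"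
        using q ab Q.Icarr by (simp add: l_distr r_distr m_ac a_ac)
      also have "\<dots> \<in> Q" using q ab Q.Icarr by (simp add: Q.a_closed Q.I_l_closed Q.I_r_closed)
      finally show False using S(3)[OF q(3,6)] Q(3) by auto
    qed
  qed
  then show thesis using Q that by simp
qed

lemma proper_ideal_subset_maximal:
  assumes "ideal I R" "\<one> \<notin> I"
  obtains J where "maximalideal J R" "I \<subseteq> J"
proof -
  obtain Q where Q: "ideal Q R" "I \<subseteq> Q" "Q \<inter> {\<one>} = {}"
    and max: "\<And>J. ideal J R \<Longrightarrow> Q \<subseteq> J \<Longrightarrow> J \<inter> {\<one>} = {} \<Longrightarrow> J = Q"
    using exists_maximal_disjoint_ideal[OF assms(1), of "{\<one>}"] assms(2) by auto
  have "maximalideal Q R"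
  proof (rule maximalidealI[OF Q(1)])
    show "carrier R \<noteq> Q" using Q(3) by auto
    fix J assume J: "ideal J R" "Q \<subseteq> J" "J \<subseteq> carrier R"
    show "J = Q \<or> J = carrier R"
    proof (cases "\<one> \<in> J")
      case True then show ?thesis using ideal.one_imp_carrier[OF J(1)] by simp
    next
      case False then have "J \<inter> {\<one>} = {}" by simp
      then show ?thesis using max[OF J(1,2)] by simp
    qed
  qed
  then show thesis using Q that by simp
qed

lemma local_ring_Units:
  assumes loc: "local_ring R m" and a: "a \<in> carrier R" "a \<notin> m"
  shows "a \<in> Units R"
proof (rule ccontr)
  assume nu: "a \<notin> Units R"
  have I: "ideal (PIdl a) R" by (rule cgenideal_ideal[OF a(1)])
  have "\<one> \<notin> PIdl a"
  proof
    assume "\<one> \<in> PIdl a"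
    then obtain b where "b \<in> carrier R" "b \<otimes> a = \<one>" unfolding cgenideal_def by auto
    then show False using nu a(1) unfolding Units_def by (auto simp: m_comm)
  qed
  then obtain J where "maximalideal J R" "PIdl a \<subseteq> J" using proper_ideal_subset_maximal[OF I, of thesis] by simp
  then show False using loc cgenideal_self[OF a(1)] a(2) unfolding local_ring_def by auto
qed

lemma local_ring_one_minus_Units:
  assumes loc: "local_ring R m" and a: "a \<in> m"
  shows "\<one> \<ominus> a \<in> Units R"
proof -
  have m: "maximalideal m R" using loc by (simp add: local_ring_def)
  interpret m: maximalideal m R by (rule m)
  have aR: "a \<in> carrier R" using a m.Icarr by auto
  have "\<one> \<ominus> a \<notin> m"
  proof
    assume "\<one> \<ominus> a \<in> m"
    then have "(\<one> \<ominus> a) \<oplus> a \<in> m" using a by (rule m.a_closed)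
    then have "\<one> \<in> m" using aR by (simp add: minus_eq a_assoc l_neg)
    then show False using m.one_imp_carrier m.I_notcarr by simp
  qed
  then show ?thesis using local_ring_Units[OF loc] aR by simp
qed

text \<open>An element regular modulo I avoids some prime over I inside P. Take S to be all s x^k
  with s outside P. If s x^k is in I, regularity puts s into I and so into P; hence S misses I. A
  prime missing S lies in P and omits x, so it is strictly smaller than P.\<close>

lemma regular_prime_descent:
  assumes I: "ideal I R" and P: "primeideal P R" "I \<subseteq> P" "x \<in> P"
    and reg: "\<And>v. v \<in> carrier R \<Longrightarrow> x \<otimes> v \<in> I \<Longrightarrow> v \<in> I"
  obtains Q where "primeideal Q R" "I \<subseteq> Q" "Q \<subset> P"
proof -
  interpret P: primeideal P R by (rule P(1))
  have x: "x \<in> carrier R" using P(3) P.Icarr by auto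
  define S where "S = {s \<otimes> x [^] k | s (k::nat). s \<in> carrier R - P}"
  have reg': "v \<in> I" if "v \<in> carrier R" "v \<otimes> x [^] (k::nat) \<in> I" for v k
    using that
  proof (induction k)
    case (Suc k)
    have "x \<otimes> (v \<otimes> x [^] k) \<in> I" using Suc.prems x by (simp add: m_ac)
    then show ?case using reg[of "v \<otimes> x [^] k"] Suc x by simp
  qed simp
  have one: "\<one> \<notin> P" using P.one_imp_carrier P.I_notcarr by auto
  have SI: "s \<otimes> x [^] (k::nat) \<in> S" if "s \<in> carrier R" "s \<notin> P" for s k
    unfolding S_def using that by (intro CollectI exI[of _ s] exI[of _ k]) simp
  have "I \<inter> S = {}" using reg' P(2) by (auto simp: S_def)
  moreover have "S \<subseteq> carrier R" using x by (auto simp: S_def)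
  moreover have "\<one> \<in> S" using SI[of \<one> 0] one by simp
  moreover have "a \<otimes> b \<in> S" if ab: "a \<in> S" "b \<in> S" for a b
  proof -
    obtain s k t l where s: "a = s \<otimes> x [^] (k::nat)" "s \<in> carrier R" "s \<notin> P"
      "b = t \<otimes> x [^] (l::nat)" "t \<in> carrier R" "t \<notin> P" using ab by (auto simp: S_def)
    have "a \<otimes> b = (s \<otimes> t) \<otimes> x [^] (k + l)" using s x by (simp add: nat_pow_mult[symmetric] m_ac)
    then show ?thesis using SI[of "s \<otimes> t" "k + l"] s P.I_prime by auto
  qed
  ultimately obtain Q where Q: "primeideal Q R" "I \<subseteq> Q" "Q \<inter> S = {}"
    using exists_prime_disjoint[OF I, of S thesis] by simp
  have "s \<in> S" if "s \<in> carrier R - P" for s using SI[of s 0] that by simp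
  then have "Q \<subseteq> P" using Q(3) ideal.Icarr[OF primeideal.axioms(1)[OF Q(1)]] by auto
  moreover have "x \<in> S" using SI[of \<one> 1] one x by simp
  ultimately have "Q \<subset> P" using Q(3) P(3) by auto
  then show thesis using that Q by simp
qed

text \<open>The height of a prime is at least the length of a regular sequence inside it. The chain
  is built downwards from P, one descent for each element from the last to the first; the next prime
  contains the remaining prefix.\<close>

lemma regular_seq_prime_chain:
  assumes "set xs \<subseteq> carrier R"
    and "\<And>i v. i < length xs \<Longrightarrow> v \<in> carrier R \<Longrightarrow> xs ! i \<otimes> v \<in> Idl (set (take i xs)) \<Longrightarrow> v \<in> Idl (set (take i xs))"
    and "primeideal P R" "set xs \<subseteq> P"
  shows "\<exists>Q. (\<forall>i\<le>length xs. primeideal (Q i) R) \<and> (\<forall>i<length xs. Q i \<subset> Q (Suc i)) \<and> Q (length xs) = P"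
  using assms
proof (induction xs arbitrary: P rule: rev_induct)
  case Nil
  then show ?case by (intro exI[of _ "\<lambda>_. P"]) auto
next
  case (snoc x xs)
  have xs: "set xs \<subseteq> carrier R" using snoc.prems(1) by auto
  have I: "ideal (Idl (set xs)) R" by (rule genideal_ideal[OF xs])
  have "Idl (set xs) \<subseteq> P"
    by (rule genideal_minimal[OF primeideal.axioms(1)[OF snoc.prems(3)]]) (use snoc.prems in auto)
  moreover have "x \<in> P" using snoc.prems(4) by simp
  moreover have "v \<in> Idl (set xs)" if "v \<in> carrier R" "x \<otimes> v \<in> Idl (set xs)" for v
    using snoc.prems(2)[of "length xs" v] that by simp
  ultimately obtain P' where P': "primeideal P' R" "Idl (set xs) \<subseteq> P'" "P' \<subset> P"
    using regular_prime_descent[OF I snoc.prems(3), of x thesis] by simp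
  have sub: "set xs \<subseteq> P'" using genideal_self[OF xs] P'(2) by auto
  have reg: "v \<in> Idl (set (take i xs))"
    if "i < length xs" "v \<in> carrier R" "xs ! i \<otimes> v \<in> Idl (set (take i xs))" for i v
    using snoc.prems(2)[of i v] that by (simp add: nth_append)
  have "\<exists>Q. (\<forall>i\<le>length xs. primeideal (Q i) R) \<and> (\<forall>i<length xs. Q i \<subset> Q (Suc i)) \<and> Q (length xs) = P'"
    by (rule snoc.IH[OF xs _ P'(1) sub]) (rule reg)
  then obtain Q where Q: "\<forall>i\<le>length xs. primeideal (Q i) R"
    "\<forall>i<length xs. Q i \<subset> Q (Suc i)" "Q (length xs) = P'" by (elim exE conjE)
  show ?case
  proof (intro exI[of _ "\<lambda>i. if i \<le> length xs then Q i else P"] conjI allI impI)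
    fix i assume "i \<le> length (xs @ [x])"
    then show "primeideal (if i \<le> length xs then Q i else P) R" using Q(1) snoc.prems(3) by simp
  next
    fix i assume i: "i < length (xs @ [x])"
    show "(if i \<le> length xs then Q i else P) \<subset> (if Suc i \<le> length xs then Q (Suc i) else P)"
    proof (cases "i < length xs")
      case True
      then show ?thesis using Q(2) by simp
    next
      case False
      then have "i = length xs" using i by simp
      then show ?thesis using Q(3) P'(3) by simp
    qed
  qed simp
qed

end

text \<open>A finite supremum bounds the lengths, so there are only finitely many and a maximum
  exists. The condition d > 0 excludes the empty set, whose supremum is 0 as well; even the empty
  sequence is not regular on the zero module.\<close>

lemma Sup_enat_attained:
  assumes "Sup {enat (length xs) | xs. P xs} = enat d" "d > 0"
  shows "\<exists>xs. P xs \<and> length xs = d"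
proof -
  let ?A = "{enat (length xs) | xs. P xs}"
  have "?A \<noteq> {}"
  proof
    assume "?A = {}"
    then show False using assms by (simp add: bot_enat_def zero_enat_def)
  qed
  moreover have "finite ?A"
  proof (rule finite_subset)
    show "?A \<subseteq> enat ` {..d}"
    proof
      fix x assume x: "x \<in> ?A"
      then obtain l where l: "x = enat l" by auto
      have "x \<le> enat d" using Sup_upper[OF x] unfolding assms(1) .
      then show "x \<in> enat ` {..d}" using l by simp
    qed
  qed simp
  ultimately have "Max ?A \<in> ?A" "Max ?A = Sup ?A" by (rule Max_in[rotated], rule Max_Sup[rotated])
  then have "enat d \<in> ?A" unfolding assms(1) by (simp only:)
  then show ?thesis by auto
qed

section \<open>Systems of parameters in Cohen-Macaulay rings\<close>

lemma local_ringD: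
  assumes "local_ring R m"
  shows "cring R" "maximalideal m R" "ideal m R" "primeideal m R"
  using assms cring.maximalideal_prime maximalideal.axioms(1) by (auto simp: local_ring_def)

lemma noetherian_ideal_list:
  assumes "noetherian_ring R" "ideal J R"
  obtains gs where "set gs \<subseteq> carrier R" "J = genideal R (set gs)"
proof -
  obtain A where "A \<subseteq> carrier R" "finite A" "J = genideal R A"
    using noetherian_ring.finetely_gen[OF assms] by blast
  then show thesis using finite_list[of A] that by auto
qed

text \<open>If \<open>ys\<close> were longer than \<open>gs\<close>, the Koszul complex of
  \<open>gs\<close> on R would be exact already in degree 0. That says R = m R, contradicting that m
  is proper.\<close>

lemma regular_seq_length_le:
  assumes loc: "local_ring R m" and gs: "set gs \<subseteq> carrier R" "m = genideal R (set gs)"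
    and ys: "regular_seq R (ring_as_module R) m' ys" "m' \<subseteq> m"
  shows "length ys \<le> length gs"
proof (rule ccontr)
  assume "\<not> length ys \<le> length gs"
  then have j: "length gs < 0 + length ys" by simp
  interpret cring R by (rule local_ringD(1)[OF loc])
  interpret M: module R "ring_as_module R" by (rule ring_module)
  interpret m: maximalideal m R by (rule local_ringD(2)[OF loc])
  have ym: "set ys \<subseteq> m" using ys by (auto simp: regular_seq_def)
  then have yR: "set ys \<subseteq> carrier R" using m.Icarr by auto
  have pow: "\<exists>k::nat. y [^]\<^bsub>R\<^esub> k \<in> lin_span (ring_as_module R) (carrier R) gs" if "y \<in> set ys" for y
    using that ym yR gs by (intro exI[of _ 1]) (auto simp: ring_lin_span)
  have "koszul_exact (ring_as_module R) gs {v \<in> carrier (ring_as_module R). id v = \<zero>\<^bsub>ring_as_module R\<^esub>} 0"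
    by (rule M.koszul_exact_regular_seq[OF gs(1) ring_module _ _ _ _ yR ys(1) pow j]) auto
  moreover have "{v \<in> carrier (ring_as_module R). id v = \<zero>\<^bsub>ring_as_module R\<^esub>} = {\<zero>\<^bsub>ring_as_module R\<^esub>}"
    by auto
  ultimately have "carrier R \<subseteq> scaled_span (ring_as_module R) gs (carrier R)"
    using M.koszul_exact_0_scaled_span[OF gs(1)] by simp
  also have "\<dots> \<subseteq> m"
  proof -
    have "set gs \<subseteq> m" using gs genideal_self by simp
    then show ?thesis
      by (induction gs) (auto intro!: m.a_closed m.I_r_closed)
  qed
  finally show False using m.I_notcarr m.a_subset by auto
qed

text \<open>A regular sequence of length d = dim R is a system of parameters. If no power of some a
  in m lay in its ideal, a prime P containing the sequence would avoid a and be strictly contained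
  in m. The chain of length d ending in P, prolonged by m, would then be longer than the dimension
  allows.\<close>

lemma cohen_macaulay_system_of_parameters:
  fixes R (structure)
  assumes CM: "cohen_macaulay_local R m" and dim: "krull_dim R > 0"
  obtains xs where "system_of_parameters R m xs"
proof -
  have loc: "local_ring R m" and noeth: "noetherian_ring R"
    and dep: "depth R m (ring_as_module R) = krull_dim R"
    using CM by (auto simp: cohen_macaulay_local_def)
  interpret cring R by (rule local_ringD(1)[OF loc])
  have mI: "ideal m R" by (rule local_ringD(3)[OF loc])
  have mR: "m \<subseteq> carrier R" using ideal.Icarr[OF mI] by auto
  obtain gs where gs: "set gs \<subseteq> carrier R" "m = Idl (set gs)"
    using noetherian_ideal_list[OF noeth mI, of thesis] by simp
  \<comment> \<open>Finiteness of the dimension: Cohen-Macaulayness identifies it with the depth,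
    which is bounded by the number of generators of m.\<close>
  have "krull_dim R \<le> enat (length gs)"
    unfolding dep[symmetric] depth_def
    by (rule Sup_least) (auto dest: regular_seq_length_le[OF loc gs])
  then obtain d where d: "krull_dim R = enat d" by (cases "krull_dim R") auto
  have d0: "d > 0" using dim d by (simp add: zero_enat_def)
  have "Sup {enat (length xs) | xs. regular_seq R (ring_as_module R) m xs} = enat d"
    using dep d by (simp add: depth_def)
  from Sup_enat_attained[OF this d0]
  obtain xs where xs: "regular_seq R (ring_as_module R) m xs" "length xs = d" by (elim exE conjE)
  have xm: "set xs \<subseteq> m" using xs(1) by (simp add: regular_seq_def)
  then have xR: "set xs \<subseteq> carrier R" using mR by auto
  have I: "ideal (Idl (set xs)) R" by (rule genideal_ideal[OF xR])
  have reg: "v \<in> Idl (set (take i xs))"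
    if "i < length xs" "v \<in> carrier R" "xs ! i \<otimes>\<^bsub>R\<^esub> v \<in> Idl (set (take i xs))" for i v
  proof -
    have "set (take i xs) \<subseteq> carrier R" using xR set_take_subset[of i xs] by auto
    then have e: "ideal_mult_module R (ring_as_module R) (take i xs) = Idl (set (take i xs))"
      by (rule ring_ideal_mult_module)
    have "xs ! i \<odot>\<^bsub>ring_as_module R\<^esub> v \<in> ideal_mult_module R (ring_as_module R) (take i xs) \<Longrightarrow>
      v \<in> ideal_mult_module R (ring_as_module R) (take i xs)"
      using xs(1) that(1,2) by (simp add: regular_seq_def)
    then show ?thesis using that(3) unfolding e by simp
  qed
  have "\<exists>k::nat. a [^]\<^bsub>R\<^esub> k \<in> Idl (set xs)" if a: "a \<in> m" for a
  proof (rule ccontr)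
    assume no: "\<not> (\<exists>k::nat. a [^]\<^bsub>R\<^esub> k \<in> Idl (set xs))"
    have aR: "a \<in> carrier R" using a mR by auto
    define S where "S = range (\<lambda>k::nat. a [^] k)"
    have "Idl (set xs) \<inter> S = {}" using no by (auto simp: S_def)
    moreover have "S \<subseteq> carrier R" using aR by (auto simp: S_def)
    moreover have "\<one> \<in> S" unfolding S_def by (rule range_eqI[of _ _ 0]) simp
    moreover have "u \<otimes> v \<in> S" if "u \<in> S" "v \<in> S" for u v
      using that aR by (auto simp: S_def nat_pow_mult)
    ultimately obtain P where P: "primeideal P R" "Idl (set xs) \<subseteq> P" "P \<inter> S = {}"
      using exists_prime_disjoint[OF I, of S thesis] by simp
    have xP: "set xs \<subseteq> P" using genideal_self[OF xR] P(2) by auto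
    have "\<exists>Q. (\<forall>i\<le>length xs. primeideal (Q i) R) \<and> (\<forall>i<length xs. Q i \<subset> Q (Suc i)) \<and> Q (length xs) = P"
      by (rule regular_seq_prime_chain[OF xR _ P(1) xP]) (rule reg)
    then obtain Q where Q: "\<forall>i\<le>length xs. primeideal (Q i) R"
      "\<forall>i<length xs. Q i \<subset> Q (Suc i)" "Q (length xs) = P" by (elim exE conjE)
    have "P \<subseteq> m"
    proof -
      have PI: "ideal P R" by (rule primeideal.axioms(1)[OF P(1)])
      have "\<one> \<notin> P" using P(3) \<open>\<one> \<in> S\<close> by auto
      then obtain J where "maximalideal J R" "P \<subseteq> J"
        using proper_ideal_subset_maximal[OF PI, of thesis] by simp
      then show ?thesis using loc by (simp add: local_ring_def)
    qed
    moreover have "a \<in> S" unfolding S_def using aR by (intro range_eqI[of _ _ 1]) simp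
    ultimately have Pm: "P \<subset> m" using a P(3) by auto
    define Q' where "Q' i = (if i \<le> d then Q i else m)" for i
    have "\<forall>i\<le>Suc d. primeideal (Q' i) R" 
      using Q(1) xs(2) local_ringD(4)[OF loc] by (simp add: Q'_def)
    moreover have "\<forall>i<Suc d. Q' i \<subset> Q' (Suc i)"
    proof (intro allI impI)
      fix i assume i: "i < Suc d"
      show "Q' i \<subset> Q' (Suc i)"
      proof (cases "i < d")
        case True then show ?thesis using Q(2) xs(2) by (simp add: Q'_def)
      next
        case False
        then have "i = d" using i by simp
        then show ?thesis using Q(3) xs(2) Pm by (simp add: Q'_def)
      qed
    qed
    ultimately have "enat (Suc d) \<le> krull_dim R"
      unfolding krull_dim_def by (intro Sup_upper CollectI exI[of _ "Suc d"] exI[of _ Q'] conjI refl)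
    then show False using d by simp
  qed
  then have "system_of_parameters R m xs"
    using xs(2) d xm by (simp add: system_of_parameters_def)
  then show thesis by (rule that)
qed

text \<open>Additivity of the Frobenius map reduces membership to generators: (r g + w)^q = r^q g^q
  + w^q with q = p^n. The empty list needs 0^q = 0, hence q \<noteq> 0.\<close>

lemma (in cring) frobenius_power_mem_ideal:
  assumes p: "Factorial_Ring.prime (p::nat)" "add_pow R p \<one> = \<zero>"
    and gs: "set gs \<subseteq> carrier R" and I: "ideal I R"
    and k: "\<And>g. g \<in> set gs \<Longrightarrow> g [^] (p ^ n) \<in> I"
    and a: "a \<in> Idl (set gs)"
  shows "a [^] (p ^ n) \<in> I"
proof -
  interpret I: ideal I R by (rule I)
  have p0: "p ^ n \<noteq> 0" using p(1) by (auto simp: prime_gt_0_nat)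
  have "a \<in> lin_span (ring_as_module R) (carrier R) gs" using a ring_lin_span[OF gs] by simp
  then show ?thesis using gs k
  proof (induction gs arbitrary: a)
    case Nil
    then show ?case using p0 by (simp add: nat_pow_zero)
  next
    case (Cons g gs)
    obtain r w where a: "a = r \<otimes> g \<oplus> w" "r \<in> carrier R" "w \<in> lin_span (ring_as_module R) (carrier R) gs"
      using Cons.prems(1) by auto
    interpret M: module R "ring_as_module R" by (rule ring_module)
    have w: "w \<in> carrier R" using a(3) M.lin_span_subset[of "carrier R" gs] Cons.prems(2) by auto
    have g: "g \<in> carrier R" using Cons.prems by simp
    have "a [^] (p ^ n) = r [^] (p ^ n) \<otimes> g [^] (p ^ n) \<oplus> w [^] (p ^ n)"
      using a w g by (simp add: frobenius_power_add[OF p] nat_pow_distrib)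
    moreover have "w [^] (p ^ n) \<in> I" using Cons.IH[OF a(3)] Cons.prems by simp
    ultimately show ?case using Cons.prems(3)[of g] a(2) by (simp add: I.a_closed I.I_l_closed)
  qed
qed

text \<open>\<open>kappa\<close> is the infimum of a set of naturals, which is \<open>0\<close> for the empty set; the bound below is
  meaningful because a system of parameters exists and \<open>m\<close> is finitely generated.\<close>

lemma kappa_system_of_parameters:
  fixes R (structure)
  assumes CM: "cohen_macaulay_local R m" and dim: "krull_dim R > 0"
    and ch: "ring_char_p R p" and n: "kappa R m p \<le> n"
  obtains xs where "system_of_parameters R m xs" "\<And>a. a \<in> m \<Longrightarrow> a [^]\<^bsub>R\<^esub> (p ^ n) \<in> genideal R (set xs)"
proof -
  have loc: "local_ring R m" and noeth: "noetherian_ring R"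
    using CM by (auto simp: cohen_macaulay_local_def)
  interpret cring R by (rule local_ringD(1)[OF loc])
  have mI: "ideal m R" by (rule local_ringD(3)[OF loc])
  have mR: "m \<subseteq> carrier R" using ideal.Icarr[OF mI] by auto
  have p: "Factorial_Ring.prime p" "add_pow R p \<one> = \<zero>" using ch by (auto simp: ring_char_p_def)
  obtain gs where gs: "set gs \<subseteq> carrier R" "m = Idl (set gs)"
    using noetherian_ideal_list[OF noeth mI, of thesis] by simp
  have gm: "set gs \<subseteq> m" using genideal_self[OF gs(1)] gs(2) by simp
  let ?T = "{t. \<exists>xs. system_of_parameters R m xs \<and> frob_power R m (p ^ t) \<subseteq> Idl (set xs)}"
  obtain xs where xs: "system_of_parameters R m xs"
    using cohen_macaulay_system_of_parameters[OF CM dim, of thesis] by simp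
  have xR: "set xs \<subseteq> carrier R" using xs mR by (auto simp: system_of_parameters_def)
  have I: "ideal (Idl (set xs)) R" by (rule genideal_ideal[OF xR])
  have "\<exists>t. \<forall>g\<in>set gs. g [^] (p ^ t) \<in> Idl (set xs)"
  proof -
    have "\<forall>g\<in>set gs. \<exists>k::nat. g [^] k \<in> Idl (set xs)" using xs gm by (auto simp: system_of_parameters_def)
    then obtain k where k: "\<And>g. g \<in> set gs \<Longrightarrow> g [^] (k g :: nat) \<in> Idl (set xs)" by metis
    \<comment> \<open>One exponent for all generators: each k g is at most the sum t, and t < 2^t
      \<le> p^t.\<close>
    define t where "t = sum_list (map k gs)"
    have "g [^] (p ^ t) \<in> Idl (set xs)" if g: "g \<in> set gs" for g
    proof (rule nat_pow_mem_ideal[OF I _ k[OF g]])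
      show "g \<in> carrier R" using g gs by auto
      have "k g \<le> t" using g member_le_sum_list[of "k g" "map k gs"] by (simp add: t_def)
      also have "t < 2 ^ t" by (rule less_exp)
      also have "2 ^ t \<le> p ^ t" using prime_ge_2_nat[OF p(1)] by (intro power_mono) auto
      finally show "k g \<le> p ^ t" by simp
    qed
    then show ?thesis by auto
  qed
  then obtain t where t: "\<And>g. g \<in> set gs \<Longrightarrow> g [^] (p ^ t) \<in> Idl (set xs)" by auto
  have "{a [^] (p ^ t) | a. a \<in> m} \<subseteq> Idl (set xs)"
    using frobenius_power_mem_ideal[OF p gs(1) I t] gs(2) by auto
  then have "frob_power R m (p ^ t) \<subseteq> Idl (set xs)"
    unfolding frob_power_def by (rule genideal_minimal[OF I])
  then have "t \<in> ?T" using xs by auto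
  then have "Inf ?T \<in> ?T" by (intro Inf_nat_def1) auto
  then obtain ys where ys: "system_of_parameters R m ys" "frob_power R m (p ^ kappa R m p) \<subseteq> Idl (set ys)"
    unfolding kappa_def by auto
  have yR: "set ys \<subseteq> carrier R" using ys(1) mR by (auto simp: system_of_parameters_def)
  have J: "ideal (Idl (set ys)) R" by (rule genideal_ideal[OF yR])
  have "a [^] (p ^ n) \<in> Idl (set ys)" if a: "a \<in> m" for a
  proof (rule nat_pow_mem_ideal[OF J])
    show "a \<in> carrier R" using a mR by auto
    have "{a [^] (p ^ kappa R m p) | a. a \<in> m} \<subseteq> frob_power R m (p ^ kappa R m p)"
      unfolding frob_power_def using mR by (intro genideal_self) auto
    then show "a [^] (p ^ kappa R m p) \<in> Idl (set ys)" using ys(2) a by auto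
    show "p ^ kappa R m p \<le> p ^ n" using n prime_gt_0_nat[OF p(1)] by (intro power_increasing) auto
  qed
  then show thesis using that ys(1) by simp
qed

section \<open>Presentations without relations\<close>

lemma free_rank_module_simps:
  "carrier (free_rank_module R k) = {..<k} \<rightarrow>\<^sub>E carrier R"
  "\<zero>\<^bsub>free_rank_module R k\<^esub> = restrict (\<lambda>i. \<zero>\<^bsub>R\<^esub>) {..<k}"
  "f \<oplus>\<^bsub>free_rank_module R k\<^esub> g = restrict (\<lambda>i. f i \<oplus>\<^bsub>R\<^esub> g i) {..<k}"
  "a \<odot>\<^bsub>free_rank_module R k\<^esub> f = restrict (\<lambda>i. a \<otimes>\<^bsub>R\<^esub> f i) {..<k}"
  by (auto simp: free_rank_module_def)

context cring
begin

lemma free_rank_module: "module R (free_rank_module R k)"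
proof (rule moduleI)
  show "cring R" by (rule is_cring)
  show "abelian_group (free_rank_module R k)"
  proof (rule abelian_groupI)
    fix x assume x: "x \<in> carrier (free_rank_module R k)"
    show "\<exists>y\<in>carrier (free_rank_module R k). y \<oplus>\<^bsub>free_rank_module R k\<^esub> x = \<zero>\<^bsub>free_rank_module R k\<^esub>"
      using x by (intro bexI[of _ "restrict (\<lambda>i. \<ominus> x i) {..<k}"])
        (auto simp: free_rank_module_simps PiE_iff l_neg intro!: restrict_ext)
  qed (auto simp: free_rank_module_simps PiE_iff a_ac intro!: extensionalityI[where A = "{..<k}"])
qed (auto simp: free_rank_module_simps PiE_iff l_distr r_distr m_assoc intro!: extensionalityI[where A = "{..<k}"])

lemma free_rank_module_uminus:
  assumes "f \<in> {..<k} \<rightarrow>\<^sub>E carrier R"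
  shows "\<ominus>\<^bsub>free_rank_module R k\<^esub> f = restrict (\<lambda>i. \<ominus> f i) {..<k}"
proof -
  interpret M: module R "free_rank_module R k" by (rule free_rank_module)
  have "\<ominus>\<^bsub>free_rank_module R k\<^esub> f = (\<ominus> \<one>) \<odot>\<^bsub>free_rank_module R k\<^esub> f"
    using assms by (simp add: M.smult_l_minus free_rank_module_simps(1))
  then show ?thesis using assms
    by (auto simp: free_rank_module_simps PiE_iff l_minus intro!: restrict_ext)
qed

lemma free_rank_module_diff:
  assumes "f \<in> {..<k} \<rightarrow>\<^sub>E carrier R" "g \<in> {..<k} \<rightarrow>\<^sub>E carrier R"
  shows "f \<ominus>\<^bsub>free_rank_module R k\<^esub> g = restrict (\<lambda>i. f i \<ominus> g i) {..<k}"
  unfolding a_minus_def[of "free_rank_module R k"] free_rank_module_uminus[OF assms(2)]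
  by (auto simp: free_rank_module_simps minus_eq intro!: restrict_ext)

text \<open>The coefficients that express a by the i-th coordinates are reused on the vectors
  themselves.\<close>

lemma lin_span_free_coordinate:
  assumes vs: "set vs \<subseteq> carrier (free_rank_module R k)" and i: "i < k"
    and a: "a \<in> lin_span (ring_as_module R) (carrier R) (map (\<lambda>v. v i) vs)"
  shows "\<exists>w \<in> lin_span (free_rank_module R k) (carrier R) vs. w i = a"
  using vs a
proof (induction vs arbitrary: a)
  case Nil
  then show ?case using i by (simp add: free_rank_module_simps)
next
  case (Cons v vs)
  interpret M: module R "free_rank_module R k" by (rule free_rank_module)
  obtain c b where b: "c \<in> carrier R" "b \<in> lin_span (ring_as_module R) (carrier R) (map (\<lambda>v. v i) vs)"
    "a = c \<otimes> v i \<oplus> b" using Cons.prems(2) by auto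
  obtain w where w: "w \<in> lin_span (free_rank_module R k) (carrier R) vs" "w i = b"
    using Cons.IH[OF _ b(2)] Cons.prems(1) by auto
  have "(c \<odot>\<^bsub>free_rank_module R k\<^esub> v \<oplus>\<^bsub>free_rank_module R k\<^esub> w) i = a"
    using b w i by (simp add: free_rank_module_simps)
  then show ?case using M.lin_span_ConsI[OF b(1) w(1), of v] by (intro bexI) 
qed

text \<open>Induction on the number l of coordinates that may be nonzero. The l-th coordinates of L
  form an ideal; lifts of its generators correct any v in L to an element with vanishing l-th
  coordinate, to which the induction hypothesis applies. All submodules stay inside the same R^k, so
  no R^l has to be embedded.\<close>

lemma free_rank_submodule_finitely_generated:
  assumes noeth: "noetherian_ring R" and L: "submodule L R (free_rank_module R k)"
  shows "\<exists>vs. set vs \<subseteq> carrier (free_rank_module R k) \<and> L = lin_span (free_rank_module R k) (carrier R) vs"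
proof -
  let ?G = "free_rank_module R k"
  interpret M: module R ?G by (rule free_rank_module)
  have "\<exists>vs. set vs \<subseteq> carrier ?G \<and> L = lin_span ?G (carrier R) vs"
    if "submodule L R ?G" "\<And>v i. v \<in> L \<Longrightarrow> l \<le> i \<Longrightarrow> i < k \<Longrightarrow> v i = \<zero>" "l \<le> k" for L l
    using that
  proof (induction l arbitrary: L)
    case 0
    have LG: "L \<subseteq> carrier ?G" by (rule M.submoduleE(1)[OF 0(1)])
    have "v = \<zero>\<^bsub>?G\<^esub>" if v: "v \<in> L" for v
    proof -
      have "v \<in> carrier ?G" using v LG by auto
      then show ?thesis using 0(2)[OF v] unfolding free_rank_module_simps
        by (intro extensionalityI[where A = "{..<k}"]) (simp_all add: PiE_iff)
    qed
    then have "L \<subseteq> {\<zero>\<^bsub>?G\<^esub>}" by (intro subsetI) (simp only: singleton_iff)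
    then have "L = {\<zero>\<^bsub>?G\<^esub>}" using M.submodule_zero[OF 0(1)] by (intro equalityI) simp_all
    then show ?case by (intro exI[of _ "[]"]) simp
  next
    case (Suc l)
    have LG: "L \<subseteq> carrier ?G" by (rule M.submoduleE(1)[OF Suc.prems(1)])
    have l: "l < k" using Suc.prems(3) by simp
    note LE = M.submoduleE(3,4,5)[OF Suc.prems(1)]
    have Lc: "v i \<in> carrier R" if "v \<in> L" "i < k" for v i
      using LG that by (auto simp: free_rank_module_simps PiE_iff)
    define I where "I = (\<lambda>v. v l) ` L"
    have II: "v l \<in> I" if "v \<in> L" for v using that by (simp add: I_def)
    have "ideal I R"
    proof (rule idealI[OF ring_axioms])
      show "subgroup I (add_monoid R)"
      proof (rule add.subgroupI)
        show "I \<subseteq> carrier R" using Lc l by (auto simp: I_def)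
        show "I \<noteq> {}" using M.submodule_zero[OF Suc.prems(1)] by (auto simp: I_def)
      next
        fix a assume "a \<in> I"
        then obtain v where v: "v \<in> L" "a = v l" by (auto simp: I_def)
        have "\<ominus> a = (\<ominus>\<^bsub>?G\<^esub> v) l" using v LG l by (subst free_rank_module_uminus) (auto simp: free_rank_module_simps)
        then show "\<ominus> a \<in> I" using II[OF LE(1)[OF v(1)]] by (simp only:)
      next
        fix a b assume "a \<in> I" "b \<in> I"
        then obtain v w where v: "v \<in> L" "a = v l" "w \<in> L" "b = w l" by (auto simp: I_def)
        have "a \<oplus> b = (v \<oplus>\<^bsub>?G\<^esub> w) l" using v l by (simp add: free_rank_module_simps)
        then show "a \<oplus> b \<in> I" using II[OF LE(3)[OF v(1,3)]] by (simp only:)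
      qed
      fix a c assume "a \<in> I" and c: "c \<in> carrier R"
      then obtain v where v: "v \<in> L" "a = v l" by (auto simp: I_def)
      have "c \<otimes> a = (c \<odot>\<^bsub>?G\<^esub> v) l" using v l by (simp add: free_rank_module_simps)
      then show *: "c \<otimes> a \<in> I" using II[OF LE(2)[OF c v(1)]] by (simp only:)
      show "a \<otimes> c \<in> I" using * c Lc[OF v(1) l] v(2) by (simp add: m_comm)
    qed
    then obtain as where as: "set as \<subseteq> carrier R" "I = Idl (set as)"
      using noetherian_ideal_list[OF noeth, of I thesis] by simp
    have "set as \<subseteq> I" using genideal_self[OF as(1)] as(2) by simp
    then have "\<exists>vs. set vs \<subseteq> L \<and> as = map (\<lambda>v. v l) vs"
    proof (induction as)
      case (Cons a as)
      then obtain vs v where "set vs \<subseteq> L" "as = map (\<lambda>v. v l) vs" "v \<in> L" "a = v l" by (auto simp: I_def)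
      then show ?case by (intro exI[of _ "v # vs"]) auto
    qed simp
    then obtain vs where vs: "set vs \<subseteq> L" "as = map (\<lambda>v. v l) vs" by (elim exE conjE)
    have vsG: "set vs \<subseteq> carrier ?G" using vs LG by auto
    define L' where "L' = {v \<in> L. v l = \<zero>}"
    have L': "submodule L' R ?G"
    proof (rule M.submoduleI)
      show "L' \<subseteq> carrier ?G" using LG by (auto simp: L'_def)
      show "\<zero>\<^bsub>?G\<^esub> \<in> L'" using M.submodule_zero[OF Suc.prems(1)] l by (simp add: L'_def free_rank_module_simps)
    next
      fix a assume a: "a \<in> L'"
      then have "(\<ominus>\<^bsub>?G\<^esub> a) l = \<zero>" using LG l
        by (subst free_rank_module_uminus) (auto simp: free_rank_module_simps L'_def)
      then show "\<ominus>\<^bsub>?G\<^esub> a \<in> L'" using a LE(1) by (simp add: L'_def)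
    next
      fix a b assume "a \<in> L'" "b \<in> L'"
      then show "a \<oplus>\<^bsub>?G\<^esub> b \<in> L'" using LE(3) l by (simp add: L'_def free_rank_module_simps(3))
    next
      fix c a assume "c \<in> carrier R" "a \<in> L'"
      then show "c \<odot>\<^bsub>?G\<^esub> a \<in> L'" using LE(2) l by (simp add: L'_def free_rank_module_simps(4))
    qed
    have z': "v i = \<zero>" if "v \<in> L'" "l \<le> i" "i < k" for v i
      using that Suc.prems(2)[of v i] by (cases "i = l") (auto simp: L'_def)
    have lk: "l \<le> k" using l by simp
    have "\<exists>ws. set ws \<subseteq> carrier ?G \<and> L' = lin_span ?G (carrier R) ws"
      by (rule Suc.IH[OF L' _ lk]) (rule z')
    then obtain ws where ws: "set ws \<subseteq> carrier ?G" "L' = lin_span ?G (carrier R) ws" by (elim exE conjE)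
    have wsL: "set ws \<subseteq> L" using M.lin_span_superset[OF ws(1)] ws(2) by (auto simp: L'_def)
    let ?S = "lin_span ?G (carrier R) (vs @ ws)"
    have vw: "set (vs @ ws) \<subseteq> carrier ?G" using vsG ws(1) by simp
    have S: "submodule ?S R ?G" by (rule M.lin_span_submodule[OF oneideal vw])
    have 1: "lin_span ?G (carrier R) vs \<subseteq> ?S" "L' \<subseteq> ?S"
      using M.lin_span_minimal[OF S] M.lin_span_superset[OF vw] ws(2) by simp_all
    have "L \<subseteq> ?S"
    proof
      fix v assume v: "v \<in> L"
      have "v l \<in> Idl (set as)" using v as(2) by (auto simp: I_def)
      then have "v l \<in> lin_span (ring_as_module R) (carrier R) (map (\<lambda>v. v l) vs)"
        using ring_lin_span[OF as(1)] vs(2) by simp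
      from lin_span_free_coordinate[OF vsG l this]
      obtain w where w: "w \<in> lin_span ?G (carrier R) vs" "w l = v l" by (elim bexE)
      have wL: "w \<in> L" using w(1) M.lin_span_minimal[OF Suc.prems(1) vs(1)] by auto
      have vG: "v \<in> carrier ?G" and wG: "w \<in> carrier ?G" using v wL LG by auto
      have d: "v \<ominus>\<^bsub>?G\<^esub> w \<in> L" by (rule M.submodule_minus[OF Suc.prems(1) v wL])
      have "(v \<ominus>\<^bsub>?G\<^esub> w) l = \<zero>"
        using vG wG w(2) l Lc[OF v l] by (subst free_rank_module_diff) (auto simp: free_rank_module_simps minus_eq r_neg)
      then have "v \<ominus>\<^bsub>?G\<^esub> w \<in> ?S" using d 1(2) by (auto simp: L'_def)
      then have "(v \<ominus>\<^bsub>?G\<^esub> w) \<oplus>\<^bsub>?G\<^esub> w \<in> ?S" by (rule M.submoduleE(5)[OF S]) (use w(1) 1(1) in auto)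
      also have "(v \<ominus>\<^bsub>?G\<^esub> w) \<oplus>\<^bsub>?G\<^esub> w = v" using vG wG by (simp add: M.M.minus_eq M.M.a_assoc M.M.l_neg)
      finally show "v \<in> ?S" .
    qed
    moreover have "?S \<subseteq> L" by (rule M.lin_span_minimal[OF Suc.prems(1)]) (use vs(1) wsL in simp)
    ultimately show ?case using vw by (intro exI[of _ "vs @ ws"]) auto
  qed
  from this[of L k] show ?thesis using L by auto
qed

text \<open>A vector with all coordinates in I lies in I R^k: the same finite list generates I for
  every coordinate, so the coefficients of one x over all coordinates can be collected into a
  vector.\<close>

lemma scaled_span_freeI:
  assumes xs: "set xs \<subseteq> carrier R" and c: "c \<in> carrier (free_rank_module R k)"
    and I: "\<And>i. i < k \<Longrightarrow> c i \<in> Idl (set xs)"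
  shows "c \<in> scaled_span (free_rank_module R k) xs (carrier (free_rank_module R k))"
proof -
  have "\<And>i. i < k \<Longrightarrow> c i \<in> lin_span (ring_as_module R) (carrier R) xs" using I ring_lin_span[OF xs] by simp
  then show ?thesis using c xs
  proof (induction xs arbitrary: c)
    case Nil
    then show ?case
      by (auto simp: free_rank_module_simps PiE_iff intro!: extensionalityI[where A = "{..<k}"])
  next
    case (Cons x xs)
    have "\<forall>i. \<exists>a b. i < k \<longrightarrow> a \<in> carrier R \<and> b \<in> lin_span (ring_as_module R) (carrier R) xs \<and> c i = a \<otimes> x \<oplus> b"
      using Cons.prems(1) by auto
    then obtain a b where ab: "\<And>i. i < k \<Longrightarrow> a i \<in> carrier R"
      "\<And>i. i < k \<Longrightarrow> b i \<in> lin_span (ring_as_module R) (carrier R) xs" "\<And>i. i < k \<Longrightarrow> c i = a i \<otimes> x \<oplus> b i"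
      by metis
    interpret M: module R "ring_as_module R" by (rule ring_module)
    have bR: "b i \<in> carrier R" if "i < k" for i
      using ab(2)[OF that] M.lin_span_subset[of "carrier R" xs] Cons.prems(3) by auto
    define a' b' where "a' = restrict a {..<k}" and "b' = restrict b {..<k}"
    have "a' \<in> carrier (free_rank_module R k)" "b' \<in> carrier (free_rank_module R k)"
      using ab bR by (auto simp: a'_def b'_def free_rank_module_simps)
    moreover have "b' \<in> scaled_span (free_rank_module R k) xs (carrier (free_rank_module R k))"
    proof (rule Cons.IH[OF _ calculation(2)])
      show "b' i \<in> lin_span (ring_as_module R) (carrier R) xs" if "i < k" for i
        using ab(2)[OF that] that unfolding b'_def by simp
    qed (use Cons.prems(3) in simp)
    moreover have "c = x \<odot>\<^bsub>free_rank_module R k\<^esub> a' \<oplus>\<^bsub>free_rank_module R k\<^esub> b'"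
      using Cons.prems(2,3) ab(1,3) unfolding free_rank_module_simps a'_def b'_def
      by (intro extensionalityI[where A = "{..<k}"]) (auto simp: PiE_iff m_comm)
    ultimately show ?case by (auto simp del: free_rank_module_simps)
  qed
qed

text \<open>If \<open>\<phi>\<close> presents a module of depth \<open>length xs\<close> and all relations have coefficients in the ideal
  of \<open>xs\<close>, there are no relations: degree one of the Koszul complex of \<open>xs\<close> on the module vanishes,
  so the relation module equals \<open>xs\<close> times itself.\<close>

lemma presentation_kernel_zero:
  assumes loc: "local_ring R m" and noeth: "noetherian_ring R"
    and xs: "set xs \<subseteq> m" and pow: "\<And>a. a \<in> m \<Longrightarrow> \<exists>k::nat. a [^] k \<in> Idl (set xs)"
    and N: "module R (N :: ('a, 'e) module)"
    and \<phi>: "\<phi> ` carrier (free_rank_module R k) = carrier N"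
      "\<And>u v. u \<in> carrier (free_rank_module R k) \<Longrightarrow> v \<in> carrier (free_rank_module R k) \<Longrightarrow>
         \<phi> (u \<oplus>\<^bsub>free_rank_module R k\<^esub> v) = \<phi> u \<oplus>\<^bsub>N\<^esub> \<phi> v"
      "\<And>a v. a \<in> carrier R \<Longrightarrow> v \<in> carrier (free_rank_module R k) \<Longrightarrow>
         \<phi> (a \<odot>\<^bsub>free_rank_module R k\<^esub> v) = a \<odot>\<^bsub>N\<^esub> \<phi> v"
    and ys: "regular_seq R N m ys" "length ys = length xs"
    and K: "\<And>c i. c \<in> carrier (free_rank_module R k) \<Longrightarrow> \<phi> c = \<zero>\<^bsub>N\<^esub> \<Longrightarrow> i < k \<Longrightarrow> c i \<in> Idl (set xs)"
    and c: "c \<in> carrier (free_rank_module R k)" "\<phi> c = \<zero>\<^bsub>N\<^esub>"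
  shows "c = \<zero>\<^bsub>free_rank_module R k\<^esub>"
proof -
  let ?G = "free_rank_module R k"
  interpret M: module R ?G by (rule free_rank_module)
  interpret N: module R N by (rule N)
  interpret m: ideal m R by (rule local_ringD(3)[OF loc])
  have xR: "set xs \<subseteq> carrier R" using xs m.Icarr by auto
  have ym: "set ys \<subseteq> m" using ys(1) by (simp add: regular_seq_def)
  then have yR: "set ys \<subseteq> carrier R" using m.Icarr by auto
  have cl: "\<phi> v \<in> carrier N" if "v \<in> carrier ?G" for v using \<phi>(1) that by auto
  have \<phi>0: "\<phi> \<zero>\<^bsub>?G\<^esub> = \<zero>\<^bsub>N\<^esub>" using \<phi>(3)[OF zero_closed M.M.zero_closed] cl by simp
  define K where "K = {v \<in> carrier ?G. \<phi> v = \<zero>\<^bsub>N\<^esub>}"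
  have neg: "\<phi> (\<ominus>\<^bsub>?G\<^esub> v) = \<ominus>\<^bsub>N\<^esub> \<phi> v" if v: "v \<in> carrier ?G" for v
    using \<phi>(3)[of "\<ominus> \<one>" v] v cl by (simp add: M.smult_l_minus N.smult_l_minus)
  have KS: "submodule K R ?G"
    by (rule M.submoduleI) (auto simp: K_def \<phi>0 \<phi>(2,3) neg)
  have ex: "koszul_exact ?G xs K 1"
    unfolding K_def
  proof (rule M.koszul_exact_regular_seq[OF xR N \<phi>(1) \<phi>0 \<phi>(2,3) yR ys(1)])
    show "\<exists>k::nat. y [^] k \<in> lin_span (ring_as_module R) (carrier R) xs" if "y \<in> set ys" for y
      using pow[of y] that ym by (simp add: ring_lin_span[OF xR] subset_iff)
    \<comment> \<open>Since \<open>xs\<close> and \<open>ys\<close> have equal length, degree one is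
      the first degree in which \<open>koszul_exact_regular_seq\<close> applies.\<close>
    show "length xs < 1 + length ys" using ys(2) by simp
  qed
  have sub: "K \<subseteq> scaled_span ?G xs K"
  proof
    fix v assume v: "v \<in> K"
    then have vG: "v \<in> carrier ?G" and v0: "\<phi> v = \<zero>\<^bsub>N\<^esub>" by (auto simp: K_def)
    have "v \<in> scaled_span ?G xs (carrier ?G)"
      by (rule scaled_span_freeI[OF xR vG K[OF vG v0]])
    then show "v \<in> scaled_span ?G xs K" by (rule M.koszul_exact_1_scaled_span[OF xR KS ex _ v])
  qed
  obtain vs where vs: "set vs \<subseteq> carrier ?G" "K = lin_span ?G (carrier R) vs"
    using free_rank_submodule_finitely_generated[OF noeth KS] by (elim exE conjE)
  have "K = {\<zero>\<^bsub>?G\<^esub>}"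
    by (rule M.nakayama[OF local_ringD(3)[OF loc] local_ring_one_minus_Units[OF loc] vs xs sub])
  then show ?thesis using c by (auto simp: K_def)
qed

end

section \<open>The Frobenius functor\<close>

text \<open>The formal sum inside the scalar multiplication of \<open>frobenius_functor\<close>,
  that is, the push-forward along (x, s) \<mapsto> (x, r s), named apart from the choice of a
  representative.\<close>

definition tensor_push :: "('a, 'b) ring_scheme \<Rightarrow> 'a \<Rightarrow> ('c \<times> 'a \<Rightarrow> int) \<Rightarrow> 'c \<times> 'a \<Rightarrow> int" where
  "tensor_push R r f = (\<lambda>k'. sum f {k. f k \<noteq> 0 \<and> (fst k, r \<otimes>\<^bsub>R\<^esub> snd k) = k'})"

text \<open>The additive extension of w from the basis elements \<open>fdelta k\<close> to formal
  sums. Maps out of the tensor product are obtained from it by checking its values on the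
  relations.\<close>

definition formal_eval :: "('a, 'b) ring_scheme \<Rightarrow> ('k \<Rightarrow> 'a) \<Rightarrow> ('k \<Rightarrow> int) \<Rightarrow> 'a" where
  "formal_eval R w f = finsum R (\<lambda>k. add_pow R (f k) (w k)) {k. f k \<noteq> 0}"

lemma formal_sums_zero: "0 \<in> formal_sums R M"
  by (simp add: formal_sums_def)

lemma formal_sums_fdelta: "x \<in> carrier M \<Longrightarrow> s \<in> carrier R \<Longrightarrow> fdelta (x, s) \<in> formal_sums R M"
  by (auto simp: formal_sums_def fdelta_def)

lemma formal_sums_add: "f \<in> formal_sums R M \<Longrightarrow> g \<in> formal_sums R M \<Longrightarrow> f + g \<in> formal_sums R M"
proof -
  assume f: "f \<in> formal_sums R M" and g: "g \<in> formal_sums R M"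
  have "{k. (f + g) k \<noteq> 0} \<subseteq> {k. f k \<noteq> 0} \<union> {k. g k \<noteq> 0}" by auto
  then show ?thesis using f g unfolding formal_sums_def
    by (auto intro: finite_subset)
qed

lemma formal_sums_uminus: "f \<in> formal_sums R M \<Longrightarrow> - f \<in> formal_sums R M"
  by (simp add: formal_sums_def)

lemma formal_sums_diff: "f \<in> formal_sums R M \<Longrightarrow> g \<in> formal_sums R M \<Longrightarrow> f - g \<in> formal_sums R M"
  using formal_sums_add[OF _ formal_sums_uminus, of f R M g] by simp

lemma formal_sums_sum:
  "finite A \<Longrightarrow> (\<And>i. i \<in> A \<Longrightarrow> f i \<in> formal_sums R M) \<Longrightarrow> sum f A \<in> formal_sums R M"
  by (induction A rule: finite_induct) (auto intro: formal_sums_zero formal_sums_add)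

text \<open>The formal sums form the free abelian group on the pairs. The auxiliary facts treat
  natural multiples of one basis element, then integer multiples, then sums over the support;
  membership in \<open>formal_sums\<close> is carried along because the rules \<open>a\<close> and
  \<open>u\<close> ask for it.\<close>

lemma formal_sums_induct [consumes 1, case_names fdelta add uminus zero]:
  assumes f: "f \<in> formal_sums R M"
    and d: "\<And>x s. x \<in> carrier M \<Longrightarrow> s \<in> carrier R \<Longrightarrow> P (fdelta (x, s))"
    and a: "\<And>f g. f \<in> formal_sums R M \<Longrightarrow> g \<in> formal_sums R M \<Longrightarrow> P f \<Longrightarrow> P g \<Longrightarrow> P (f + g)"
    and u: "\<And>f. f \<in> formal_sums R M \<Longrightarrow> P f \<Longrightarrow> P (- f)"
    and z: "P 0"
  shows "P f"
proof -
  have S: "finite {k. f k \<noteq> 0}" "{k. f k \<noteq> 0} \<subseteq> carrier M \<times> carrier R" using f by (auto simp: formal_sums_def)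
  have 1: "(\<lambda>k'. int n * fdelta k k') \<in> formal_sums R M \<and> P (\<lambda>k'. int n * fdelta k k')"
    if "k \<in> carrier M \<times> carrier R" for k n
  proof (induction n)
    case 0
    have e: "(\<lambda>k'. int 0 * fdelta k k') = 0" by auto
    from z formal_sums_zero show ?case unfolding e by (rule conjI[rotated])
  next
    case (Suc n)
    have "(\<lambda>k'. int (Suc n) * fdelta k k') = fdelta k + (\<lambda>k'. int n * fdelta k k')"
      by (auto simp: algebra_simps)
    moreover have "fdelta k \<in> formal_sums R M" "P (fdelta k)"
      using that d formal_sums_fdelta[of "fst k" M "snd k" R] by auto
    ultimately show ?case using Suc a[of "fdelta k" "\<lambda>k'. int n * fdelta k k'"]
        formal_sums_add[of "fdelta k" R M "\<lambda>k'. int n * fdelta k k'"] by (simp only: simp_thms)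
  qed
  have 2: "(\<lambda>k'. c * fdelta k k') \<in> formal_sums R M \<and> P (\<lambda>k'. c * fdelta k k')"
    if "k \<in> carrier M \<times> carrier R" for k c
  proof (cases "c \<ge> 0")
    case True
    then show ?thesis using 1[OF that, of "nat c"] by simp
  next
    case False
    then have "(\<lambda>k'. c * fdelta k k') = - (\<lambda>k'. int (nat (- c)) * fdelta k k')" by auto
    then show ?thesis using 1[OF that, of "nat (- c)"] u[of "\<lambda>k'. int (nat (- c)) * fdelta k k'"]
        formal_sums_uminus[of "\<lambda>k'. int (nat (- c)) * fdelta k k'" R M] by (simp only: simp_thms)
  qed
  have 3: "sum (\<lambda>k k'. f k * fdelta k k') A \<in> formal_sums R M \<and> P (sum (\<lambda>k k'. f k * fdelta k k') A)"
    if "finite A" "A \<subseteq> carrier M \<times> carrier R" for A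
    using that
  proof (induction A rule: finite_induct)
    case empty
    from z formal_sums_zero show ?case unfolding sum.empty by (rule conjI[rotated])
  next
    case (insert k A)
    have "k \<in> carrier M \<times> carrier R" using insert.prems by simp
    note k = 2[OF this, of "f k"]
    have IH: "sum (\<lambda>k k'. f k * fdelta k k') A \<in> formal_sums R M \<and> P (sum (\<lambda>k k'. f k * fdelta k k') A)"
      by (rule insert.IH) (use insert.prems in simp)
    show ?case unfolding sum.insert[OF insert.hyps]
      by (rule conjI[OF formal_sums_add[OF conjunct1[OF k] conjunct1[OF IH]]
        a[OF conjunct1[OF k] conjunct1[OF IH] conjunct2[OF k] conjunct2[OF IH]]])
  qed
  have "sum (\<lambda>k k'. f k * fdelta k k') {k. f k \<noteq> 0} = f"
  proof
    fix k'
    have "sum (\<lambda>k k'. f k * fdelta k k') {k. f k \<noteq> 0} k' = (\<Sum>k | f k \<noteq> 0. f k * fdelta k k')"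
      using S(1) by (induction rule: finite_induct) auto
    also have "\<dots> = (\<Sum>k | f k \<noteq> 0. if k = k' then f k else 0)" by (intro sum.cong) (auto simp: fdelta_def)
    also have "\<dots> = f k'" using S(1) by (simp add: sum.delta)
    finally show "sum (\<lambda>k k'. f k * fdelta k k') {k. f k \<noteq> 0} k' = f k'" .
  qed
  then show ?thesis using 3[OF S] by (simp only: simp_thms)
qed

text \<open>Summing over any finite set that contains the support lets several formal sums share an
  index set, although their supports differ. \<open>formal_eval_superset\<close> serves the same
  purpose.\<close>

lemma tensor_push_superset:
  assumes "finite A" "{k. f k \<noteq> 0} \<subseteq> A"
  shows "tensor_push R r f k' = sum f {k \<in> A. (fst k, r \<otimes>\<^bsub>R\<^esub> snd k) = k'}"
  unfolding tensor_push_def using assms by (intro sum.mono_neutral_left) auto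

lemma tensor_push_add:
  assumes "finite {k. f k \<noteq> 0}" "finite {k. g k \<noteq> 0}"
  shows "tensor_push R r (f + g) = tensor_push R r f + tensor_push R r g"
proof
  fix k'
  let ?A = "{k. f k \<noteq> 0} \<union> {k. g k \<noteq> 0}"
  have A: "finite ?A" using assms by simp
  have "tensor_push R r (f + g) k' = sum (f + g) {k \<in> ?A. (fst k, r \<otimes>\<^bsub>R\<^esub> snd k) = k'}"
    by (rule tensor_push_superset[OF A]) auto
  moreover have "tensor_push R r f k' = sum f {k \<in> ?A. (fst k, r \<otimes>\<^bsub>R\<^esub> snd k) = k'}"
    by (rule tensor_push_superset[OF A]) auto
  moreover have "tensor_push R r g k' = sum g {k \<in> ?A. (fst k, r \<otimes>\<^bsub>R\<^esub> snd k) = k'}"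
    by (rule tensor_push_superset[OF A]) auto
  ultimately show "tensor_push R r (f + g) k' = (tensor_push R r f + tensor_push R r g) k'"
    by (simp add: sum.distrib)
qed

lemma tensor_push_zero: "tensor_push R r 0 = 0"
  by (auto simp: tensor_push_def)

lemma tensor_push_uminus: "tensor_push R r (- f) = - tensor_push R r f"
  by (auto simp: tensor_push_def sum_negf)

lemma tensor_push_diff:
  assumes "finite {k. f k \<noteq> 0}" "finite {k. g k \<noteq> 0}"
  shows "tensor_push R r (f - g) = tensor_push R r f - tensor_push R r g"
  using tensor_push_add[of f "- g" R r] assms by (simp add: tensor_push_uminus)

lemma tensor_push_fdelta: "tensor_push R r (fdelta (x, s)) = fdelta (x, r \<otimes>\<^bsub>R\<^esub> s)"
proof
  fix k'
  have "tensor_push R r (fdelta (x, s)) k' = sum (fdelta (x, s)) {k \<in> {(x, s)}. (fst k, r \<otimes>\<^bsub>R\<^esub> snd k) = k'}"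
    by (rule tensor_push_superset) (auto simp: fdelta_def)
  also have "{k \<in> {(x, s)}. (fst k, r \<otimes>\<^bsub>R\<^esub> snd k) = k'} = (if k' = (x, r \<otimes>\<^bsub>R\<^esub> s) then {(x, s)} else {})"
    by auto
  finally show "tensor_push R r (fdelta (x, s)) k' = fdelta (x, r \<otimes>\<^bsub>R\<^esub> s) k'"
    by (simp add: fdelta_def)
qed

context cring
begin

lemma formal_eval_superset:
  assumes "finite A" "{k. f k \<noteq> 0} \<subseteq> A" "\<And>k. k \<in> A \<Longrightarrow> w k \<in> carrier R"
  shows "formal_eval R w f = finsum R (\<lambda>k. add_pow R (f k) (w k)) A"
  unfolding formal_eval_def using assms
  by (intro add.finprod_mono_neutral_cong_left) (auto simp: add_pow_int_ge)

lemma formal_eval_add: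
  assumes f: "finite {k. f k \<noteq> 0}" "\<And>k. f k \<noteq> 0 \<Longrightarrow> w k \<in> carrier R"
    and g: "finite {k. g k \<noteq> 0}" "\<And>k. g k \<noteq> 0 \<Longrightarrow> w k \<in> carrier R"
  shows "formal_eval R w (f + g) = formal_eval R w f \<oplus> formal_eval R w g"
proof -
  let ?A = "{k. f k \<noteq> 0} \<union> {k. g k \<noteq> 0}"
  have A: "finite ?A" and w: "\<And>k. k \<in> ?A \<Longrightarrow> w k \<in> carrier R" using f g by auto
  have "formal_eval R w (f + g) = finsum R (\<lambda>k. add_pow R ((f + g) k) (w k)) ?A"
    by (rule formal_eval_superset[OF A _ w]) auto
  moreover have "formal_eval R w f = finsum R (\<lambda>k. add_pow R (f k) (w k)) ?A"
    by (rule formal_eval_superset[OF A _ w]) auto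
  moreover have "formal_eval R w g = finsum R (\<lambda>k. add_pow R (g k) (w k)) ?A"
    by (rule formal_eval_superset[OF A _ w]) auto
  moreover have "finsum R (\<lambda>k. add_pow R ((f + g) k) (w k)) ?A =
     finsum R (\<lambda>k. add_pow R (f k) (w k) \<oplus> add_pow R (g k) (w k)) ?A"
    using w by (intro finsum_cong') (auto simp: add.int_pow_mult)
  ultimately show ?thesis using w by (simp add: finsum_addf Pi_def)
qed

lemma formal_eval_closed:
  assumes "\<And>k. f k \<noteq> 0 \<Longrightarrow> w k \<in> carrier R" shows "formal_eval R w f \<in> carrier R"
  unfolding formal_eval_def using assms by (intro finsum_closed) auto

lemma formal_eval_uminus:
  assumes f: "finite {k. f k \<noteq> 0}" "\<And>k. f k \<noteq> 0 \<Longrightarrow> w k \<in> carrier R"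
  shows "formal_eval R w (- f) = \<ominus> formal_eval R w f"
proof -
  have "formal_eval R w (f + - f) = formal_eval R w f \<oplus> formal_eval R w (- f)"
    by (rule formal_eval_add) (use f in auto)
  moreover have "formal_eval R w (f + - f) = \<zero>" by (simp add: formal_eval_def)
  ultimately show ?thesis
    using formal_eval_closed[of f w] formal_eval_closed[of "- f" w] f(2)
      minus_equality[of "formal_eval R w (- f)" "formal_eval R w f"]
    by (simp add: a_comm)
qed

lemma formal_eval_diff:
  assumes f: "finite {k. f k \<noteq> 0}" "\<And>k. f k \<noteq> 0 \<Longrightarrow> w k \<in> carrier R"
    and g: "finite {k. g k \<noteq> 0}" "\<And>k. g k \<noteq> 0 \<Longrightarrow> w k \<in> carrier R"
  shows "formal_eval R w (f - g) = formal_eval R w f \<ominus> formal_eval R w g"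
proof -
  have "formal_eval R w (f + - g) = formal_eval R w f \<oplus> formal_eval R w (- g)"
    by (rule formal_eval_add) (use f g in auto)
  then show ?thesis using formal_eval_uminus[of g w] g by (simp add: minus_eq)
qed

lemma formal_eval_fdelta: "w k \<in> carrier R \<Longrightarrow> formal_eval R w (fdelta k) = w k"
proof -
  assume w: "w k \<in> carrier R"
  have "formal_eval R w (fdelta k) = finsum R (\<lambda>k'. add_pow R (fdelta k k') (w k')) {k}"
    by (rule formal_eval_superset) (use w in \<open>auto simp: fdelta_def\<close>)
  then show ?thesis using w by (simp add: fdelta_def add.int_pow_1)
qed

lemma formal_eval_zero: "formal_eval R w 0 = \<zero>"
  by (simp add: formal_eval_def)

end

text \<open>The rules of an inductive set of functions are stored eta-expanded, which derails the
  simplifier; the following copies are eta-contracted.\<close>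

lemma tensor_rels_zero: "0 \<in> tensor_rels R M q"
  by (rule tr_zero)

lemma tensor_rels_add_left: "x \<in> carrier M \<Longrightarrow> y \<in> carrier M \<Longrightarrow> s \<in> carrier R \<Longrightarrow>
  fdelta (x \<oplus>\<^bsub>M\<^esub> y, s) - fdelta (x, s) - fdelta (y, s) \<in> tensor_rels R M q"
  by (rule tr_addl)

lemma tensor_rels_add_right: "x \<in> carrier M \<Longrightarrow> s \<in> carrier R \<Longrightarrow> t \<in> carrier R \<Longrightarrow>
  fdelta (x, s \<oplus>\<^bsub>R\<^esub> t) - fdelta (x, s) - fdelta (x, t) \<in> tensor_rels R M q"
  by (rule tr_addr)

lemma tensor_rels_balanced: "x \<in> carrier M \<Longrightarrow> r \<in> carrier R \<Longrightarrow> s \<in> carrier R \<Longrightarrow>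
  fdelta (r \<odot>\<^bsub>M\<^esub> x, s) - fdelta (x, (r [^]\<^bsub>R\<^esub> q) \<otimes>\<^bsub>R\<^esub> s) \<in> tensor_rels R M q"
  by (rule tr_bal)

lemma tensor_rels_plus: "f \<in> tensor_rels R M q \<Longrightarrow> g \<in> tensor_rels R M q \<Longrightarrow> f + g \<in> tensor_rels R M q"
  by (rule tr_plus)

lemma tensor_rels_uminus: "f \<in> tensor_rels R M q \<Longrightarrow> - f \<in> tensor_rels R M q"
  by (rule tr_uminus)

lemma tensor_rels_induct [consumes 1, case_names zero add_left add_right balanced plus uminus]:
  assumes f: "f \<in> tensor_rels R M q" and zero: "P 0"
    and add_left: "\<And>x y s. x \<in> carrier M \<Longrightarrow> y \<in> carrier M \<Longrightarrow> s \<in> carrier R \<Longrightarrow>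
      P (fdelta (x \<oplus>\<^bsub>M\<^esub> y, s) - fdelta (x, s) - fdelta (y, s))"
    and add_right: "\<And>x s t. x \<in> carrier M \<Longrightarrow> s \<in> carrier R \<Longrightarrow> t \<in> carrier R \<Longrightarrow>
      P (fdelta (x, s \<oplus>\<^bsub>R\<^esub> t) - fdelta (x, s) - fdelta (x, t))"
    and balanced: "\<And>x r s. x \<in> carrier M \<Longrightarrow> r \<in> carrier R \<Longrightarrow> s \<in> carrier R \<Longrightarrow>
      P (fdelta (r \<odot>\<^bsub>M\<^esub> x, s) - fdelta (x, (r [^]\<^bsub>R\<^esub> q) \<otimes>\<^bsub>R\<^esub> s))"
    and plus: "\<And>f g. f \<in> tensor_rels R M q \<Longrightarrow> P f \<Longrightarrow> g \<in> tensor_rels R M q \<Longrightarrow> P g \<Longrightarrow> P (f + g)"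
    and uminus: "\<And>f. f \<in> tensor_rels R M q \<Longrightarrow> P f \<Longrightarrow> P (- f)"
  shows "P f"
  using f by (rule tensor_rels.induct) (fact zero add_left add_right balanced plus uminus)+

lemma tensor_rels_diff: "f \<in> tensor_rels R M q \<Longrightarrow> g \<in> tensor_rels R M q \<Longrightarrow> f - g \<in> tensor_rels R M q"
  using tensor_rels_plus[OF _ tensor_rels_uminus, of f R M q g] by simp

lemma tensor_rels_sum:
  "finite A \<Longrightarrow> (\<And>i. i \<in> A \<Longrightarrow> f i \<in> tensor_rels R M q) \<Longrightarrow> sum f A \<in> tensor_rels R M q"
  by (induction A rule: finite_induct) (auto intro: tensor_rels_zero tensor_rels_plus)

context
  fixes R :: "('a, 'b) ring_scheme" (structure) and M :: "('a, 'c) module" and q :: nat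
  assumes module: "module R M"
begin

interpretation module R M by (rule module)

lemma tensor_rels_formal_sums:
  assumes "f \<in> tensor_rels R M q" shows "f \<in> formal_sums R M"
  using assms
proof (induction rule: tensor_rels_induct)
  case (add_left x y s)
  then show "fdelta (x \<oplus>\<^bsub>M\<^esub> y, s) - fdelta (x, s) - fdelta (y, s) \<in> formal_sums R M"
    by (intro formal_sums_diff formal_sums_fdelta) auto
next
  case (add_right x s t)
  then show "fdelta (x, s \<oplus> t) - fdelta (x, s) - fdelta (x, t) \<in> formal_sums R M"
    by (intro formal_sums_diff formal_sums_fdelta) auto
next
  case (balanced x r s)
  then show "fdelta (r \<odot>\<^bsub>M\<^esub> x, s) - fdelta (x, (r [^] q) \<otimes> s) \<in> formal_sums R M"
    by (intro formal_sums_diff formal_sums_fdelta) auto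
qed (rule formal_sums_zero, rule formal_sums_add, assumption+, rule formal_sums_uminus, assumption)

lemma formal_sums_finite: "f \<in> formal_sums R M \<Longrightarrow> finite {k. f k \<noteq> 0}"
  by (simp add: formal_sums_def)

lemma tensor_push_diff_formal_sums:
  "f \<in> formal_sums R M \<Longrightarrow> g \<in> formal_sums R M \<Longrightarrow>
    tensor_push R r (f - g) = tensor_push R r f - tensor_push R r g"
  by (intro tensor_push_diff formal_sums_finite)

text \<open>Scaling the right factor commutes with the factor c^q of the balanced relation, so
  relations go to relations. This makes scalar multiplication on classes well defined.\<close>

lemma tensor_push_rels:
  assumes "f \<in> tensor_rels R M q" and r: "r \<in> carrier R"
  shows "tensor_push R r f \<in> tensor_rels R M q"
  using assms(1)
proof (induction rule: tensor_rels_induct)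
  case zero
  show "tensor_push R r 0 \<in> tensor_rels R M q" by (simp add: tensor_push_zero tensor_rels_zero)
next
  case (add_left x y s)
  then have F: "fdelta (x \<oplus>\<^bsub>M\<^esub> y, s) \<in> formal_sums R M" "fdelta (x, s) \<in> formal_sums R M"
    "fdelta (y, s) \<in> formal_sums R M" by (auto intro: formal_sums_fdelta)
  note F' = formal_sums_diff[OF F(1,2)]
  show "tensor_push R r (fdelta (x \<oplus>\<^bsub>M\<^esub> y, s) - fdelta (x, s) - fdelta (y, s)) \<in> tensor_rels R M q"
    using add_left r by (simp add: tensor_push_diff_formal_sums F F' tensor_push_fdelta tensor_rels_add_left)
next
  case (add_right x s t)
  then have F: "fdelta (x, s \<oplus> t) \<in> formal_sums R M" "fdelta (x, s) \<in> formal_sums R M"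
    "fdelta (x, t) \<in> formal_sums R M" by (auto intro: formal_sums_fdelta)
  note F' = formal_sums_diff[OF F(1,2)]
  show "tensor_push R r (fdelta (x, s \<oplus> t) - fdelta (x, s) - fdelta (x, t)) \<in> tensor_rels R M q"
    using add_right r
    by (simp add: tensor_push_diff_formal_sums F F' tensor_push_fdelta tensor_rels_add_right R.r_distr)
next
  case (balanced x c s)
  then have F: "fdelta (c \<odot>\<^bsub>M\<^esub> x, s) \<in> formal_sums R M" "fdelta (x, c [^] q \<otimes> s) \<in> formal_sums R M"
    by (auto intro: formal_sums_fdelta)
  have "r \<otimes> (c [^] q \<otimes> s) = c [^] q \<otimes> (r \<otimes> s)" using balanced r by (simp add: R.m_lcomm)
  then show "tensor_push R r (fdelta (c \<odot>\<^bsub>M\<^esub> x, s) - fdelta (x, (c [^] q) \<otimes> s)) \<in> tensor_rels R M q"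
    using balanced r
    by (simp add: tensor_push_diff_formal_sums F tensor_push_fdelta tensor_rels_balanced)
next
  case (plus f g)
  then show "tensor_push R r (f + g) \<in> tensor_rels R M q"
    using formal_sums_finite[OF tensor_rels_formal_sums] by (simp add: tensor_push_add tensor_rels_plus)
next
  case (uminus f)
  then show "tensor_push R r (- f) \<in> tensor_rels R M q" by (simp add: tensor_push_uminus tensor_rels_uminus)
qed

lemma tensor_push_formal_sums:
  assumes "f \<in> formal_sums R M" and r: "r \<in> carrier R"
  shows "tensor_push R r f \<in> formal_sums R M"
  using assms(1)
proof (induction rule: formal_sums_induct)
  case (fdelta x s)
  then show ?case using r by (simp add: tensor_push_fdelta formal_sums_fdelta)
next
  case (add f g)
  then have "tensor_push R r (f + g) = tensor_push R r f + tensor_push R r g"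
    by (intro tensor_push_add formal_sums_finite)
  then show "tensor_push R r (f + g) \<in> formal_sums R M" using add by (simp only: formal_sums_add)
next
  case (uminus f)
  then show "tensor_push R r (- f) \<in> formal_sums R M" by (simp add: tensor_push_uminus formal_sums_uminus)
next
  case zero
  show "tensor_push R r 0 \<in> formal_sums R M" by (simp add: tensor_push_zero formal_sums_zero)
qed

lemma tensor_class_eq_iff:
  assumes "f \<in> formal_sums R M" "g \<in> formal_sums R M"
  shows "tensor_class R M q f = tensor_class R M q g \<longleftrightarrow> f - g \<in> tensor_rels R M q"
proof
  assume "tensor_class R M q f = tensor_class R M q g"
  moreover have "f \<in> tensor_class R M q f" using assms by (simp add: tensor_class_def tensor_rels_zero)
  ultimately show "f - g \<in> tensor_rels R M q" by (simp add: tensor_class_def)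
next
  assume d: "f - g \<in> tensor_rels R M q"
  have "h - f \<in> tensor_rels R M q \<longleftrightarrow> h - g \<in> tensor_rels R M q" for h
    using tensor_rels_plus[OF _ d, of "h - f"] tensor_rels_diff[OF _ d, of "h - g"] by auto
  then show "tensor_class R M q f = tensor_class R M q g" by (simp add: tensor_class_def)
qed

lemma rep_of_tensor_class:
  assumes "f \<in> formal_sums R M"
  shows "rep_of (tensor_class R M q f) \<in> formal_sums R M"
    "rep_of (tensor_class R M q f) - f \<in> tensor_rels R M q"
proof -
  have "f \<in> tensor_class R M q f" using assms by (simp add: tensor_class_def tensor_rels_zero)
  then have "rep_of (tensor_class R M q f) \<in> tensor_class R M q f"
    unfolding rep_of_def by (rule someI[where P = "\<lambda>e. e \<in> tensor_class R M q f"])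
  then show "rep_of (tensor_class R M q f) \<in> formal_sums R M"
    "rep_of (tensor_class R M q f) - f \<in> tensor_rels R M q" by (auto simp: tensor_class_def)
qed

text \<open>The operations are defined through arbitrary representatives; any two differ by a
  relation, so the result can be computed with f and g themselves. From here on
  \<open>rep_of\<close> no longer occurs for tensors.\<close>

lemma frobenius_functor_simps:
  assumes q: "q = p ^ n"
  shows "carrier (frobenius_functor R p n M) = tensor_class R M q ` formal_sums R M"
    "\<zero>\<^bsub>frobenius_functor R p n M\<^esub> = tensor_class R M q 0"
    "\<And>f g. f \<in> formal_sums R M \<Longrightarrow> g \<in> formal_sums R M \<Longrightarrow>
       tensor_class R M q f \<oplus>\<^bsub>frobenius_functor R p n M\<^esub> tensor_class R M q g = tensor_class R M q (f + g)"
    "\<And>r f. r \<in> carrier R \<Longrightarrow> f \<in> formal_sums R M \<Longrightarrow>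
       r \<odot>\<^bsub>frobenius_functor R p n M\<^esub> tensor_class R M q f = tensor_class R M q (tensor_push R r f)"
proof -
  show "carrier (frobenius_functor R p n M) = tensor_class R M q ` formal_sums R M"
    "\<zero>\<^bsub>frobenius_functor R p n M\<^esub> = tensor_class R M q 0"
    by (simp_all add: frobenius_functor_def q Let_def)
next
  fix f g assume f: "f \<in> formal_sums R M" and g: "g \<in> formal_sums R M"
  let ?f = "rep_of (tensor_class R M q f)" and ?g = "rep_of (tensor_class R M q g)"
  have "(?f + ?g) - (f + g) = (?f - f) + (?g - g)" by simp
  then have "(?f + ?g) - (f + g) \<in> tensor_rels R M q"
    using tensor_rels_plus[OF rep_of_tensor_class(2)[OF f] rep_of_tensor_class(2)[OF g]] by (simp only:)
  then have "tensor_class R M q (?f + ?g) = tensor_class R M q (f + g)"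
    using tensor_class_eq_iff[of "?f + ?g" "f + g"] rep_of_tensor_class(1)[OF f] rep_of_tensor_class(1)[OF g] f g
    by (simp add: formal_sums_add)
  then show "tensor_class R M q f \<oplus>\<^bsub>frobenius_functor R p n M\<^esub> tensor_class R M q g = tensor_class R M q (f + g)"
    by (simp add: frobenius_functor_def q Let_def)
next
  fix r f assume r: "r \<in> carrier R" and f: "f \<in> formal_sums R M"
  let ?f = "rep_of (tensor_class R M q f)"
  have "tensor_push R r (?f - f) \<in> tensor_rels R M q"
    by (rule tensor_push_rels[OF rep_of_tensor_class(2)[OF f] r])
  then have "tensor_push R r ?f - tensor_push R r f \<in> tensor_rels R M q"
    using formal_sums_finite rep_of_tensor_class(1)[OF f] f by (simp add: tensor_push_diff)
  then have "tensor_class R M q (tensor_push R r ?f) = tensor_class R M q (tensor_push R r f)"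
    using tensor_class_eq_iff[of "tensor_push R r ?f" "tensor_push R r f"]
      tensor_push_formal_sums[OF rep_of_tensor_class(1)[OF f] r] tensor_push_formal_sums[OF f r] by simp
  then show "r \<odot>\<^bsub>frobenius_functor R p n M\<^esub> tensor_class R M q f = tensor_class R M q (tensor_push R r f)"
    by (simp add: frobenius_functor_def q Let_def tensor_push_def)
qed

text \<open>The additivity relation for 0 + 0 is the negative of this element.\<close>

lemma fdelta_zero_right: "x \<in> carrier M \<Longrightarrow> fdelta (x, \<zero>) \<in> tensor_rels R M q"
  using tensor_rels_uminus[OF tensor_rels_add_right[of x M "\<zero>" R "\<zero>" q]] by simp

lemma fdelta_zero_left: "s \<in> carrier R \<Longrightarrow> fdelta (\<zero>\<^bsub>M\<^esub>, s) \<in> tensor_rels R M q"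
  using tensor_rels_uminus[OF tensor_rels_add_left[of "\<zero>\<^bsub>M\<^esub>" M "\<zero>\<^bsub>M\<^esub>" s R q]] by simp

text \<open>Here q-th powers arise: the balanced relation carries a coefficient of M across the
  tensor sign as its q-th power.\<close>

lemma fdelta_finsum:
  assumes "finite A" "\<And>i. i \<in> A \<Longrightarrow> a i \<in> carrier R" "\<And>i. i \<in> A \<Longrightarrow> e i \<in> carrier M" "s \<in> carrier R"
  shows "fdelta (finsum M (\<lambda>i. a i \<odot>\<^bsub>M\<^esub> e i) A, s) - (\<Sum>i\<in>A. fdelta (e i, a i [^] q \<otimes> s)) \<in> tensor_rels R M q"
  using assms
proof (induction A rule: finite_induct)
  case empty
  then show "fdelta (finsum M (\<lambda>i. a i \<odot>\<^bsub>M\<^esub> e i) {}, s) - (\<Sum>i\<in>{}. fdelta (e i, a i [^] q \<otimes> s)) \<in> tensor_rels R M q"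
    using fdelta_zero_left by simp
next
  case (insert j A)
  let ?x = "finsum M (\<lambda>i. a i \<odot>\<^bsub>M\<^esub> e i) A"
  have x: "?x \<in> carrier M" using insert by (intro M.finsum_closed) auto
  have ej: "a j \<odot>\<^bsub>M\<^esub> e j \<in> carrier M" using insert by auto
  have "finsum M (\<lambda>i. a i \<odot>\<^bsub>M\<^esub> e i) (insert j A) = a j \<odot>\<^bsub>M\<^esub> e j \<oplus>\<^bsub>M\<^esub> ?x"
    using insert by (intro M.finsum_insert) auto
  moreover have "fdelta (a j \<odot>\<^bsub>M\<^esub> e j \<oplus>\<^bsub>M\<^esub> ?x, s) - fdelta (a j \<odot>\<^bsub>M\<^esub> e j, s) - fdelta (?x, s) \<in> tensor_rels R M q"
    by (rule tensor_rels_add_left[OF ej x insert.prems(3)])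
  moreover have "fdelta (a j \<odot>\<^bsub>M\<^esub> e j, s) - fdelta (e j, a j [^] q \<otimes> s) \<in> tensor_rels R M q"
    using insert by (intro tensor_rels_balanced) auto
  moreover have "fdelta (?x, s) - (\<Sum>i\<in>A. fdelta (e i, a i [^] q \<otimes> s)) \<in> tensor_rels R M q"
    by (rule insert.IH) (use insert.prems in auto)
  moreover have "fdelta (a j \<odot>\<^bsub>M\<^esub> e j \<oplus>\<^bsub>M\<^esub> ?x, s) - (\<Sum>i\<in>insert j A. fdelta (e i, a i [^] q \<otimes> s)) =
     (fdelta (a j \<odot>\<^bsub>M\<^esub> e j \<oplus>\<^bsub>M\<^esub> ?x, s) - fdelta (a j \<odot>\<^bsub>M\<^esub> e j, s) - fdelta (?x, s)) +
     ((fdelta (a j \<odot>\<^bsub>M\<^esub> e j, s) - fdelta (e j, a j [^] q \<otimes> s)) +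
      (fdelta (?x, s) - (\<Sum>i\<in>A. fdelta (e i, a i [^] q \<otimes> s))))"
    using insert(1,2) by simp
  ultimately show "fdelta (finsum M (\<lambda>i. a i \<odot>\<^bsub>M\<^esub> e i) (insert j A), s) -
      (\<Sum>i\<in>insert j A. fdelta (e i, a i [^] q \<otimes> s)) \<in> tensor_rels R M q"
    by (simp only: tensor_rels_plus)
qed

end

text \<open>All axioms are equations between images of elements of G. For F^n(M) this replaces a
  verification on tensor classes by the surjection from R^k.\<close>

lemma module_surjective_image:
  assumes G: "module R G"
    and \<phi>: "\<phi> ` carrier G = carrier N" "\<phi> \<zero>\<^bsub>G\<^esub> = \<zero>\<^bsub>N\<^esub>"
      "\<And>u v. u \<in> carrier G \<Longrightarrow> v \<in> carrier G \<Longrightarrow> \<phi> (u \<oplus>\<^bsub>G\<^esub> v) = \<phi> u \<oplus>\<^bsub>N\<^esub> \<phi> v"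
      "\<And>a v. a \<in> carrier R \<Longrightarrow> v \<in> carrier G \<Longrightarrow> \<phi> (a \<odot>\<^bsub>G\<^esub> v) = a \<odot>\<^bsub>N\<^esub> \<phi> v"
  shows "module R N"
proof -
  interpret G: module R G by (rule G)
  have cl: "\<phi> v \<in> carrier N" if "v \<in> carrier G" for v using \<phi>(1) that by auto
  have ob: "\<exists>v\<in>carrier G. x = \<phi> v" if "x \<in> carrier N" for x
    using that unfolding \<phi>(1)[symmetric] by auto
  show ?thesis
  proof (rule moduleI)
    show "abelian_group N"
    proof (rule abelian_groupI)
      fix x y assume "x \<in> carrier N" "y \<in> carrier N"
      then obtain u v where u: "u \<in> carrier G" "x = \<phi> u" "v \<in> carrier G" "y = \<phi> v" using ob by meson
      show "x \<oplus>\<^bsub>N\<^esub> y \<in> carrier N" using u cl by (simp add: \<phi>(3)[symmetric])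
      show "x \<oplus>\<^bsub>N\<^esub> y = y \<oplus>\<^bsub>N\<^esub> x" using u by (simp add: \<phi>(3)[symmetric] G.M.a_comm)
    next
      show "\<zero>\<^bsub>N\<^esub> \<in> carrier N" using cl[OF G.M.zero_closed] \<phi>(2) by simp
    next
      fix x y z assume "x \<in> carrier N" "y \<in> carrier N" "z \<in> carrier N"
      then obtain u v w where u: "u \<in> carrier G" "x = \<phi> u" "v \<in> carrier G" "y = \<phi> v" "w \<in> carrier G" "z = \<phi> w"
        using ob by meson
      show "x \<oplus>\<^bsub>N\<^esub> y \<oplus>\<^bsub>N\<^esub> z = x \<oplus>\<^bsub>N\<^esub> (y \<oplus>\<^bsub>N\<^esub> z)" using u by (simp add: \<phi>(3)[symmetric] G.M.a_assoc)
    next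
      fix x assume "x \<in> carrier N"
      then obtain u where u: "u \<in> carrier G" "x = \<phi> u" using ob by meson
      show "\<zero>\<^bsub>N\<^esub> \<oplus>\<^bsub>N\<^esub> x = x" using u by (simp add: \<phi>(3)[symmetric] \<phi>(2)[symmetric])
      show "\<exists>y\<in>carrier N. y \<oplus>\<^bsub>N\<^esub> x = \<zero>\<^bsub>N\<^esub>"
        using u cl by (intro bexI[of _ "\<phi> (\<ominus>\<^bsub>G\<^esub> u)"]) (simp_all add: \<phi>(3)[symmetric] \<phi>(2)[symmetric] G.M.l_neg)
    qed
  next
    show "cring R" by (rule G.is_cring)
  next
    fix a x assume a: "a \<in> carrier R" and "x \<in> carrier N"
    then obtain u where u: "u \<in> carrier G" "x = \<phi> u" using ob by meson
    show "a \<odot>\<^bsub>N\<^esub> x \<in> carrier N" using a u cl by (simp add: \<phi>(4)[symmetric])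
  next
    fix a b x assume a: "a \<in> carrier R" "b \<in> carrier R" and "x \<in> carrier N"
    then obtain u where u: "u \<in> carrier G" "x = \<phi> u" using ob by meson
    show "(a \<oplus>\<^bsub>R\<^esub> b) \<odot>\<^bsub>N\<^esub> x = a \<odot>\<^bsub>N\<^esub> x \<oplus>\<^bsub>N\<^esub> b \<odot>\<^bsub>N\<^esub> x"
      using a u by (simp add: \<phi>(3,4)[symmetric] G.smult_l_distr)
    show "(a \<otimes>\<^bsub>R\<^esub> b) \<odot>\<^bsub>N\<^esub> x = a \<odot>\<^bsub>N\<^esub> (b \<odot>\<^bsub>N\<^esub> x)"
      using a u by (simp add: \<phi>(3,4)[symmetric] G.smult_assoc1)
  next
    fix a x y assume a: "a \<in> carrier R" and "x \<in> carrier N" "y \<in> carrier N"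
    then obtain u v where u: "u \<in> carrier G" "x = \<phi> u" "v \<in> carrier G" "y = \<phi> v" using ob by meson
    show "a \<odot>\<^bsub>N\<^esub> (x \<oplus>\<^bsub>N\<^esub> y) = a \<odot>\<^bsub>N\<^esub> x \<oplus>\<^bsub>N\<^esub> a \<odot>\<^bsub>N\<^esub> y"
      using a u by (simp add: \<phi>(3,4)[symmetric] G.smult_r_distr)
  next
    fix x assume "x \<in> carrier N"
    then obtain u where u: "u \<in> carrier G" "x = \<phi> u" using ob by meson
    show "\<one>\<^bsub>R\<^esub> \<odot>\<^bsub>N\<^esub> x = x" using u by (simp add: \<phi>(4)[symmetric])
  qed
qed

section \<open>The presentation of F^n(M) by generators of M\<close>

context
  fixes R :: "('a, 'b) ring_scheme" (structure) and m and M :: "('a, 'c) module"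
    and p n k :: nat and e :: "nat \<Rightarrow> 'c" and I :: "'a set"
  assumes module: "module R M" and ch: "ring_char_p R p"
    and I: "ideal I R" and pow: "\<And>a. a \<in> m \<Longrightarrow> a [^] (p ^ n) \<in> I"
    and e: "\<And>i. i < k \<Longrightarrow> e i \<in> carrier M"
    and gen: "\<And>x. x \<in> carrier M \<Longrightarrow> \<exists>a. (\<forall>i<k. a i \<in> carrier R) \<and> x = finsum M (\<lambda>i. a i \<odot>\<^bsub>M\<^esub> e i) {..<k}"
    and rel: "\<And>a i. (\<And>i. i < k \<Longrightarrow> a i \<in> carrier R) \<Longrightarrow> finsum M (\<lambda>i. a i \<odot>\<^bsub>M\<^esub> e i) {..<k} = \<zero>\<^bsub>M\<^esub> \<Longrightarrow> i < k \<Longrightarrow> a i \<in> m"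
begin

interpretation module R M by (rule module)

private lemma p: "Factorial_Ring.prime p" "add_pow R p \<one> = \<zero>"
  using ch by (auto simp: ring_char_p_def)

private abbreviation "q \<equiv> p ^ n"

private lemma add_diff_diff: "x \<in> carrier R \<Longrightarrow> y \<in> carrier R \<Longrightarrow> (x \<oplus> y) \<ominus> x \<ominus> y = \<zero>"
  by (simp add: R.minus_eq R.a_comm[of x y] R.a_assoc R.r_neg)

text \<open>The difference of two coordinate vectors of one element is a relation, so its entries
  lie in m and their q-th powers in I. Additivity of the Frobenius map then separates the two
  powers.\<close>

private lemma coordinates_unique_mod:
  assumes a: "\<And>i. i < k \<Longrightarrow> a i \<in> carrier R" and b: "\<And>i. i < k \<Longrightarrow> b i \<in> carrier R"
    and eq: "finsum M (\<lambda>i. a i \<odot>\<^bsub>M\<^esub> e i) {..<k} = finsum M (\<lambda>i. b i \<odot>\<^bsub>M\<^esub> e i) {..<k}" and i: "i < k"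
  shows "a i [^] q \<ominus> b i [^] q \<in> I"
proof -
  have "finsum M (\<lambda>i. b i \<odot>\<^bsub>M\<^esub> e i) {..<k} \<in> carrier M"
    using b e by (intro M.finsum_closed) auto
  then have "finsum M (\<lambda>i. (a i \<ominus> b i) \<odot>\<^bsub>M\<^esub> e i) {..<k} = \<zero>\<^bsub>M\<^esub>"
    using finsum_smult_diff[of a "{..<k}" b e] a b e eq by (simp add: Pi_def M.minus_eq M.r_neg)
  then have "a i \<ominus> b i \<in> m" using a b i by (intro rel[of "\<lambda>i. a i \<ominus> b i"]) auto
  then show ?thesis using pow[of "a i \<ominus> b i"] frobenius_power_diff[OF p a[OF i] b[OF i]] by simp
qed

text \<open>An arbitrary choice of coordinates. It need not be additive or linear; the next lemmas
  recover this for q-th powers modulo I.\<close>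

private definition "co x = (SOME a. (\<forall>i<k. a i \<in> carrier R) \<and> x = finsum M (\<lambda>i. a i \<odot>\<^bsub>M\<^esub> e i) {..<k})"

private lemma co:
  assumes "x \<in> carrier M"
  shows "i < k \<Longrightarrow> co x i \<in> carrier R" "finsum M (\<lambda>i. co x i \<odot>\<^bsub>M\<^esub> e i) {..<k} = x"
proof -
  have "(\<forall>i<k. co x i \<in> carrier R) \<and> x = finsum M (\<lambda>i. co x i \<odot>\<^bsub>M\<^esub> e i) {..<k}"
    unfolding co_def by (rule someI_ex[OF gen[OF assms]])
  then show "i < k \<Longrightarrow> co x i \<in> carrier R" "finsum M (\<lambda>i. co x i \<odot>\<^bsub>M\<^esub> e i) {..<k} = x" by simp_all
qed

private lemma co_mod:
  assumes "x \<in> carrier M" "\<And>i. i < k \<Longrightarrow> a i \<in> carrier R" "finsum M (\<lambda>i. a i \<odot>\<^bsub>M\<^esub> e i) {..<k} = x" "i < k"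
  shows "co x i [^] q \<ominus> a i [^] q \<in> I"
  using assms by (intro coordinates_unique_mod co) (auto simp: co)

private lemma co_add_mod:
  assumes x: "x \<in> carrier M" and y: "y \<in> carrier M" and i: "i < k"
  shows "co (x \<oplus>\<^bsub>M\<^esub> y) i [^] q \<ominus> (co x i [^] q \<oplus> co y i [^] q) \<in> I"
proof -
  have "co (x \<oplus>\<^bsub>M\<^esub> y) i [^] q \<ominus> (co x i \<oplus> co y i) [^] q \<in> I"
  proof (rule co_mod[of _ "\<lambda>i. co x i \<oplus> co y i"])
    have "finsum M (\<lambda>i. (co x i \<oplus> co y i) \<odot>\<^bsub>M\<^esub> e i) {..<k} =
       finsum M (\<lambda>i. co x i \<odot>\<^bsub>M\<^esub> e i \<oplus>\<^bsub>M\<^esub> co y i \<odot>\<^bsub>M\<^esub> e i) {..<k}"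
      using x y e by (intro M.finsum_cong') (auto simp: smult_l_distr co)
    also have "\<dots> = x \<oplus>\<^bsub>M\<^esub> y"
      using x y e by (subst M.finsum_addf) (auto simp: co)
    finally show "finsum M (\<lambda>i. (co x i \<oplus> co y i) \<odot>\<^bsub>M\<^esub> e i) {..<k} = x \<oplus>\<^bsub>M\<^esub> y" .
  qed (use x y i in \<open>auto simp: co\<close>)
  then show ?thesis using frobenius_power_add[OF p, of "co x i" "co y i" n] x y i by (simp add: co)
qed

private lemma co_smult_mod:
  assumes x: "x \<in> carrier M" and r: "r \<in> carrier R" and i: "i < k"
  shows "co (r \<odot>\<^bsub>M\<^esub> x) i [^] q \<ominus> r [^] q \<otimes> co x i [^] q \<in> I"
proof -
  have "co (r \<odot>\<^bsub>M\<^esub> x) i [^] q \<ominus> (r \<otimes> co x i) [^] q \<in> I"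
  proof (rule co_mod[of _ "\<lambda>i. r \<otimes> co x i"])
    have "finsum M (\<lambda>i. (r \<otimes> co x i) \<odot>\<^bsub>M\<^esub> e i) {..<k} = finsum M (\<lambda>i. r \<odot>\<^bsub>M\<^esub> (co x i \<odot>\<^bsub>M\<^esub> e i)) {..<k}"
      using x r e by (intro M.finsum_cong') (auto simp: smult_assoc1 co)
    also have "\<dots> = r \<odot>\<^bsub>M\<^esub> finsum M (\<lambda>i. co x i \<odot>\<^bsub>M\<^esub> e i) {..<k}"
      using x r e by (subst finsum_smult_ldistr) (auto simp: co)
    finally show "finsum M (\<lambda>i. (r \<otimes> co x i) \<odot>\<^bsub>M\<^esub> e i) {..<k} = r \<odot>\<^bsub>M\<^esub> x" using x by (simp add: co)
  qed (use x r i in \<open>auto simp: co\<close>)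
  then show ?thesis using x r i by (simp add: co R.nat_pow_distrib)
qed

text \<open>The chosen coordinates of e_j may differ from the unit vector, but only by a
  relation.\<close>

private lemma co_generator_mod:
  assumes j: "j < k" and i: "i < k"
  shows "co (e j) i [^] q \<ominus> (if i = j then \<one> else \<zero>) \<in> I"
proof -
  have q0: "q \<noteq> 0" using prime_gt_0_nat[OF p(1)] by simp
  have "co (e j) i [^] q \<ominus> (if i = j then \<one> else \<zero>) [^] q \<in> I"
  proof (rule co_mod[of _ "\<lambda>i. if i = j then \<one> else \<zero>"])
    show "finsum M (\<lambda>i. (if i = j then \<one> else \<zero>) \<odot>\<^bsub>M\<^esub> e i) {..<k} = e j"
      using finsum_smult_delta[of "{..<k}" j \<one> e] j e by simp
  qed (use j i e in auto)
  then show ?thesis using q0 by (auto simp: R.nat_pow_zero split: if_splits)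
qed

text \<open>Modulo I, x \<otimes> s \<mapsto> s x_j^q is the j-th coordinate function on F^n(M),
  where x_j is the chosen j-th coordinate of x.\<close>

private definition "w j = (\<lambda>(x, s). s \<otimes> co x j [^] q)"

private lemma w_closed: "j < k \<Longrightarrow> f \<in> formal_sums R M \<Longrightarrow> f z \<noteq> 0 \<Longrightarrow> w j z \<in> carrier R"
  by (auto simp: formal_sums_def w_def co split: prod.split)

private lemma ev_add: "j < k \<Longrightarrow> f \<in> formal_sums R M \<Longrightarrow> g \<in> formal_sums R M \<Longrightarrow>
   formal_eval R (w j) (f + g) = formal_eval R (w j) f \<oplus> formal_eval R (w j) g"
  by (intro formal_eval_add formal_sums_finite[OF module] w_closed)

private lemma ev_diff: "j < k \<Longrightarrow> f \<in> formal_sums R M \<Longrightarrow> g \<in> formal_sums R M \<Longrightarrow>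
   formal_eval R (w j) (f - g) = formal_eval R (w j) f \<ominus> formal_eval R (w j) g"
  by (intro formal_eval_diff formal_sums_finite[OF module] w_closed)

private lemma ev_uminus: "j < k \<Longrightarrow> f \<in> formal_sums R M \<Longrightarrow>
   formal_eval R (w j) (- f) = \<ominus> formal_eval R (w j) f"
  by (intro formal_eval_uminus formal_sums_finite[OF module] w_closed)

private lemma ev_fdelta: "j < k \<Longrightarrow> x \<in> carrier M \<Longrightarrow> s \<in> carrier R \<Longrightarrow>
   formal_eval R (w j) (fdelta (x, s)) = s \<otimes> co x j [^] q"
  by (subst formal_eval_fdelta) (auto simp: w_def co)

text \<open>So the map descends to F^n(M) -> R/I. Additivity in the left factor and balancedness
  hold only modulo I, by \<open>co_add_mod\<close> and \<open>co_smult_mod\<close>; additivity in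
  the right factor is exact.\<close>

private lemma ev_rels:
  assumes "f \<in> tensor_rels R M q" and j: "j < k"
  shows "formal_eval R (w j) f \<in> I"
proof -
  interpret I: ideal I R by (rule I)
  show ?thesis using assms(1)
  proof (induction rule: tensor_rels_induct)
    case zero
    show "formal_eval R (w j) 0 \<in> I" by (simp add: formal_eval_zero)
  next
    case (add_left x y s)
    let ?d = "co (x \<oplus>\<^bsub>M\<^esub> y) j [^] q \<ominus> (co x j [^] q \<oplus> co y j [^] q)"
    have c: "co (x \<oplus>\<^bsub>M\<^esub> y) j \<in> carrier R" "co x j \<in> carrier R" "co y j \<in> carrier R"
      using add_left j by (simp_all add: co)
    have F: "fdelta (x \<oplus>\<^bsub>M\<^esub> y, s) \<in> formal_sums R M" "fdelta (x, s) \<in> formal_sums R M"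
      "fdelta (y, s) \<in> formal_sums R M" using add_left by (auto intro: formal_sums_fdelta)
    have "formal_eval R (w j) (fdelta (x \<oplus>\<^bsub>M\<^esub> y, s) - fdelta (x, s) - fdelta (y, s)) =
       s \<otimes> co (x \<oplus>\<^bsub>M\<^esub> y) j [^] q \<ominus> s \<otimes> co x j [^] q \<ominus> s \<otimes> co y j [^] q"
      using add_left j F by (simp add: ev_diff formal_sums_diff ev_fdelta)
    also have "\<dots> = s \<otimes> ?d"
      using c add_left by (simp add: R.minus_eq R.r_distr R.r_minus R.minus_add R.a_ac)
    also have "\<dots> \<in> I" using I.I_l_closed co_add_mod add_left j by simp
    finally show "formal_eval R (w j) (fdelta (x \<oplus>\<^bsub>M\<^esub> y, s) - fdelta (x, s) - fdelta (y, s)) \<in> I" .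
  next
    case (add_right x s t)
    have c: "co x j \<in> carrier R" using add_right j by (simp_all add: co)
    have F: "fdelta (x, s \<oplus> t) \<in> formal_sums R M" "fdelta (x, s) \<in> formal_sums R M"
      "fdelta (x, t) \<in> formal_sums R M" using add_right by (auto intro: formal_sums_fdelta)
    have "formal_eval R (w j) (fdelta (x, s \<oplus> t) - fdelta (x, s) - fdelta (x, t)) =
       (s \<oplus> t) \<otimes> co x j [^] q \<ominus> s \<otimes> co x j [^] q \<ominus> t \<otimes> co x j [^] q"
      using add_right j F by (simp add: ev_diff formal_sums_diff ev_fdelta)
    also have "\<dots> = \<zero>"
      using c add_right add_diff_diff[of "s \<otimes> co x j [^] q" "t \<otimes> co x j [^] q"] by (simp add: R.l_distr)
    finally show "formal_eval R (w j) (fdelta (x, s \<oplus> t) - fdelta (x, s) - fdelta (x, t)) \<in> I" by simp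
  next
    case (balanced x r s)
    let ?d = "co (r \<odot>\<^bsub>M\<^esub> x) j [^] q \<ominus> r [^] q \<otimes> co x j [^] q"
    have c: "co (r \<odot>\<^bsub>M\<^esub> x) j \<in> carrier R" "co x j \<in> carrier R" using balanced j by (simp_all add: co)
    have F: "fdelta (r \<odot>\<^bsub>M\<^esub> x, s) \<in> formal_sums R M" "fdelta (x, r [^] q \<otimes> s) \<in> formal_sums R M"
      using balanced by (auto intro: formal_sums_fdelta)
    have "formal_eval R (w j) (fdelta (r \<odot>\<^bsub>M\<^esub> x, s) - fdelta (x, r [^] q \<otimes> s)) =
       s \<otimes> co (r \<odot>\<^bsub>M\<^esub> x) j [^] q \<ominus> (r [^] q \<otimes> s) \<otimes> co x j [^] q"
      using balanced j F by (simp add: ev_diff ev_fdelta)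
    also have "\<dots> = s \<otimes> ?d"
      using c balanced by (simp add: R.minus_eq R.r_distr R.r_minus R.m_ac)
    also have "\<dots> \<in> I" using I.I_l_closed co_smult_mod balanced j by simp
    finally show "formal_eval R (w j) (fdelta (r \<odot>\<^bsub>M\<^esub> x, s) - fdelta (x, r [^] q \<otimes> s)) \<in> I" .
  next
    case (plus f g)
    then show "formal_eval R (w j) (f + g) \<in> I"
      using j by (simp add: ev_add tensor_rels_formal_sums[OF module] I.a_closed)
  next
    case (uminus f)
    then show "formal_eval R (w j) (- f) \<in> I"
      using j by (simp add: ev_uminus tensor_rels_formal_sums[OF module] I.a_inv_closed)
  qed
qed

private definition "gen_sum c = (\<Sum>i<k. fdelta (e i, c i))"

private lemma gen_sum_formal_sums: "(\<And>i. i < k \<Longrightarrow> c i \<in> carrier R) \<Longrightarrow> gen_sum c \<in> formal_sums R M"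
  unfolding gen_sum_def using e by (intro formal_sums_sum) (auto intro: formal_sums_fdelta)

text \<open>Modulo I the functional recovers the coefficient of e_j \<otimes> 1. With
  \<open>ev_rels\<close> this forces the coefficients of every relation of F^n(M) into I.\<close>

private lemma ev_gen_sum:
  assumes c: "\<And>i. i < k \<Longrightarrow> c i \<in> carrier R" and j: "j < k"
  shows "formal_eval R (w j) (gen_sum c) \<ominus> c j \<in> I"
proof -
  interpret I: ideal I R by (rule I)
  have "formal_eval R (w j) (\<Sum>i\<in>A. fdelta (e i, c i)) = finsum R (\<lambda>i. c i \<otimes> co (e i) j [^] q) A"
    if "finite A" "A \<subseteq> {..<k}" for A
    using that
  proof (induction A rule: finite_induct)
    case empty
    show "formal_eval R (w j) (\<Sum>i\<in>{}. fdelta (e i, c i)) = finsum R (\<lambda>i. c i \<otimes> co (e i) j [^] q) {}"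
      by (simp only: sum.empty R.finsum_empty formal_eval_zero)
  next
    case (insert i A)
    have "(\<Sum>i\<in>A. fdelta (e i, c i)) \<in> formal_sums R M"
      using insert c e by (intro formal_sums_sum) (auto intro: formal_sums_fdelta)
    moreover have "fdelta (e i, c i) \<in> formal_sums R M" using insert c e by (auto intro: formal_sums_fdelta)
    moreover have "finsum R (\<lambda>i. c i \<otimes> co (e i) j [^] q) (insert i A) =
       c i \<otimes> co (e i) j [^] q \<oplus> finsum R (\<lambda>i. c i \<otimes> co (e i) j [^] q) A"
      using insert c e j by (intro R.finsum_insert) (auto simp: co)
    moreover have "formal_eval R (w j) (\<Sum>i\<in>A. fdelta (e i, c i)) = finsum R (\<lambda>i. c i \<otimes> co (e i) j [^] q) A"
      by (rule insert.IH) (use insert.prems in auto)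
    moreover have "e i \<in> carrier M" "c i \<in> carrier R" using insert.prems c e by auto
    ultimately show "formal_eval R (w j) (\<Sum>i\<in>insert i A. fdelta (e i, c i)) =
        finsum R (\<lambda>i. c i \<otimes> co (e i) j [^] q) (insert i A)"
      unfolding sum.insert[OF insert.hyps] using j by (simp only: ev_add ev_fdelta)
  qed
  then have "formal_eval R (w j) (gen_sum c) = finsum R (\<lambda>i. c i \<otimes> co (e i) j [^] q) {..<k}"
    unfolding gen_sum_def by simp
  \<comment> \<open>Splitting off the Kronecker delta leaves c_j and a sum whose terms lie in I by
    \<open>co_generator_mod\<close>.\<close>
  also have "\<dots> = finsum R (\<lambda>i. c i \<otimes> (co (e i) j [^] q \<ominus> (if j = i then \<one> else \<zero>)) \<oplus> (if j = i then c i else \<zero>)) {..<k}"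
    using c e j by (intro R.finsum_cong') (auto simp: co R.minus_eq R.r_distr R.a_assoc R.r_minus R.l_neg)
  also have "\<dots> = finsum R (\<lambda>i. c i \<otimes> (co (e i) j [^] q \<ominus> (if j = i then \<one> else \<zero>))) {..<k} \<oplus>
      finsum R (\<lambda>i. if j = i then c i else \<zero>) {..<k}"
    using c e j by (intro R.finsum_addf) (auto simp: co)
  also have "finsum R (\<lambda>i. if j = i then c i else \<zero>) {..<k} = c j"
    using c j by (intro R.add.finprod_singleton) auto
  finally have eq: "formal_eval R (w j) (gen_sum c) =
     finsum R (\<lambda>i. c i \<otimes> (co (e i) j [^] q \<ominus> (if j = i then \<one> else \<zero>))) {..<k} \<oplus> c j" .
  have "finsum R (\<lambda>i. c i \<otimes> (co (e i) j [^] q \<ominus> (if j = i then \<one> else \<zero>))) {..<k} \<in> I" (is "?z \<in> I")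
  proof (rule finsum_mem_ideal[OF _ I])
    fix i assume "i \<in> {..<k}"
    then show "c i \<otimes> (co (e i) j [^] q \<ominus> (if j = i then \<one> else \<zero>)) \<in> I"
      by (intro I.I_l_closed co_generator_mod j c) simp_all
  qed simp
  moreover from this have "?z \<in> carrier R" by (rule I.Icarr)
  ultimately show ?thesis unfolding eq using c[OF j] by (simp add: R.minus_eq R.a_assoc R.r_neg)
qed

private lemma gen_sum_add:
  assumes c: "\<And>i. i < k \<Longrightarrow> c i \<in> carrier R" and d: "\<And>i. i < k \<Longrightarrow> d i \<in> carrier R"
  shows "gen_sum (\<lambda>i. c i \<oplus> d i) - gen_sum c - gen_sum d \<in> tensor_rels R M q"
proof -
  have "(\<Sum>i<k. fdelta (e i, c i \<oplus> d i) - fdelta (e i, c i) - fdelta (e i, d i)) \<in> tensor_rels R M q"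
    by (intro tensor_rels_sum tensor_rels_add_right) (use c d e in auto)
  then show ?thesis by (simp only: gen_sum_def sum_subtractf)
qed

private lemma gen_sum_cong: "(\<And>i. i < k \<Longrightarrow> c i = d i) \<Longrightarrow> gen_sum c = gen_sum d"
  unfolding gen_sum_def by (intro sum.cong) auto

private lemma gen_sum_zero: "gen_sum (\<lambda>i. \<zero>) \<in> tensor_rels R M q"
  unfolding gen_sum_def by (intro tensor_rels_sum fdelta_zero_right module e) auto

private lemma gen_sum_surj:
  assumes "f \<in> formal_sums R M"
  shows "\<exists>c. (\<forall>i<k. c i \<in> carrier R) \<and> f - gen_sum c \<in> tensor_rels R M q"
  using assms
proof (induction rule: formal_sums_induct)
  case (fdelta x s)
  obtain a where a: "\<forall>i<k. a i \<in> carrier R" "x = finsum M (\<lambda>i. a i \<odot>\<^bsub>M\<^esub> e i) {..<k}"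
    using gen[OF fdelta(1)] by (elim exE conjE)
  have "fdelta (x, s) - gen_sum (\<lambda>i. a i [^] q \<otimes> s) \<in> tensor_rels R M q"
    unfolding a(2) gen_sum_def by (rule fdelta_finsum[OF module]) (use a e fdelta in auto)
  then show "\<exists>c. (\<forall>i<k. c i \<in> carrier R) \<and> fdelta (x, s) - gen_sum c \<in> tensor_rels R M q"
    using a fdelta by (intro exI[of _ "\<lambda>i. a i [^] q \<otimes> s"]) auto
next
  case (add f g)
  then obtain c d where c: "\<forall>i<k. c i \<in> carrier R" "f - gen_sum c \<in> tensor_rels R M q"
    "\<forall>i<k. d i \<in> carrier R" "g - gen_sum d \<in> tensor_rels R M q" by (elim exE conjE)
  have "f + g - gen_sum (\<lambda>i. c i \<oplus> d i) = (f - gen_sum c) + (g - gen_sum d) - (gen_sum (\<lambda>i. c i \<oplus> d i) - gen_sum c - gen_sum d)" by simp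
  also have "\<dots> \<in> tensor_rels R M q"
    by (intro tensor_rels_diff tensor_rels_plus c gen_sum_add) (use c in auto)
  finally have "f + g - gen_sum (\<lambda>i. c i \<oplus> d i) \<in> tensor_rels R M q" .
  then show "\<exists>c. (\<forall>i<k. c i \<in> carrier R) \<and> f + g - gen_sum c \<in> tensor_rels R M q"
    using c by (intro exI[of _ "\<lambda>i. c i \<oplus> d i"] conjI) auto
next
  case (uminus f)
  then obtain c where c: "\<forall>i<k. c i \<in> carrier R" "f - gen_sum c \<in> tensor_rels R M q" by (elim exE conjE)
  \<comment> \<open>\<open>gen_sum\<close> is additive only modulo relations, so its compatibility
    with negation is extracted from c + (-c) = 0.\<close>
  have "gen_sum (\<lambda>i. c i \<oplus> \<ominus> c i) = gen_sum (\<lambda>i. \<zero>)" by (rule gen_sum_cong) (use c in \<open>auto simp: R.r_neg\<close>)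
  moreover have "gen_sum (\<lambda>i. c i \<oplus> \<ominus> c i) - gen_sum c - gen_sum (\<lambda>i. \<ominus> c i) \<in> tensor_rels R M q"
    by (rule gen_sum_add) (use c in auto)
  ultimately have "gen_sum (\<lambda>i. \<zero>) - gen_sum c - gen_sum (\<lambda>i. \<ominus> c i) \<in> tensor_rels R M q" by (simp only:)
  then have "(gen_sum (\<lambda>i. \<zero>) - gen_sum c - gen_sum (\<lambda>i. \<ominus> c i)) - gen_sum (\<lambda>i. \<zero>) - (f - gen_sum c) \<in> tensor_rels R M q"
    using tensor_rels_diff[OF tensor_rels_diff[OF _ gen_sum_zero] c(2)] by blast
  also have "(gen_sum (\<lambda>i. \<zero>) - gen_sum c - gen_sum (\<lambda>i. \<ominus> c i)) - gen_sum (\<lambda>i. \<zero>) - (f - gen_sum c) = - f - gen_sum (\<lambda>i. \<ominus> c i)" by simp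
  finally have "- f - gen_sum (\<lambda>i. \<ominus> c i) \<in> tensor_rels R M q" .
  then show "\<exists>c. (\<forall>i<k. c i \<in> carrier R) \<and> - f - gen_sum c \<in> tensor_rels R M q"
    using c by (intro exI[of _ "\<lambda>i. \<ominus> c i"] conjI) auto
next
  case zero
  show "\<exists>c. (\<forall>i<k. c i \<in> carrier R) \<and> 0 - gen_sum c \<in> tensor_rels R M q"
    using tensor_rels_diff[OF tensor_rels_zero gen_sum_zero] by (intro exI[of _ "\<lambda>i. \<zero>"] conjI) auto
qed

private lemma tensor_push_gen_sum:
  assumes c: "\<And>i. i < k \<Longrightarrow> c i \<in> carrier R" and r: "r \<in> carrier R"
  shows "tensor_push R r (gen_sum c) = gen_sum (\<lambda>i. r \<otimes> c i)"
proof -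
  have "tensor_push R r (\<Sum>i\<in>A. fdelta (e i, c i)) = (\<Sum>i\<in>A. fdelta (e i, r \<otimes> c i))"
    if "finite A" "A \<subseteq> {..<k}" for A
    using that
  proof (induction A rule: finite_induct)
    case empty
    show "tensor_push R r (\<Sum>i\<in>{}. fdelta (e i, c i)) = (\<Sum>i\<in>{}. fdelta (e i, r \<otimes> c i))"
      by (simp only: sum.empty tensor_push_zero)
  next
    case (insert i A)
    have F: "(\<Sum>i\<in>A. fdelta (e i, c i)) \<in> formal_sums R M"
      using insert c e by (intro formal_sums_sum) (auto intro: formal_sums_fdelta)
    have F': "fdelta (e i, c i) \<in> formal_sums R M" using insert c e by (auto intro: formal_sums_fdelta)
    have "tensor_push R r (fdelta (e i, c i) + (\<Sum>i\<in>A. fdelta (e i, c i))) =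
      tensor_push R r (fdelta (e i, c i)) + tensor_push R r (\<Sum>i\<in>A. fdelta (e i, c i))"
      by (intro tensor_push_add formal_sums_finite[OF module] F F')
    moreover have "tensor_push R r (\<Sum>i\<in>A. fdelta (e i, c i)) = (\<Sum>i\<in>A. fdelta (e i, r \<otimes> c i))"
      by (rule insert.IH) (use insert.prems in auto)
    ultimately show "tensor_push R r (\<Sum>i\<in>insert i A. fdelta (e i, c i)) = (\<Sum>i\<in>insert i A. fdelta (e i, r \<otimes> c i))"
      unfolding sum.insert[OF insert.hyps] by (simp only: tensor_push_fdelta)
  qed
  then show ?thesis unfolding gen_sum_def by simp
qed

text \<open>The map c \<mapsto> sum of the e_i \<otimes> c_i presents F^n(M), and the vector (a_i^q)
  lies in its kernel because it represents (sum of the a_i e_i) \<otimes> 1 = 0.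
  \<open>presentation_kernel_zero\<close> makes the kernel trivial.\<close>

lemma frobenius_relation_power_zero:
  assumes loc: "local_ring R m" and noeth: "noetherian_ring R" 
    and xs: "set xs \<subseteq> m" and Ixs: "I = Idl (set xs)"
    and ys: "regular_seq R (frobenius_functor R p n M) m ys" "length ys = length xs"
    and a: "\<And>i. i < k \<Longrightarrow> a i \<in> carrier R" "finsum M (\<lambda>i. a i \<odot>\<^bsub>M\<^esub> e i) {..<k} = \<zero>\<^bsub>M\<^esub>" "i < k"
  shows "a i [^] (p ^ n) = \<zero>"
proof -
  let ?F = "frobenius_functor R p n M" and ?G = "free_rank_module R k"
  note FS = frobenius_functor_simps[OF module, where p = p and n = n, OF refl]
  interpret G: module R ?G by (rule R.free_rank_module)
  define \<phi> where "\<phi> c = tensor_class R M q (gen_sum c)" for c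
  have Gc: "c i \<in> carrier R" if "c \<in> carrier ?G" "i < k" for c i
    using that by (auto simp: free_rank_module_simps PiE_iff)
  have SG: "gen_sum c \<in> formal_sums R M" if "c \<in> carrier ?G" for c using Gc[OF that] by (rule gen_sum_formal_sums)
  have \<phi>: "\<phi> ` carrier ?G = carrier ?F"
  proof
    show "\<phi> ` carrier ?G \<subseteq> carrier ?F" using SG by (auto simp: FS(1) \<phi>_def)
    show "carrier ?F \<subseteq> \<phi> ` carrier ?G"
    proof
      fix x assume "x \<in> carrier ?F"
      then obtain f where f: "f \<in> formal_sums R M" "x = tensor_class R M q f" by (auto simp: FS(1))
      obtain c where c: "\<forall>i<k. c i \<in> carrier R" "f - gen_sum c \<in> tensor_rels R M q"
        using gen_sum_surj[OF f(1)] by (elim exE conjE)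
      let ?c = "restrict c {..<k}"
      have cG: "?c \<in> carrier ?G" using c(1) by (auto simp: free_rank_module_simps)
      have "gen_sum ?c = gen_sum c" by (rule gen_sum_cong) simp
      then have "x = \<phi> ?c" unfolding f(2) \<phi>_def
        using tensor_class_eq_iff[OF module f(1) SG[OF cG], of q] c(2) by simp
      then show "x \<in> \<phi> ` carrier ?G" using cG by (rule image_eqI)
    qed
  qed
  have \<phi>add: "\<phi> (u \<oplus>\<^bsub>?G\<^esub> v) = \<phi> u \<oplus>\<^bsub>?F\<^esub> \<phi> v" if u: "u \<in> carrier ?G" and v: "v \<in> carrier ?G" for u v
  proof -
    have uv: "u \<oplus>\<^bsub>?G\<^esub> v \<in> carrier ?G" using u v by simp
    have "gen_sum (u \<oplus>\<^bsub>?G\<^esub> v) = gen_sum (\<lambda>i. u i \<oplus> v i)" by (rule gen_sum_cong) (simp add: free_rank_module_simps)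
    then have "gen_sum (u \<oplus>\<^bsub>?G\<^esub> v) - (gen_sum u + gen_sum v) \<in> tensor_rels R M q"
      using gen_sum_add[of u v] Gc[OF u] Gc[OF v] by (simp only: diff_diff_eq)
    then show ?thesis
      using tensor_class_eq_iff[OF module SG[OF uv] formal_sums_add[OF SG[OF u] SG[OF v]], of q]
      unfolding \<phi>_def FS(3)[OF SG[OF u] SG[OF v]] by blast
  qed
  have \<phi>smult: "\<phi> (r \<odot>\<^bsub>?G\<^esub> v) = r \<odot>\<^bsub>?F\<^esub> \<phi> v" if r: "r \<in> carrier R" and v: "v \<in> carrier ?G" for r v
  proof -
    have "gen_sum (r \<odot>\<^bsub>?G\<^esub> v) = gen_sum (\<lambda>i. r \<otimes> v i)" by (rule gen_sum_cong) (simp add: free_rank_module_simps)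
    moreover have "tensor_push R r (gen_sum v) = gen_sum (\<lambda>i. r \<otimes> v i)" by (rule tensor_push_gen_sum[OF Gc[OF v] r])
    ultimately show ?thesis unfolding \<phi>_def FS(4)[OF r SG[OF v]] by (simp only:)
  qed
  have \<phi>_zero_iff: "\<phi> c = \<zero>\<^bsub>?F\<^esub> \<longleftrightarrow> gen_sum c \<in> tensor_rels R M q" if "c \<in> carrier ?G" for c
    using tensor_class_eq_iff[OF module SG[OF that] formal_sums_zero, of q] unfolding \<phi>_def FS(2) by simp
  have "gen_sum \<zero>\<^bsub>?G\<^esub> = gen_sum (\<lambda>i. \<zero>)" by (rule gen_sum_cong) (simp add: free_rank_module_simps)
  then have \<phi>0: "\<phi> \<zero>\<^bsub>?G\<^esub> = \<zero>\<^bsub>?F\<^esub>" using \<phi>_zero_iff[OF G.M.zero_closed] gen_sum_zero by simp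
  have F: "module R ?F" by (rule module_surjective_image[where \<phi> = \<phi>, OF G.module_axioms \<phi> \<phi>0]) (fact \<phi>add, fact \<phi>smult)
  let ?c = "restrict (\<lambda>i. a i [^] q) {..<k}"
  have cG: "?c \<in> carrier ?G" using a(1) by (auto simp: free_rank_module_simps)
  have "?c = \<zero>\<^bsub>?G\<^esub>"
  proof (rule R.presentation_kernel_zero[where \<phi> = \<phi>, OF loc noeth xs _ F \<phi> _ _ ys _ cG])
    show "\<phi> (u \<oplus>\<^bsub>?G\<^esub> v) = \<phi> u \<oplus>\<^bsub>?F\<^esub> \<phi> v" if "u \<in> carrier ?G" "v \<in> carrier ?G" for u v
      using that by (rule \<phi>add)
    show "\<phi> (r \<odot>\<^bsub>?G\<^esub> v) = r \<odot>\<^bsub>?F\<^esub> \<phi> v" if "r \<in> carrier R" "v \<in> carrier ?G" for r v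
      using that by (rule \<phi>smult)
    show "\<exists>l::nat. b [^] l \<in> Idl (set xs)" if "b \<in> m" for b using pow[OF that] Ixs by auto
  next
    fix c j assume c: "c \<in> carrier ?G" "\<phi> c = \<zero>\<^bsub>?F\<^esub>" and j: "j < k"
    interpret I: ideal I R by (rule I)
    \<comment> \<open>For c in the kernel, \<open>gen_sum c\<close> is a relation, so the j-th
      functional sends it into I; its value is also c_j modulo I.\<close>
    have "formal_eval R (w j) (gen_sum c) \<in> I" using ev_rels[OF _ j] \<phi>_zero_iff[OF c(1)] c(2) by simp
    moreover have "formal_eval R (w j) (gen_sum c) \<ominus> c j \<in> I" by (rule ev_gen_sum[OF Gc[OF c(1)] j])
    ultimately have "formal_eval R (w j) (gen_sum c) \<oplus> \<ominus> (formal_eval R (w j) (gen_sum c) \<ominus> c j) \<in> I"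
      by (intro I.a_closed I.a_inv_closed)
    moreover have "formal_eval R (w j) (gen_sum c) \<in> carrier R"
      using \<open>formal_eval R (w j) (gen_sum c) \<in> I\<close> by (rule I.Icarr)
    then have "formal_eval R (w j) (gen_sum c) \<oplus> \<ominus> (formal_eval R (w j) (gen_sum c) \<ominus> c j) = c j"
      using Gc[OF c(1) j] by (simp add: R.minus_eq R.minus_add R.a_assoc[symmetric] R.r_neg)
    ultimately show "c j \<in> Idl (set xs)" unfolding Ixs[symmetric] by (simp only:)
  next
    have "fdelta (finsum M (\<lambda>i. a i \<odot>\<^bsub>M\<^esub> e i) {..<k}, \<one>) - (\<Sum>i<k. fdelta (e i, a i [^] q \<otimes> \<one>)) \<in> tensor_rels R M q"
      by (rule fdelta_finsum[OF module]) (use a e in auto)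
    moreover have "(\<Sum>i<k. fdelta (e i, a i [^] q \<otimes> \<one>)) = gen_sum ?c"
      unfolding gen_sum_def using a(1) by (intro sum.cong) auto
    ultimately have "fdelta (\<zero>\<^bsub>M\<^esub>, \<one>) - gen_sum ?c \<in> tensor_rels R M q" using a(2) by simp
    from tensor_rels_diff[OF fdelta_zero_left[OF module R.one_closed] this]
    have "gen_sum ?c \<in> tensor_rels R M q" by simp
    then show "\<phi> ?c = \<zero>\<^bsub>?F\<^esub>" unfolding \<phi>_zero_iff[OF cG] by simp
  qed
  then have "?c i = \<zero>\<^bsub>?G\<^esub> i" by simp
  then show ?thesis using a(3) by (simp add: free_rank_module_simps)
qed

end

section \<open>Localisation at the nonzerodivisors\<close>

context cring
begin

lemma nonzerodivisors_closed: "s \<in> nonzerodivisors R \<Longrightarrow> s \<in> carrier R"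
  by (simp add: nonzerodivisors_def)

lemma nonzerodivisorsD: "s \<in> nonzerodivisors R \<Longrightarrow> a \<in> carrier R \<Longrightarrow> s \<otimes> a = \<zero> \<Longrightarrow> a = \<zero>"
  by (simp add: nonzerodivisors_def)

lemma one_nonzerodivisor: "\<one> \<in> nonzerodivisors R"
  by (simp add: nonzerodivisors_def)

lemma nonzerodivisors_mult:
  assumes s: "s \<in> nonzerodivisors R" and t: "t \<in> nonzerodivisors R"
  shows "s \<otimes> t \<in> nonzerodivisors R"
proof -
  have c: "s \<in> carrier R" "t \<in> carrier R" using s t by (auto simp: nonzerodivisors_closed)
  have "a = \<zero>" if a: "a \<in> carrier R" "(s \<otimes> t) \<otimes> a = \<zero>" for a
  proof -
    have "s \<otimes> (t \<otimes> a) = \<zero>" using a c by (simp add: m_assoc)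
    then have "t \<otimes> a = \<zero>" using nonzerodivisorsD[OF s] a c by simp
    then show ?thesis using nonzerodivisorsD[OF t] a by simp
  qed
  then show ?thesis using c by (simp add: nonzerodivisors_def)
qed

lemma nonzerodivisors_pow:
  assumes s: "s \<in> nonzerodivisors R"
  shows "s [^] (n::nat) \<in> nonzerodivisors R"
  by (induction n) (auto simp: one_nonzerodivisor nonzerodivisors_mult s)

end

context
  fixes R :: "('a, 'b) ring_scheme" (structure) and M :: "('a, 'c) module"
  assumes module: "module R M"
begin

interpretation module R M by (rule module)

private lemmas Sc = R.nonzerodivisors_closed

lemma diff_eq_zero_iff:
  assumes "a \<in> carrier M" "b \<in> carrier M"
  shows "a \<ominus>\<^bsub>M\<^esub> b = \<zero>\<^bsub>M\<^esub> \<longleftrightarrow> a = b"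
proof
  assume "a \<ominus>\<^bsub>M\<^esub> b = \<zero>\<^bsub>M\<^esub>"
  then have "(a \<ominus>\<^bsub>M\<^esub> b) \<oplus>\<^bsub>M\<^esub> b = b" using assms by simp
  then show "a = b" using assms by (simp add: M.minus_eq M.a_assoc M.l_neg)
qed (use assms in \<open>simp add: M.minus_eq M.r_neg\<close>)

text \<open>In this cross-multiplied form both sides are iterated scalar multiples, which
  associativity and commutativity of the scalars bring to a common shape.\<close>

lemma frac_rel_iff:
  "((x, s), (y, t)) \<in> frac_rel R M \<longleftrightarrow> x \<in> carrier M \<and> y \<in> carrier M \<and> s \<in> nonzerodivisors R \<and>
     t \<in> nonzerodivisors R \<and> (\<exists>u\<in>nonzerodivisors R. u \<odot>\<^bsub>M\<^esub> (t \<odot>\<^bsub>M\<^esub> x) = u \<odot>\<^bsub>M\<^esub> (s \<odot>\<^bsub>M\<^esub> y))"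
proof -
  have "u \<odot>\<^bsub>M\<^esub> (t \<odot>\<^bsub>M\<^esub> x \<ominus>\<^bsub>M\<^esub> s \<odot>\<^bsub>M\<^esub> y) = \<zero>\<^bsub>M\<^esub> \<longleftrightarrow> u \<odot>\<^bsub>M\<^esub> (t \<odot>\<^bsub>M\<^esub> x) = u \<odot>\<^bsub>M\<^esub> (s \<odot>\<^bsub>M\<^esub> y)"
    if "x \<in> carrier M" "y \<in> carrier M" "s \<in> nonzerodivisors R" "t \<in> nonzerodivisors R" "u \<in> nonzerodivisors R" for u
    using that Sc diff_eq_zero_iff by (simp add: smult_r_diff)
  then show ?thesis unfolding frac_rel_def by auto
qed

lemma frac_rel_equiv: "equiv (carrier M \<times> nonzerodivisors R) (frac_rel R M)"
proof (rule equivI)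
  show "frac_rel R M \<subseteq> (carrier M \<times> nonzerodivisors R) \<times> (carrier M \<times> nonzerodivisors R)"
    by (auto simp: frac_rel_iff)
  show "refl_on (carrier M \<times> nonzerodivisors R) (frac_rel R M)"
    using R.one_nonzerodivisor by (auto simp: refl_on_def frac_rel_iff)
  show "sym (frac_rel R M)"
    by (rule symI) (auto simp: frac_rel_iff, metis)
  show "trans (frac_rel R M)"
  proof (rule transI)
    fix a b c assume "(a, b) \<in> frac_rel R M" "(b, c) \<in> frac_rel R M"
    moreover obtain x s y t z w where e: "a = (x, s)" "b = (y, t)" "c = (z, w)" by (metis surj_pair)
    ultimately obtain u v where h: "x \<in> carrier M" "y \<in> carrier M" "z \<in> carrier M"
      "s \<in> nonzerodivisors R" "t \<in> nonzerodivisors R" "w \<in> nonzerodivisors R" "u \<in> nonzerodivisors R" "v \<in> nonzerodivisors R"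
      "u \<odot>\<^bsub>M\<^esub> (t \<odot>\<^bsub>M\<^esub> x) = u \<odot>\<^bsub>M\<^esub> (s \<odot>\<^bsub>M\<^esub> y)" "v \<odot>\<^bsub>M\<^esub> (w \<odot>\<^bsub>M\<^esub> y) = v \<odot>\<^bsub>M\<^esub> (t \<odot>\<^bsub>M\<^esub> z)"
      by (auto simp: frac_rel_iff)
    note c = Sc[OF h(4)] Sc[OF h(5)] Sc[OF h(6)] Sc[OF h(7)] Sc[OF h(8)]
    \<comment> \<open>The multiplier is t u v: u and v witness the two given equivalences, and the
      middle denominator t is needed to eliminate y.\<close>
    have "(t \<otimes> u \<otimes> v) \<odot>\<^bsub>M\<^esub> (w \<odot>\<^bsub>M\<^esub> x) = (v \<otimes> w) \<odot>\<^bsub>M\<^esub> (u \<odot>\<^bsub>M\<^esub> (t \<odot>\<^bsub>M\<^esub> x))"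
      using h(1) c by (simp add: smult_assoc1[symmetric] R.m_ac)
    also have "\<dots> = (u \<otimes> s) \<odot>\<^bsub>M\<^esub> (v \<odot>\<^bsub>M\<^esub> (w \<odot>\<^bsub>M\<^esub> y))"
      unfolding h(9) using h(2) c by (simp add: smult_assoc1[symmetric] R.m_ac)
    also have "\<dots> = (t \<otimes> u \<otimes> v) \<odot>\<^bsub>M\<^esub> (s \<odot>\<^bsub>M\<^esub> z)"
      unfolding h(10) using h(3) c by (simp add: smult_assoc1[symmetric] R.m_ac)
    finally show "(a, c) \<in> frac_rel R M"
      unfolding e frac_rel_iff using h(1-8) R.nonzerodivisors_mult by blast
  qed
qed

lemma frac_class_eq_iff:
  assumes "x \<in> carrier M" "y \<in> carrier M" "s \<in> nonzerodivisors R" "t \<in> nonzerodivisors R"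
  shows "frac_class R M x s = frac_class R M y t \<longleftrightarrow>
    (\<exists>u\<in>nonzerodivisors R. u \<odot>\<^bsub>M\<^esub> (t \<odot>\<^bsub>M\<^esub> x) = u \<odot>\<^bsub>M\<^esub> (s \<odot>\<^bsub>M\<^esub> y))"
  using eq_equiv_class_iff[OF frac_rel_equiv, of "(x, s)" "(y, t)"] assms
  by (simp add: frac_class_def frac_rel_iff)

text \<open>The operations on fractions use \<open>rep_of\<close>, of which nothing is known except
  that it stays in the class. The following lemmas show that their results do not depend on
  it.\<close>

lemma rep_of_frac_class:
  assumes "x \<in> carrier M" "s \<in> nonzerodivisors R"
  obtains x' s' where "rep_of (frac_class R M x s) = (x', s')" "x' \<in> carrier M"
    "s' \<in> nonzerodivisors R" "frac_class R M x' s' = frac_class R M x s"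
proof -
  have "(x, s) \<in> frac_class R M x s"
    using assms R.one_nonzerodivisor by (auto simp: frac_class_def frac_rel_iff)
  then have "rep_of (frac_class R M x s) \<in> frac_class R M x s"
    unfolding rep_of_def by (rule someI[where P = "\<lambda>e. e \<in> frac_class R M x s"])
  then have *: "((x, s), rep_of (frac_class R M x s)) \<in> frac_rel R M" by (simp add: frac_class_def)
  obtain x' s' where e: "rep_of (frac_class R M x s) = (x', s')" by (metis surj_pair)
  have "frac_class R M x s = frac_class R M x' s'"
    using equiv_class_eq[OF frac_rel_equiv *[unfolded e]] by (simp only: frac_class_def)
  then show thesis using that e * by (simp add: frac_rel_iff)
qed

lemma frac_class_add:
  assumes x: "x \<in> carrier M" "s \<in> nonzerodivisors R" and y: "y \<in> carrier M" "t \<in> nonzerodivisors R"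
  shows "(case (rep_of (frac_class R M x s), rep_of (frac_class R M y t)) of ((x, s), (y, t)) \<Rightarrow>
      frac_class R M (t \<odot>\<^bsub>M\<^esub> x \<oplus>\<^bsub>M\<^esub> s \<odot>\<^bsub>M\<^esub> y) (s \<otimes> t)) = frac_class R M (t \<odot>\<^bsub>M\<^esub> x \<oplus>\<^bsub>M\<^esub> s \<odot>\<^bsub>M\<^esub> y) (s \<otimes> t)"
proof -
  obtain x' s' where x': "rep_of (frac_class R M x s) = (x', s')" "x' \<in> carrier M"
    "s' \<in> nonzerodivisors R" "frac_class R M x' s' = frac_class R M x s" by (rule rep_of_frac_class[OF x])
  obtain y' t' where y': "rep_of (frac_class R M y t) = (y', t')" "y' \<in> carrier M"
    "t' \<in> nonzerodivisors R" "frac_class R M y' t' = frac_class R M y t" by (rule rep_of_frac_class[OF y])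
  obtain u where u: "u \<in> nonzerodivisors R" "u \<odot>\<^bsub>M\<^esub> (s \<odot>\<^bsub>M\<^esub> x') = u \<odot>\<^bsub>M\<^esub> (s' \<odot>\<^bsub>M\<^esub> x)"
    using x' x by (auto simp: frac_class_eq_iff)
  obtain v where v: "v \<in> nonzerodivisors R" "v \<odot>\<^bsub>M\<^esub> (t \<odot>\<^bsub>M\<^esub> y') = v \<odot>\<^bsub>M\<^esub> (t' \<odot>\<^bsub>M\<^esub> y)"
    using y' y by (auto simp: frac_class_eq_iff)
  note c = Sc[OF x(2)] Sc[OF y(2)] Sc[OF x'(3)] Sc[OF y'(3)] Sc[OF u(1)] Sc[OF v(1)]
  \<comment> \<open>The product u v serves both summands at once: u identifies the two
    representatives of x/s, v those of y/t.\<close>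
  have "(u \<otimes> v) \<odot>\<^bsub>M\<^esub> ((s \<otimes> t) \<odot>\<^bsub>M\<^esub> (t' \<odot>\<^bsub>M\<^esub> x' \<oplus>\<^bsub>M\<^esub> s' \<odot>\<^bsub>M\<^esub> y')) =
     (v \<otimes> t \<otimes> t') \<odot>\<^bsub>M\<^esub> (u \<odot>\<^bsub>M\<^esub> (s \<odot>\<^bsub>M\<^esub> x')) \<oplus>\<^bsub>M\<^esub> (u \<otimes> s \<otimes> s') \<odot>\<^bsub>M\<^esub> (v \<odot>\<^bsub>M\<^esub> (t \<odot>\<^bsub>M\<^esub> y'))"
    using x'(2) y'(2) c by (simp add: smult_r_distr smult_assoc1[symmetric] R.m_ac)
  also have "\<dots> = (u \<otimes> v) \<odot>\<^bsub>M\<^esub> ((s' \<otimes> t') \<odot>\<^bsub>M\<^esub> (t \<odot>\<^bsub>M\<^esub> x \<oplus>\<^bsub>M\<^esub> s \<odot>\<^bsub>M\<^esub> y))"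
    unfolding u(2) v(2) using x(1) y(1) c by (simp add: smult_r_distr smult_assoc1[symmetric] R.m_ac)
  finally have "frac_class R M (t' \<odot>\<^bsub>M\<^esub> x' \<oplus>\<^bsub>M\<^esub> s' \<odot>\<^bsub>M\<^esub> y') (s' \<otimes> t') =
      frac_class R M (t \<odot>\<^bsub>M\<^esub> x \<oplus>\<^bsub>M\<^esub> s \<odot>\<^bsub>M\<^esub> y) (s \<otimes> t)"
    using x x' y y' u v c R.nonzerodivisors_mult by (subst frac_class_eq_iff) auto
  then show ?thesis unfolding x'(1) y'(1) by simp
qed

text \<open>The equivalence of the two scalars is assumed in terms of elements. So the lemma applies
  both to the product of \<open>total_frac_ring\<close>, with M = R, and to the scalar
  multiplication of \<open>loc_module\<close>.\<close>

lemma frac_class_smult: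
  assumes a: "a \<in> carrier R" "s \<in> nonzerodivisors R" and x: "x \<in> carrier M" "t \<in> nonzerodivisors R"
    and a': "a' \<in> carrier R" "s' \<in> nonzerodivisors R" "\<exists>u\<in>nonzerodivisors R. u \<otimes> (s \<otimes> a') = u \<otimes> (s' \<otimes> a)"
    and x': "x' \<in> carrier M" "t' \<in> nonzerodivisors R" "frac_class R M x' t' = frac_class R M x t"
  shows "frac_class R M (a' \<odot>\<^bsub>M\<^esub> x') (s' \<otimes> t') = frac_class R M (a \<odot>\<^bsub>M\<^esub> x) (s \<otimes> t)"
proof -
  obtain u where u: "u \<in> nonzerodivisors R" "u \<otimes> (s \<otimes> a') = u \<otimes> (s' \<otimes> a)" using a' by auto
  obtain v where v: "v \<in> nonzerodivisors R" "v \<odot>\<^bsub>M\<^esub> (t \<odot>\<^bsub>M\<^esub> x') = v \<odot>\<^bsub>M\<^esub> (t' \<odot>\<^bsub>M\<^esub> x)"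
    using x' x by (auto simp: frac_class_eq_iff)
  note c = Sc[OF a(2)] Sc[OF x(2)] Sc[OF a'(2)] Sc[OF x'(2)] Sc[OF u(1)] Sc[OF v(1)] a(1) a'(1)
  have "(u \<otimes> v) \<odot>\<^bsub>M\<^esub> ((s \<otimes> t) \<odot>\<^bsub>M\<^esub> (a' \<odot>\<^bsub>M\<^esub> x')) = (u \<otimes> (s \<otimes> a')) \<odot>\<^bsub>M\<^esub> (v \<odot>\<^bsub>M\<^esub> (t \<odot>\<^bsub>M\<^esub> x'))"
    using x'(1) c by (simp add: smult_assoc1[symmetric] R.m_ac)
  also have "\<dots> = (u \<otimes> v) \<odot>\<^bsub>M\<^esub> ((s' \<otimes> t') \<odot>\<^bsub>M\<^esub> (a \<odot>\<^bsub>M\<^esub> x))"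
    unfolding u(2) v(2) using x(1) c by (simp add: smult_assoc1[symmetric] R.m_ac)
  finally show ?thesis
    using x x' u v c a a' R.nonzerodivisors_mult by (subst frac_class_eq_iff) auto
qed

end

lemma frac_class_ring_eq_iff:
  fixes R (structure)
  assumes "cring R" "a \<in> carrier R" "b \<in> carrier R" "s \<in> nonzerodivisors R" "t \<in> nonzerodivisors R"
  shows "frac_class R (ring_as_module R) a s = frac_class R (ring_as_module R) b t \<longleftrightarrow>
    (\<exists>u\<in>nonzerodivisors R. u \<otimes> (t \<otimes> a) = u \<otimes> (s \<otimes> b))"
  using frac_class_eq_iff[OF cring.ring_module[OF assms(1)], of a b s t] assms
  by (simp add: cring.ring_as_module_simps)

text \<open>R embeds into its total ring of fractions because the denominators are
  nonzerodivisors.\<close>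

lemma frac_class_ring_one_eq_iff:
  fixes R (structure)
  assumes R: "cring R" and ab: "a \<in> carrier R" "b \<in> carrier R"
  shows "frac_class R (ring_as_module R) a \<one> = frac_class R (ring_as_module R) b \<one> \<longleftrightarrow> a = b"
proof -
  interpret cring R by (rule R)
  have "a = b" if u: "u \<in> nonzerodivisors R" "u \<otimes> (\<one> \<otimes> a) = u \<otimes> (\<one> \<otimes> b)" for u
  proof -
    have uc: "u \<in> carrier R" using u nonzerodivisors_closed by blast
    have "u \<otimes> (a \<ominus> b) = \<zero>"
      using u(2) uc ab by (simp add: minus_eq r_distr r_minus r_neg)
    then have "a \<ominus> b = \<zero>" using nonzerodivisorsD[OF u(1)] ab by simp
    then show ?thesis using ab by simp
  qed
  then show ?thesis
    unfolding frac_class_ring_eq_iff[OF R ab one_nonzerodivisor one_nonzerodivisor]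
    using one_nonzerodivisor by auto
qed

text \<open>Denominator 1 suffices here, since sums are taken only after clearing denominators. The
  product below allows general denominators because the clearing itself needs them.\<close>

lemma total_frac_ring_add:
  fixes R (structure)
  assumes R: "cring R" and a: "a \<in> carrier R" "b \<in> carrier R"
  shows "frac_class R (ring_as_module R) a \<one> \<oplus>\<^bsub>total_frac_ring R\<^esub> frac_class R (ring_as_module R) b \<one> =
    frac_class R (ring_as_module R) (a \<oplus> b) \<one>"
proof -
  interpret cring R by (rule R)
  show ?thesis
    using frac_class_add[OF ring_module, of a \<one> b \<one>] a one_nonzerodivisor
    by (simp add: total_frac_ring_def Let_def)
qed

lemma total_frac_ring_mult:
  fixes R (structure)
  assumes R: "cring R" and a: "a \<in> carrier R" "b \<in> carrier R" "s \<in> nonzerodivisors R" "t \<in> nonzerodivisors R"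
  shows "frac_class R (ring_as_module R) a s \<otimes>\<^bsub>total_frac_ring R\<^esub> frac_class R (ring_as_module R) b t =
    frac_class R (ring_as_module R) (a \<otimes> b) (s \<otimes> t)"
proof -
  interpret cring R by (rule R)
  let ?A = "ring_as_module R"
  obtain a' s' where a': "rep_of (frac_class R ?A a s) = (a', s')" "a' \<in> carrier ?A"
    "s' \<in> nonzerodivisors R" "frac_class R ?A a' s' = frac_class R ?A a s"
    by (rule rep_of_frac_class[OF ring_module, of a s]) (use a in auto)
  obtain b' t' where b': "rep_of (frac_class R ?A b t) = (b', t')" "b' \<in> carrier ?A"
    "t' \<in> nonzerodivisors R" "frac_class R ?A b' t' = frac_class R ?A b t"
    by (rule rep_of_frac_class[OF ring_module, of b t]) (use a in auto)
  have "frac_class R ?A (a' \<odot>\<^bsub>?A\<^esub> b') (s' \<otimes> t') = frac_class R ?A (a \<odot>\<^bsub>?A\<^esub> b) (s \<otimes> t)"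
    by (rule frac_class_smult[OF ring_module])
      (use a a' b' in \<open>auto simp: frac_class_ring_eq_iff[OF R]\<close>)
  then show ?thesis using a'(1) b'(1) by (simp add: total_frac_ring_def Let_def)
qed

lemma loc_module_add:
  fixes R (structure)
  assumes M: "module R M" and x: "x \<in> carrier M" "y \<in> carrier M"
  shows "frac_class R M x \<one> \<oplus>\<^bsub>loc_module R M\<^esub> frac_class R M y \<one> = frac_class R M (x \<oplus>\<^bsub>M\<^esub> y) \<one>"
proof -
  interpret module R M by (rule M)
  show ?thesis using frac_class_add[OF M, of x \<one> y \<one>] x R.one_nonzerodivisor
    by (simp add: loc_module_def)
qed

lemma loc_module_smult:
  fixes R (structure)
  assumes M: "module R M" and a: "a \<in> carrier R" "s \<in> nonzerodivisors R"
    and x: "x \<in> carrier M" "t \<in> nonzerodivisors R"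
  shows "frac_class R (ring_as_module R) a s \<odot>\<^bsub>loc_module R M\<^esub> frac_class R M x t =
    frac_class R M (a \<odot>\<^bsub>M\<^esub> x) (s \<otimes> t)"
proof -
  interpret module R M by (rule M)
  let ?A = "ring_as_module R"
  obtain a' s' where a': "rep_of (frac_class R ?A a s) = (a', s')" "a' \<in> carrier ?A"
    "s' \<in> nonzerodivisors R" "frac_class R ?A a' s' = frac_class R ?A a s"
    by (rule rep_of_frac_class[OF R.ring_module, of a s]) (use a in auto)
  obtain x' t' where x': "rep_of (frac_class R M x t) = (x', t')" "x' \<in> carrier M"
    "t' \<in> nonzerodivisors R" "frac_class R M x' t' = frac_class R M x t"
    by (rule rep_of_frac_class[OF M x])
  have "frac_class R M (a' \<odot>\<^bsub>M\<^esub> x') (s' \<otimes> t') = frac_class R M (a \<odot>\<^bsub>M\<^esub> x) (s \<otimes> t)"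
    by (rule frac_class_smult[OF M])
      (use a a' x x' in \<open>auto simp: frac_class_ring_eq_iff[OF R.is_cring]\<close>)
  then show ?thesis using a'(1) x'(1) by (simp add: loc_module_def)
qed

lemma loc_module_carrier:
  "carrier (loc_module R M) = {frac_class R M x s | x s. x \<in> carrier M \<and> s \<in> nonzerodivisors R}"
  by (auto simp: loc_module_def quotient_def frac_class_def)

lemma total_frac_ring_carrier:
  "carrier (total_frac_ring R) =
     {frac_class R (ring_as_module R) a s | a s. a \<in> carrier R \<and> s \<in> nonzerodivisors R}"
  by (auto simp: total_frac_ring_def quotient_def frac_class_def Let_def)

text \<open>\<open>v/1\<close> has the coordinates \<open>b\<^sub>i/1\<close> under the isomorphism \<open>\<phi>\<close> of the localisation with a free module.\<close>

definition rank_relation ::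
    "('a, 'b) ring_scheme \<Rightarrow> ('a, 'c) module \<Rightarrow> nat \<Rightarrow> (('c \<times> 'a) set \<Rightarrow> nat \<Rightarrow> ('a \<times> 'a) set) \<Rightarrow> 'c \<Rightarrow> (nat \<Rightarrow> 'a) \<Rightarrow> bool" where
  "rank_relation R M r \<phi> v b \<longleftrightarrow> v \<in> carrier M \<and> (\<forall>i<r. b i \<in> carrier R) \<and>
     \<phi> (frac_class R M v \<one>\<^bsub>R\<^esub>) = restrict (\<lambda>i. frac_class R (ring_as_module R) (b i) \<one>\<^bsub>R\<^esub>) {..<r}"

context
  fixes R :: "('a, 'b) ring_scheme" (structure) and M :: "('a, 'c) module" and r :: nat and \<phi>
  assumes module: "module R M"
    and iso: "module_iso (total_frac_ring R) (loc_module R M) (free_rank_module (total_frac_ring R) r) \<phi>"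
begin

interpretation module R M by (rule module)

private abbreviation "\<iota> a \<equiv> frac_class R (ring_as_module R) a \<one>"
private abbreviation "jM v \<equiv> frac_class R M v \<one>"
private abbreviation "rr \<equiv> rank_relation R M r \<phi>"

private lemma locI: "v \<in> carrier M \<Longrightarrow> s \<in> nonzerodivisors R \<Longrightarrow> frac_class R M v s \<in> carrier (loc_module R M)"
  by (auto simp: loc_module_carrier)

private lemma totI: "a \<in> carrier R \<Longrightarrow> s \<in> nonzerodivisors R \<Longrightarrow> frac_class R (ring_as_module R) a s \<in> carrier (total_frac_ring R)"
  by (auto simp: total_frac_ring_carrier)

private lemma \<phi>_add:
  "x \<in> carrier (loc_module R M) \<Longrightarrow> y \<in> carrier (loc_module R M) \<Longrightarrow>
   \<phi> (x \<oplus>\<^bsub>loc_module R M\<^esub> y) = restrict (\<lambda>i. \<phi> x i \<oplus>\<^bsub>total_frac_ring R\<^esub> \<phi> y i) {..<r}"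
  using iso by (simp add: module_iso_def free_rank_module_simps)

private lemma \<phi>_smult:
  "a \<in> carrier (total_frac_ring R) \<Longrightarrow> x \<in> carrier (loc_module R M) \<Longrightarrow>
   \<phi> (a \<odot>\<^bsub>loc_module R M\<^esub> x) = restrict (\<lambda>i. a \<otimes>\<^bsub>total_frac_ring R\<^esub> \<phi> x i) {..<r}"
  using iso by (simp add: module_iso_def free_rank_module_simps)

lemma rank_relation_cong:
  assumes "rr v b" "\<And>i. i < r \<Longrightarrow> b i = b' i" shows "rr v b'"
proof -
  have "restrict (\<lambda>i. \<iota> (b i)) {..<r} = restrict (\<lambda>i. \<iota> (b' i)) {..<r}"
    using assms(2) by (intro restrict_ext) simp
  then show ?thesis using assms by (simp add: rank_relation_def)
qed

lemma rank_relation_add: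
  assumes "rr v b" "rr v' b'" shows "rr (v \<oplus>\<^bsub>M\<^esub> v') (\<lambda>i. b i \<oplus> b' i)"
proof -
  have v: "v \<in> carrier M" "v' \<in> carrier M" and b: "\<forall>i<r. b i \<in> carrier R" "\<forall>i<r. b' i \<in> carrier R"
    and \<phi>: "\<phi> (jM v) = restrict (\<lambda>i. \<iota> (b i)) {..<r}" "\<phi> (jM v') = restrict (\<lambda>i. \<iota> (b' i)) {..<r}"
    using assms by (auto simp: rank_relation_def)
  have "\<phi> (jM (v \<oplus>\<^bsub>M\<^esub> v')) = restrict (\<lambda>i. \<phi> (jM v) i \<oplus>\<^bsub>total_frac_ring R\<^esub> \<phi> (jM v') i) {..<r}"
    unfolding loc_module_add[OF module v, symmetric]
    by (rule \<phi>_add) (rule locI, rule v, rule R.one_nonzerodivisor)+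
  also have "\<dots> = restrict (\<lambda>i. \<iota> (b i \<oplus> b' i)) {..<r}"
    unfolding \<phi> using b by (intro restrict_ext) (simp add: total_frac_ring_add[OF R.is_cring])
  finally show ?thesis using v b by (simp add: rank_relation_def)
qed

lemma rank_relation_smult:
  assumes a: "a \<in> carrier R" and "rr v b" shows "rr (a \<odot>\<^bsub>M\<^esub> v) (\<lambda>i. a \<otimes> b i)"
proof -
  have v: "v \<in> carrier M" and b: "\<forall>i<r. b i \<in> carrier R"
    and \<phi>: "\<phi> (jM v) = restrict (\<lambda>i. \<iota> (b i)) {..<r}"
    using assms by (auto simp: rank_relation_def)
  note one = R.one_nonzerodivisor
  have "\<iota> a \<odot>\<^bsub>loc_module R M\<^esub> jM v = jM (a \<odot>\<^bsub>M\<^esub> v)"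
    using loc_module_smult[OF module a one v one] by simp
  then have "\<phi> (jM (a \<odot>\<^bsub>M\<^esub> v)) = restrict (\<lambda>i. \<iota> a \<otimes>\<^bsub>total_frac_ring R\<^esub> \<phi> (jM v) i) {..<r}"
    using \<phi>_smult[OF totI[OF a one] locI[OF v one]] by simp
  also have "\<dots> = restrict (\<lambda>i. \<iota> (a \<otimes> b i)) {..<r}"
    unfolding \<phi> using b a total_frac_ring_mult[OF R.is_cring a _ one one]
    by (intro restrict_ext) simp
  finally show ?thesis using v b a by (simp add: rank_relation_def)
qed

lemma rank_relation_zero_left:
  assumes "rr \<zero>\<^bsub>M\<^esub> b" "i < r" shows "b i = \<zero>"
proof -
  \<comment> \<open>Homogeneity with the scalar 0 determines the coordinates of 0/1. They are
    compared with b through the embedding of R into its fractions.\<close>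
  have "rr (\<zero> \<odot>\<^bsub>M\<^esub> \<zero>\<^bsub>M\<^esub>) (\<lambda>i. \<zero> \<otimes> b i)" by (rule rank_relation_smult[OF R.zero_closed assms(1)])
  then have "\<phi> (jM \<zero>\<^bsub>M\<^esub>) = restrict (\<lambda>i. \<iota> (\<zero> \<otimes> b i)) {..<r}"
    by (simp add: rank_relation_def)
  moreover have "\<phi> (jM \<zero>\<^bsub>M\<^esub>) = restrict (\<lambda>i. \<iota> (b i)) {..<r}" and b: "\<forall>i<r. b i \<in> carrier R"
    using assms(1) by (auto simp: rank_relation_def)
  ultimately have "restrict (\<lambda>i. \<iota> (b i)) {..<r} i = restrict (\<lambda>i. \<iota> (\<zero> \<otimes> b i)) {..<r} i" by simp
  then have "\<iota> (b i) = \<iota> \<zero>" using assms(2) b by simp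
  then show ?thesis using frac_class_ring_one_eq_iff[OF R.is_cring, of "b i" \<zero>] b assms(2) by simp
qed

lemma rank_relation_denominator:
  assumes v: "v \<in> carrier M"
  shows "\<exists>s\<in>nonzerodivisors R. \<exists>b. rr (s \<odot>\<^bsub>M\<^esub> v) b"
proof -
  note one = R.one_nonzerodivisor
  have "\<phi> (jM v) \<in> carrier (free_rank_module (total_frac_ring R) r)"
    using iso locI[OF v one] unfolding module_iso_def by (auto dest: bij_betwE)
  then have mem: "\<phi> (jM v) i \<in> carrier (total_frac_ring R)" if "i < r" for i
    using that by (auto simp: free_rank_module_simps PiE_iff)
  have "\<exists>a s. a \<in> carrier R \<and> s \<in> nonzerodivisors R \<and> \<phi> (jM v) i = frac_class R (ring_as_module R) a s" if "i < r" for i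
    using mem[OF that] unfolding total_frac_ring_carrier by blast
  then obtain a s where as: "\<And>i. i < r \<Longrightarrow> a i \<in> carrier R" "\<And>i. i < r \<Longrightarrow> s i \<in> nonzerodivisors R"
    "\<And>i. i < r \<Longrightarrow> \<phi> (jM v) i = frac_class R (ring_as_module R) (a i) (s i)" by metis
  \<comment> \<open>A common multiple t of the denominators, built one factor at a time. From t =
    s_i c_i the coordinate a_i/s_i of v/1 becomes c_i a_i for t v.\<close>
  have "\<exists>t\<in>nonzerodivisors R. \<forall>i<l. \<exists>c\<in>carrier R. t = s i \<otimes> c" if "l \<le> r" for l
    using that
  proof (induction l)
    case 0
    then show ?case using one by auto
  next
    case (Suc l)
    then have "\<exists>t\<in>nonzerodivisors R. \<forall>i<l. \<exists>c\<in>carrier R. t = s i \<otimes> c" by simp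
    then obtain t where t: "t \<in> nonzerodivisors R" "\<forall>i<l. \<exists>c\<in>carrier R. t = s i \<otimes> c" by (elim bexE)
    have sl: "s l \<in> nonzerodivisors R" using as(2) Suc.prems by simp
    note c = R.nonzerodivisors_closed[OF t(1)] R.nonzerodivisors_closed[OF sl]
    have "\<exists>c\<in>carrier R. t \<otimes> s l = s i \<otimes> c" if i: "i < Suc l" for i
    proof (cases "i = l")
      case True
      then show ?thesis using c by (intro bexI[of _ t]) (simp_all add: R.m_comm)
    next
      case False
      then have "i < l" using i by simp
      with t(2) have "\<exists>c\<in>carrier R. t = s i \<otimes> c" by blast
      then obtain d where d: "d \<in> carrier R" "t = s i \<otimes> d" by (elim bexE)
      have "s i \<in> carrier R" using as(2)[of i] i Suc.prems R.nonzerodivisors_closed by simp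
      then show ?thesis using d c by (intro bexI[of _ "d \<otimes> s l"]) (simp_all add: R.m_assoc)
    qed
    then show ?case using R.nonzerodivisors_mult[OF t(1) sl] by (intro bexI[of _ "t \<otimes> s l"]) auto
  qed
  then obtain t where t: "t \<in> nonzerodivisors R" "\<forall>i<r. \<exists>c\<in>carrier R. t = s i \<otimes> c" by (meson order_refl)
  then obtain c where c: "\<And>i. i < r \<Longrightarrow> c i \<in> carrier R" "\<And>i. i < r \<Longrightarrow> t = s i \<otimes> c i" by metis
  have tR: "t \<in> carrier R" by (rule R.nonzerodivisors_closed[OF t(1)])
  have "\<iota> t \<odot>\<^bsub>loc_module R M\<^esub> jM v = jM (t \<odot>\<^bsub>M\<^esub> v)"
    using loc_module_smult[OF module tR one v one] by simp
  then have "\<phi> (jM (t \<odot>\<^bsub>M\<^esub> v)) = restrict (\<lambda>i. \<iota> t \<otimes>\<^bsub>total_frac_ring R\<^esub> \<phi> (jM v) i) {..<r}"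
    using \<phi>_smult[OF totI[OF tR one] locI[OF v one]] by simp
  also have "\<dots> = restrict (\<lambda>i. \<iota> (c i \<otimes> a i)) {..<r}"
  proof (rule restrict_ext)
    fix i assume "i \<in> {..<r}"
    then have i: "i < r" by simp
    have sc: "s i \<in> carrier R" by (rule R.nonzerodivisors_closed[OF as(2)[OF i]])
    have "\<iota> t \<otimes>\<^bsub>total_frac_ring R\<^esub> \<phi> (jM v) i = frac_class R (ring_as_module R) (t \<otimes> a i) (\<one> \<otimes> s i)"
      unfolding as(3)[OF i] by (rule total_frac_ring_mult[OF R.is_cring tR as(1)[OF i] one as(2)[OF i]])
    also have "\<dots> = \<iota> (c i \<otimes> a i)"
    proof (subst frac_class_ring_eq_iff[OF R.is_cring])
      have "\<one> \<otimes> (t \<otimes> a i) = \<one> \<otimes> s i \<otimes> (c i \<otimes> a i)"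
        using c(1)[OF i] sc as(1)[OF i] by (simp add: c(2)[OF i] R.m_assoc)
      then show "\<exists>u\<in>nonzerodivisors R. u \<otimes> (\<one> \<otimes> (t \<otimes> a i)) = u \<otimes> (\<one> \<otimes> s i \<otimes> (c i \<otimes> a i))"
        using one by (intro bexI[of _ \<one>]) simp_all
    qed (use c i as tR one sc in auto)
    finally show "\<iota> t \<otimes>\<^bsub>total_frac_ring R\<^esub> \<phi> (jM v) i = \<iota> (c i \<otimes> a i)" .
  qed
  finally have "rr (t \<odot>\<^bsub>M\<^esub> v) (\<lambda>i. c i \<otimes> a i)"
    using v tR c(1) as(1) by (simp add: rank_relation_def)
  then show ?thesis using t(1) by blast
qed

text \<open>Injectivity of \<phi> gives v/1 = 0/1, which means torsion with respect to
  nonzerodivisors; v itself may be nonzero.\<close>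

lemma rank_relation_zero_right:
  assumes "rr v b" "\<And>i. i < r \<Longrightarrow> b i = \<zero>"
  shows "\<exists>u\<in>nonzerodivisors R. u \<odot>\<^bsub>M\<^esub> v = \<zero>\<^bsub>M\<^esub>"
proof -
  note one = R.one_nonzerodivisor
  have v: "v \<in> carrier M" and \<phi>v: "\<phi> (jM v) = restrict (\<lambda>i. \<iota> (b i)) {..<r}"
    using assms(1) by (auto simp: rank_relation_def)
  have "rr (\<zero> \<odot>\<^bsub>M\<^esub> v) (\<lambda>i. \<zero> \<otimes> b i)" by (rule rank_relation_smult[OF R.zero_closed assms(1)])
  then have "\<phi> (jM \<zero>\<^bsub>M\<^esub>) = restrict (\<lambda>i. \<iota> (\<zero> \<otimes> b i)) {..<r}"
    using v by (simp add: rank_relation_def)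
  also have "\<dots> = \<phi> (jM v)" unfolding \<phi>v using assms(2) by (intro restrict_ext) simp
  finally have "jM \<zero>\<^bsub>M\<^esub> = jM v"
    using iso locI[OF M.zero_closed one] locI[OF v one] unfolding module_iso_def
    by (auto dest: bij_betw_imp_inj_on inj_onD)
  then obtain u where u: "u \<in> nonzerodivisors R" "u \<odot>\<^bsub>M\<^esub> (\<one> \<odot>\<^bsub>M\<^esub> \<zero>\<^bsub>M\<^esub>) = u \<odot>\<^bsub>M\<^esub> (\<one> \<odot>\<^bsub>M\<^esub> v)"
    unfolding frac_class_eq_iff[OF module M.zero_closed v one one] by auto
  then have "u \<odot>\<^bsub>M\<^esub> v = \<zero>\<^bsub>M\<^esub>" using v R.nonzerodivisors_closed[OF u(1)] by simp
  then show ?thesis using u(1) by blast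
qed

text \<open>The preimage of a unit vector is a fraction v/t. Clearing its denominator puts t in
  place of 1.\<close>

lemma rank_relation_basis:
  assumes i: "i < r"
  shows "\<exists>t\<in>nonzerodivisors R. \<exists>v. rr v (\<lambda>j. if j = i then t else \<zero>)"
proof -
  note one = R.one_nonzerodivisor
  let ?e = "restrict (\<lambda>j. \<iota> (if j = i then \<one> else \<zero>)) {..<r}"
  have "?e \<in> carrier (free_rank_module (total_frac_ring R) r)"
    using totI one by (auto simp: free_rank_module_simps)
  then have "?e \<in> \<phi> ` carrier (loc_module R M)"
    using iso by (simp add: module_iso_def bij_betw_def)
  then obtain x where x: "x \<in> carrier (loc_module R M)" "\<phi> x = ?e" by auto
  then obtain v t where v: "v \<in> carrier M" "t \<in> nonzerodivisors R" "x = frac_class R M v t" by (auto simp: loc_module_carrier)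
  have tR: "t \<in> carrier R" by (rule R.nonzerodivisors_closed[OF v(2)])
  have "\<iota> t \<odot>\<^bsub>loc_module R M\<^esub> x = frac_class R M (t \<odot>\<^bsub>M\<^esub> v) (\<one> \<otimes> t)"
    unfolding v(3) by (rule loc_module_smult[OF module tR one v(1,2)])
  also have "\<dots> = jM v"
  proof (subst frac_class_eq_iff[OF module])
    show "\<exists>u\<in>nonzerodivisors R. u \<odot>\<^bsub>M\<^esub> (\<one> \<odot>\<^bsub>M\<^esub> (t \<odot>\<^bsub>M\<^esub> v)) = u \<odot>\<^bsub>M\<^esub> (\<one> \<otimes> t \<odot>\<^bsub>M\<^esub> v)"
      using one v tR by (intro bexI[of _ \<one>]) simp_all
  qed (use v tR one in auto)
  finally have "\<phi> (jM v) = restrict (\<lambda>j. \<iota> t \<otimes>\<^bsub>total_frac_ring R\<^esub> \<phi> x j) {..<r}"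
    using \<phi>_smult[OF totI[OF tR one] x(1)] by simp
  also have "\<dots> = restrict (\<lambda>j. \<iota> (if j = i then t else \<zero>)) {..<r}"
    unfolding x(2) using total_frac_ring_mult[OF R.is_cring tR _ one one] tR by (intro restrict_ext) simp
  finally have "rr v (\<lambda>j. if j = i then t else \<zero>)" using v tR by (simp add: rank_relation_def)
  then show ?thesis using v(2) by blast
qed

lemma rank_relation_closed: "rr v b \<Longrightarrow> v \<in> carrier M" "rr v b \<Longrightarrow> i < r \<Longrightarrow> b i \<in> carrier R"
  by (simp_all add: rank_relation_def)

end

section \<open>Modules with a rank and nilpotent relations\<close>

context module
begin

lemma finsum_lessThan_Suc_shift:
  assumes "f \<in> {..<Suc n} \<rightarrow> carrier M"
  shows "finsum M f {..<Suc n} = f 0 \<oplus>\<^bsub>M\<^esub> finsum M (\<lambda>i. f (Suc i)) {..<n}"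
proof -
  have "finsum M f (insert 0 (Suc ` {..<n})) = f 0 \<oplus>\<^bsub>M\<^esub> finsum M f (Suc ` {..<n})"
    using assms by (intro M.finsum_insert) auto
  also have "finsum M f (Suc ` {..<n}) = finsum M (\<lambda>i. f (Suc i)) {..<n}"
    using assms by (intro M.add.finprod_reindex) auto
  finally show ?thesis by (simp only: lessThan_Suc_eq_insert_0)
qed

lemma lin_span_finsum:
  assumes "set vs \<subseteq> carrier M" "x \<in> lin_span M (carrier R) vs"
  shows "\<exists>a. (\<forall>i<length vs. a i \<in> carrier R) \<and> x = finsum M (\<lambda>i. a i \<odot>\<^bsub>M\<^esub> vs ! i) {..<length vs}"
  using assms
proof (induction vs arbitrary: x)
  case (Cons v vs)
  obtain c w where c: "c \<in> carrier R" "w \<in> lin_span M (carrier R) vs" "x = c \<odot>\<^bsub>M\<^esub> v \<oplus>\<^bsub>M\<^esub> w"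
    using Cons.prems(2) by auto
  have vs: "set vs \<subseteq> carrier M" using Cons.prems(1) by simp
  from Cons.IH[OF vs c(2)] obtain a where a: "\<forall>i<length vs. a i \<in> carrier R"
    "w = finsum M (\<lambda>i. a i \<odot>\<^bsub>M\<^esub> vs ! i) {..<length vs}" by (elim exE conjE)
  define b where "b = case_nat c a"
  have b: "\<forall>i<length (v # vs). b i \<in> carrier R" using a(1) c(1) by (auto simp: b_def split: nat.split)
  have nth: "i < length (v # vs) \<Longrightarrow> (v # vs) ! i \<in> carrier M" for i using Cons.prems(1) nth_mem by blast
  have "finsum M (\<lambda>i. b i \<odot>\<^bsub>M\<^esub> (v # vs) ! i) {..<Suc (length vs)} =
     b 0 \<odot>\<^bsub>M\<^esub> (v # vs) ! 0 \<oplus>\<^bsub>M\<^esub> finsum M (\<lambda>i. b (Suc i) \<odot>\<^bsub>M\<^esub> (v # vs) ! Suc i) {..<length vs}"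
    using b nth by (intro finsum_lessThan_Suc_shift) auto
  then have "x = finsum M (\<lambda>i. b i \<odot>\<^bsub>M\<^esub> (v # vs) ! i) {..<length (v # vs)}"
    unfolding c(3) a(2) by (simp add: b_def)
  then show ?case using b by (intro exI[of _ b] conjI)
qed simp

lemma submodule_finsum:
  assumes L: "submodule L R M" and A: "finite A" and f: "\<And>i. i \<in> A \<Longrightarrow> f i \<in> L"
  shows "finsum M f A \<in> L"
  using A f
proof (induction A rule: finite_induct)
  case empty
  then show ?case using submodule_zero[OF L] by simp
next
  case (insert x A)
  then have "f \<in> A \<rightarrow> carrier M" "f x \<in> carrier M" using submoduleE(1)[OF L] by (auto simp: Pi_def)
  then show ?case using insert submoduleE(5)[OF L] by (subst M.finsum_insert) auto
qed

text \<open>A generating list of least length is taken. A coefficient outside m is a unit, so a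
  relation containing one expresses that generator by the others, and dropping it would shorten the
  list.\<close>

lemma minimal_generators:
  assumes loc: "local_ring R m" and us: "set us \<subseteq> carrier M" "carrier M = lin_span M (carrier R) us"
  shows "\<exists>vs. set vs \<subseteq> carrier M \<and> carrier M = lin_span M (carrier R) vs \<and>
    (\<forall>a i. (\<forall>i<length vs. a i \<in> carrier R) \<longrightarrow> finsum M (\<lambda>i. a i \<odot>\<^bsub>M\<^esub> vs ! i) {..<length vs} = \<zero>\<^bsub>M\<^esub> \<longrightarrow>
       i < length vs \<longrightarrow> a i \<in> m)"
proof -
  let ?P = "\<lambda>vs. set vs \<subseteq> carrier M \<and> carrier M = lin_span M (carrier R) vs"
  have "?P us" using us by simp
  then obtain vs where vs: "?P vs" and min: "\<And>ws. ?P ws \<Longrightarrow> length vs \<le> length ws"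
    using ex_has_least_nat[of ?P us length] by blast
  let ?k = "length vs"
  have "a i \<in> m" if a: "\<forall>i<?k. a i \<in> carrier R" "finsum M (\<lambda>i. a i \<odot>\<^bsub>M\<^esub> vs ! i) {..<?k} = \<zero>\<^bsub>M\<^esub>"
    and i: "i < ?k" for a i
  proof (rule ccontr)
    assume "a i \<notin> m"
    then have u: "a i \<in> Units R" using a(1) i by (intro local_ring_Units[OF loc]) auto
    define ws where "ws = take i vs @ drop (Suc i) vs"
    have ws_sub: "set ws \<subseteq> set vs" unfolding ws_def using set_take_subset set_drop_subset by fastforce
    have ws: "set ws \<subseteq> carrier M" using ws_sub vs by blast
    let ?L = "lin_span M (carrier R) ws"
    have L: "submodule ?L R M" by (rule lin_span_submodule[OF oneideal ws])
    have mem: "vs ! j \<in> set ws" if "j < ?k" "j \<noteq> i" for j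
    proof (cases "j < i")
      case True
      then have "vs ! j = take i vs ! j" "j < length (take i vs)" using that by auto
      then show ?thesis unfolding ws_def by (metis Un_iff nth_mem set_append)
    next
      case False
      then have "vs ! j = drop (Suc i) vs ! (j - Suc i)" "j - Suc i < length (drop (Suc i) vs)"
        using that by auto
      then show ?thesis unfolding ws_def by (metis Un_iff nth_mem set_append)
    qed
    then have memL: "vs ! j \<in> ?L" if "j < ?k" "j \<noteq> i" for j
      using lin_span_superset[OF ws] that by blast
    have vM: "vs ! j \<in> carrier M" if "j < ?k" for j using vs that nth_mem by blast
    let ?z = "finsum M (\<lambda>j. a j \<odot>\<^bsub>M\<^esub> vs ! j) ({..<?k} - {i})"
    have z: "?z \<in> ?L"
      using a(1) memL by (intro submodule_finsum[OF L]) (auto intro!: submoduleE(4)[OF L])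
    then have zM: "?z \<in> carrier M" using submoduleE(1)[OF L] by blast
    have "{..<?k} = insert i ({..<?k} - {i})" using i by auto
    then have "finsum M (\<lambda>j. a j \<odot>\<^bsub>M\<^esub> vs ! j) {..<?k} = finsum M (\<lambda>j. a j \<odot>\<^bsub>M\<^esub> vs ! j) (insert i ({..<?k} - {i}))"
      by simp
    also have "\<dots> = a i \<odot>\<^bsub>M\<^esub> vs ! i \<oplus>\<^bsub>M\<^esub> ?z"
      using a(1) vM i by (intro M.finsum_insert) auto
    finally have "a i \<odot>\<^bsub>M\<^esub> vs ! i = \<ominus>\<^bsub>M\<^esub> ?z"
      using a vM i zM by (intro M.minus_equality[symmetric]) auto
    then have "a i \<odot>\<^bsub>M\<^esub> vs ! i \<in> ?L" using submoduleE(3)[OF L z] by simp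
    then have "inv (a i) \<odot>\<^bsub>M\<^esub> (a i \<odot>\<^bsub>M\<^esub> vs ! i) \<in> ?L"
      by (rule submoduleE(4)[OF L R.Units_inv_closed[OF u]])
    moreover have "inv (a i) \<odot>\<^bsub>M\<^esub> (a i \<odot>\<^bsub>M\<^esub> vs ! i) = vs ! i"
    proof -
      have "inv (a i) \<odot>\<^bsub>M\<^esub> (a i \<odot>\<^bsub>M\<^esub> vs ! i) = (inv (a i) \<otimes> a i) \<odot>\<^bsub>M\<^esub> vs ! i"
        using u vM[OF i] by (intro smult_assoc1[symmetric]) auto
      then show ?thesis using u vM[OF i] by simp
    qed
    ultimately have "vs ! i \<in> ?L" by simp
    then have "vs ! j \<in> ?L" if "j < ?k" for j using memL that by (cases "j = i") auto
    then have "set vs \<subseteq> ?L" by (auto simp: set_conv_nth)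
    then have "lin_span M (carrier R) vs \<subseteq> ?L" by (rule lin_span_minimal[OF L])
    then have "?P ws" using vs ws submoduleE(1)[OF L] by blast
    then have "?k \<le> length ws" by (rule min)
    then show False using i by (simp add: ws_def)
  qed
  then show ?thesis using vs by blast
qed

end

lemma finitely_generated_lin_span:
  assumes "module R M" "finitely_generated R M"
  shows "\<exists>vs. set vs \<subseteq> carrier M \<and> carrier M = lin_span M (carrier R) vs"
proof -
  interpret module R M by fact
  obtain vs where vs: "set vs \<subseteq> carrier M" and gen: "\<forall>x\<in>carrier M. \<exists>a. (\<forall>i<length vs. a i \<in> carrier R) \<and>
     x = finsum M (\<lambda>i. a i \<odot>\<^bsub>M\<^esub> vs ! i) {..<length vs}"
    using assms(2) unfolding finitely_generated_def by (elim exE conjE)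
  have L: "submodule (lin_span M (carrier R) vs) R M" by (rule lin_span_submodule[OF oneideal vs])
  have "x \<in> lin_span M (carrier R) vs" if "x \<in> carrier M" for x
  proof -
    from bspec[OF gen that] obtain a where a: "\<forall>i<length vs. a i \<in> carrier R"
      "x = finsum M (\<lambda>i. a i \<odot>\<^bsub>M\<^esub> vs ! i) {..<length vs}" by (elim exE conjE)
    have "a i \<odot>\<^bsub>M\<^esub> vs ! i \<in> lin_span M (carrier R) vs" if "i \<in> {..<length vs}" for i
    proof (rule submoduleE(4)[OF L])
      show "vs ! i \<in> lin_span M (carrier R) vs"
        using subsetD[OF lin_span_superset[OF vs]] nth_mem that by simp
    qed (use a(1) that in simp)
    then show ?thesis unfolding a(2) by (rule submodule_finsum[OF L finite_lessThan])
  qed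
  then have "carrier M = lin_span M (carrier R) vs"
    by (intro equalityI subsetI submoduleE(1)[OF L, THEN subsetD])
  then show ?thesis using vs by blast
qed

text \<open>The multiplier z is a product of powers of the members of C, each as high as possible
  without killing the vector. In \<open>relations_trivial\<close> the set C consists of the entries
  of a matrix.\<close>

lemma (in cring) kill_nilpotents:
  assumes C: "finite C" "\<And>c. c \<in> C \<Longrightarrow> c \<in> carrier R" "\<And>c. c \<in> C \<Longrightarrow> c [^] (q::nat) = \<zero>"
    and a: "\<And>i. i < k \<Longrightarrow> a i \<in> carrier R" "\<exists>i<k::nat. a i \<noteq> \<zero>"
  shows "\<exists>z\<in>carrier R. (\<exists>i<k. z \<otimes> a i \<noteq> \<zero>) \<and> (\<forall>c\<in>C. \<forall>i<k. c \<otimes> (z \<otimes> a i) = \<zero>)"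
  using C
proof (induction C rule: finite_induct)
  case empty
  then show ?case using a by (intro bexI[of _ \<one>]) auto
next
  case (insert c C)
  have "\<exists>z\<in>carrier R. (\<exists>i<k. z \<otimes> a i \<noteq> \<zero>) \<and> (\<forall>c\<in>C. \<forall>i<k. c \<otimes> (z \<otimes> a i) = \<zero>)"
    by (rule insert.IH; rule insert.prems; rule insertI2)
  then obtain z where z: "z \<in> carrier R" "\<exists>i<k. z \<otimes> a i \<noteq> \<zero>"
    "\<forall>c\<in>C. \<forall>i<k. c \<otimes> (z \<otimes> a i) = \<zero>" by (elim bexE conjE)
  have c: "c \<in> carrier R" "c [^] q = \<zero>" using insert.prems by auto
  let ?Q = "\<lambda>l. \<forall>i<k. c [^] (l::nat) \<otimes> (z \<otimes> a i) = \<zero>"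
  have "?Q q" using c z(1) a(1) by simp
  moreover have "\<not> ?Q 0" using z a(1) by auto
  \<comment> \<open>l is such that c^l does not kill z a but c^(l + 1) does. The new multiplier c^l
    z is annihilated on a by c and still by the earlier members of C.\<close>
  ultimately have "\<exists>l<q. (\<forall>i\<le>l. \<not> ?Q i) \<and> ?Q (Suc l)" by (intro ex_least_nat_less)
  then obtain l where l: "\<not> ?Q l" "?Q (Suc l)" by blast
  let ?z = "c [^] l \<otimes> z"
  have "\<exists>i<k. ?z \<otimes> a i \<noteq> \<zero>" using l(1) c z(1) a(1) by (auto simp: m_assoc)
  moreover have "c \<otimes> (?z \<otimes> a i) = \<zero>" if "i < k" for i
  proof -
    have "c \<otimes> (?z \<otimes> a i) = c [^] Suc l \<otimes> (z \<otimes> a i)" using c z(1) a(1)[OF that] by (simp add: m_ac)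
    then show ?thesis using l(2) that by simp
  qed
  moreover have "d \<otimes> (?z \<otimes> a i) = \<zero>" if "i < k" "d \<in> C" for i d
  proof -
    have d: "d \<in> carrier R" using insert.prems(1) that by auto
    have "d \<otimes> (?z \<otimes> a i) = c [^] l \<otimes> (d \<otimes> (z \<otimes> a i))" using c z(1) d a(1)[OF that(1)] by (simp add: m_ac)
    then show ?thesis using z(3) that c by simp
  qed
  ultimately have "\<forall>d\<in>insert c C. \<forall>i<k. d \<otimes> (?z \<otimes> a i) = \<zero>" by blast
  moreover have "?z \<in> carrier R" using c z(1) by simp
  moreover note \<open>\<exists>i<k. ?z \<otimes> a i \<noteq> \<zero>\<close>
  ultimately show ?case by blast
qed

text \<open>Let \<open>e\<close> generate \<open>M\<close> and let \<open>T v b\<close> mean that \<open>v\<close> has coordinates \<open>b\<close> with respect to a basis of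
  the localisation. If \<open>s e\<^sub>j\<close> has coordinates \<open>B\<^sub>j\<close> and \<open>v\<^sub>i = \<Sum> C\<^sub>i\<^sub>j e\<^sub>j\<close> has coordinates \<open>t \<epsilon>\<^sub>i\<close>, then
  every relation \<open>a\<close> satisfies \<open>a B = 0\<close>, hence \<open>s t a = a A\<close> for \<open>A = s t - B C\<close>. The rows of \<open>A\<close> are
  relations up to a nonzerodivisor, so \<open>A\<close> has nilpotent entries and \<open>a\<close> must vanish.\<close>

lemma relations_trivial:
  fixes R :: "('a, 'b) ring_scheme" (structure) and M :: "('a, 'c) module" and k r q :: nat
  assumes module: "module R M"
    and iso: "module_iso (total_frac_ring R) (loc_module R M) (free_rank_module (total_frac_ring R) r) \<phi>"
    and e: "\<And>i. i < k \<Longrightarrow> e i \<in> carrier M"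
    and gen: "\<And>x. x \<in> carrier M \<Longrightarrow> \<exists>a. (\<forall>i<k. a i \<in> carrier R) \<and> x = finsum M (\<lambda>i. a i \<odot>\<^bsub>M\<^esub> e i) {..<k}"
    and nil: "\<And>a i. (\<And>i. i < k \<Longrightarrow> a i \<in> carrier R) \<Longrightarrow> finsum M (\<lambda>i. a i \<odot>\<^bsub>M\<^esub> e i) {..<k} = \<zero>\<^bsub>M\<^esub> \<Longrightarrow>
        i < k \<Longrightarrow> a i [^] q = \<zero>"
    and a: "\<And>i. i < k \<Longrightarrow> a i \<in> carrier R" "finsum M (\<lambda>i. a i \<odot>\<^bsub>M\<^esub> e i) {..<k} = \<zero>\<^bsub>M\<^esub>" "i < k"
  shows "a i = \<zero>"
proof (rule ccontr)
  assume ai: "a i \<noteq> \<zero>"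
  interpret module R M by (rule module)
  interpret RM: module R "ring_as_module R" by (rule R.ring_module)
  let ?S = "nonzerodivisors R"
  define T where "T = rank_relation R M r \<phi>"
  note T_cong = rank_relation_cong[OF module iso, folded T_def]
    and T_add = rank_relation_add[OF module iso, folded T_def]
    and T_smult = rank_relation_smult[OF module iso, folded T_def]
    and T_zero_left = rank_relation_zero_left[OF module iso, folded T_def]
    and T_zero_right = rank_relation_zero_right[OF module iso, folded T_def]
    and T_den = rank_relation_denominator[OF module iso, folded T_def]
    and T_basis = rank_relation_basis[OF module iso, folded T_def]
    and T_closed = rank_relation_closed[OF module iso, folded T_def]
  note Sc = R.nonzerodivisors_closed
  have T0: "T \<zero>\<^bsub>M\<^esub> (\<lambda>i. \<zero>)"
  proof -
    obtain s b where "s \<in> ?S" "T (s \<odot>\<^bsub>M\<^esub> \<zero>\<^bsub>M\<^esub>) b" using T_den[OF M.zero_closed] by (elim bexE exE)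
    then have s: "T \<zero>\<^bsub>M\<^esub> b" using Sc by simp
    have "T (\<zero> \<odot>\<^bsub>M\<^esub> \<zero>\<^bsub>M\<^esub>) (\<lambda>i. \<zero> \<otimes> b i)" by (rule T_smult[OF R.zero_closed s])
    then have "T \<zero>\<^bsub>M\<^esub> (\<lambda>i. \<zero> \<otimes> b i)" by simp
    then show ?thesis by (rule T_cong) (use T_closed(2)[OF s] in simp)
  qed
  have T_finsum: "T (finsum M (\<lambda>j. c j \<odot>\<^bsub>M\<^esub> x j) A) (\<lambda>l. finsum R (\<lambda>j. c j \<otimes> b j l) A)"
    if "finite A" "\<And>j. j \<in> A \<Longrightarrow> c j \<in> carrier R" "\<And>j. j \<in> A \<Longrightarrow> T (x j) (b j)" for A :: "nat set" and c x b
    using that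
  proof (induction A rule: finite_induct)
    case empty
    then show ?case using T0 by simp
  next
    case (insert j A)
    have "T (c j \<odot>\<^bsub>M\<^esub> x j \<oplus>\<^bsub>M\<^esub> finsum M (\<lambda>j. c j \<odot>\<^bsub>M\<^esub> x j) A) (\<lambda>l. c j \<otimes> b j l \<oplus> finsum R (\<lambda>j. c j \<otimes> b j l) A)"
      by (intro T_add T_smult insert.IH insert.prems) auto
    moreover have "c i \<odot>\<^bsub>M\<^esub> x i \<in> carrier M" if "i \<in> insert j A" for i
      by (rule smult_closed[OF insert.prems(1)[OF that] T_closed(1)[OF insert.prems(2)[OF that]]])
    then have "finsum M (\<lambda>j. c j \<odot>\<^bsub>M\<^esub> x j) (insert j A) = c j \<odot>\<^bsub>M\<^esub> x j \<oplus>\<^bsub>M\<^esub> finsum M (\<lambda>j. c j \<odot>\<^bsub>M\<^esub> x j) A"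
      using insert.hyps by (intro M.finsum_insert) (simp_all add: Pi_def)
    ultimately have "T (finsum M (\<lambda>j. c j \<odot>\<^bsub>M\<^esub> x j) (insert j A)) (\<lambda>l. c j \<otimes> b j l \<oplus> finsum R (\<lambda>j. c j \<otimes> b j l) A)"
      by simp
    then show ?case
    proof (rule T_cong)
      fix l assume l: "l < r"
      show "c j \<otimes> b j l \<oplus> finsum R (\<lambda>j. c j \<otimes> b j l) A = finsum R (\<lambda>j. c j \<otimes> b j l) (insert j A)"
      proof -
        have "c i \<otimes> b i l \<in> carrier R" if "i \<in> insert j A" for i
          by (rule R.m_closed[OF insert.prems(1)[OF that] T_closed(2)[OF insert.prems(2)[OF that] l]])
        then show ?thesis using insert.hyps by (intro R.finsum_insert[symmetric]) (simp_all add: Pi_def)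
      qed
    qed
  qed
  \<comment> \<open>One nonzerodivisor s for all generators, obtained as a product by induction on
    l; vectors treated earlier are only rescaled. The common t for the basis vectors is found in the
    same way.\<close>
  have "\<exists>s\<in>?S. \<forall>j<l. \<exists>b. T (s \<odot>\<^bsub>M\<^esub> e j) b" if "l \<le> k" for l
    using that
  proof (induction l)
    case 0
    show ?case using R.one_nonzerodivisor by (intro bexI[of _ \<one>]) auto
  next
    case (Suc l)
    then have "\<exists>s\<in>?S. \<forall>j<l. \<exists>b. T (s \<odot>\<^bsub>M\<^esub> e j) b" by simp
    then obtain s where s: "s \<in> ?S" "\<forall>j<l. \<exists>b. T (s \<odot>\<^bsub>M\<^esub> e j) b" by (elim bexE)
    have el: "e l \<in> carrier M" using e Suc.prems by simp
    obtain t b where t: "t \<in> ?S" "T (t \<odot>\<^bsub>M\<^esub> e l) b" using T_den[OF el] by (elim bexE exE)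
    have "\<exists>b. T ((s \<otimes> t) \<odot>\<^bsub>M\<^esub> e j) b" if j: "j < Suc l" for j
    proof (cases "j = l")
      case True
      have "T (s \<odot>\<^bsub>M\<^esub> (t \<odot>\<^bsub>M\<^esub> e l)) (\<lambda>i. s \<otimes> b i)" by (rule T_smult[OF Sc[OF s(1)] t(2)])
      then show ?thesis using el Sc[OF s(1)] Sc[OF t(1)] True by (auto simp: smult_assoc1)
    next
      case False
      then have "j < l" using j by simp
      then obtain b where "T (s \<odot>\<^bsub>M\<^esub> e j) b" using s(2) by blast
      then have "T (t \<odot>\<^bsub>M\<^esub> (s \<odot>\<^bsub>M\<^esub> e j)) (\<lambda>i. t \<otimes> b i)" by (rule T_smult[OF Sc[OF t(1)]])
      moreover have "t \<odot>\<^bsub>M\<^esub> (s \<odot>\<^bsub>M\<^esub> e j) = (s \<otimes> t) \<odot>\<^bsub>M\<^esub> e j"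
        using e[of j] j Suc.prems Sc[OF s(1)] Sc[OF t(1)] by (simp add: smult_assoc1 smult_commute)
      ultimately show ?thesis by auto
    qed
    then show ?case using R.nonzerodivisors_mult[OF s(1) t(1)] by blast
  qed
  then obtain s where s: "s \<in> ?S" and "\<forall>j<k. \<exists>b. T (s \<odot>\<^bsub>M\<^esub> e j) b" by blast
  then obtain B where B: "\<And>j. j < k \<Longrightarrow> T (s \<odot>\<^bsub>M\<^esub> e j) (B j)" by metis
  have "\<exists>t\<in>?S. \<forall>j<l. \<exists>v. T v (\<lambda>i. if i = j then t else \<zero>)" if "l \<le> r" for l
    using that
  proof (induction l)
    case 0
    show ?case using R.one_nonzerodivisor by (intro bexI[of _ \<one>]) auto
  next
    case (Suc l)
    then have "\<exists>t\<in>?S. \<forall>j<l. \<exists>v. T v (\<lambda>i. if i = j then t else \<zero>)" by simp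
    then obtain t where t: "t \<in> ?S" "\<forall>j<l. \<exists>v. T v (\<lambda>i. if i = j then t else \<zero>)" by (elim bexE)
    have lr: "l < r" using Suc.prems by simp
    obtain t' v where t': "t' \<in> ?S" "T v (\<lambda>i. if i = l then t' else \<zero>)" using T_basis[OF lr] by (elim bexE exE)
    note c = Sc[OF t(1)] Sc[OF t'(1)]
    have "\<exists>v. T v (\<lambda>i. if i = j then t \<otimes> t' else \<zero>)" if j: "j < Suc l" for j
    proof (cases "j = l")
      case True
      have "T (t \<odot>\<^bsub>M\<^esub> v) (\<lambda>i. t \<otimes> (if i = l then t' else \<zero>))" by (rule T_smult[OF c(1) t'(2)])
      then have "T (t \<odot>\<^bsub>M\<^esub> v) (\<lambda>i. if i = j then t \<otimes> t' else \<zero>)" by (rule T_cong) (use c True in auto)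
      then show ?thesis by blast
    next
      case False
      then have "j < l" using j by simp
      then obtain w where "T w (\<lambda>i. if i = j then t else \<zero>)" using t(2) by blast
      then have "T (t' \<odot>\<^bsub>M\<^esub> w) (\<lambda>i. t' \<otimes> (if i = j then t else \<zero>))" by (rule T_smult[OF c(2)])
      then have "T (t' \<odot>\<^bsub>M\<^esub> w) (\<lambda>i. if i = j then t \<otimes> t' else \<zero>)" by (rule T_cong) (use c in \<open>auto simp: R.m_comm\<close>)
      then show ?thesis by blast
    qed
    then show ?case using R.nonzerodivisors_mult[OF t(1) t'(1)] by blast
  qed
  then obtain t where t: "t \<in> ?S" and "\<forall>j<r. \<exists>v. T v (\<lambda>i. if i = j then t else \<zero>)" by blast
  then obtain v where v: "\<And>j. j < r \<Longrightarrow> T (v j) (\<lambda>i. if i = j then t else \<zero>)" by metis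
  have "\<exists>c. (\<forall>j<k. c j \<in> carrier R) \<and> v i = finsum M (\<lambda>j. c j \<odot>\<^bsub>M\<^esub> e j) {..<k}" if "i < r" for i
    by (rule gen[OF T_closed(1)[OF v[OF that]]])
  then obtain C where C: "\<And>i j. i < r \<Longrightarrow> j < k \<Longrightarrow> C i j \<in> carrier R"
    "\<And>i. i < r \<Longrightarrow> v i = finsum M (\<lambda>j. C i j \<odot>\<^bsub>M\<^esub> e j) {..<k}" by metis
  note cs = Sc[OF s] Sc[OF t]
  have Bc: "B j l \<in> carrier R" if "j < k" "l < r" for j l using T_closed(2)[OF B[OF that(1)] that(2)] .
  define \<sigma> where "\<sigma> = s \<otimes> t"
  have \<sigma>: "\<sigma> \<in> ?S" "\<sigma> \<in> carrier R" unfolding \<sigma>_def using R.nonzerodivisors_mult[OF s t] cs by auto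
  define D where "D j l = finsum R (\<lambda>i. B j i \<otimes> C i l) {..<r}" for j l
  have Dc: "D j l \<in> carrier R" if "j < k" "l < k" for j l
    unfolding D_def using that Bc C(1) by (intro R.finsum_closed) auto
  define A where "A j l = (if l = j then \<sigma> else \<zero>) \<ominus> D j l" for j l
  have Ac: "A j l \<in> carrier R" if "j < k" "l < k" for j l
    unfolding A_def using that Dc \<sigma> by auto
  have A_nil: "A j l [^] q = \<zero>" if j: "j < k" and l: "l < k" for j l
  proof -
    let ?y = "finsum M (\<lambda>i. B j i \<odot>\<^bsub>M\<^esub> v i) {..<r}"
    have ej: "e j \<in> carrier M" by (rule e[OF j])
    have vM: "v i \<in> carrier M" if "i < r" for i using T_closed(1)[OF v[OF that]] .
    have yM: "?y \<in> carrier M" using Bc[OF j] vM by (intro M.finsum_closed) auto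
    have Ty: "T ?y (\<lambda>l. finsum R (\<lambda>i. B j i \<otimes> (if l = i then t else \<zero>)) {..<r})"
      by (rule T_finsum) (use Bc[OF j] v in auto)
    have delta: "finsum R (\<lambda>i. B j i \<otimes> (if l = i then t else \<zero>)) {..<r} = B j l \<otimes> t" if "l < r" for l
      using RM.finsum_smult_delta[of "{..<r}" l t "B j"] that Bc[OF j] cs
      by (simp add: R.m_comm[of _ "B j _"] eq_commute[of l] cong: R.finsum_cong)
    \<comment> \<open>\<sigma> e_j and the sum of the B_ji v_i have the same coordinates t B_j.
      Their difference has coordinates zero and is therefore killed by some nonzerodivisor
      u.\<close>
    have "T (\<sigma> \<odot>\<^bsub>M\<^esub> e j \<oplus>\<^bsub>M\<^esub> (\<ominus> \<one>) \<odot>\<^bsub>M\<^esub> ?y)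
       (\<lambda>l. t \<otimes> B j l \<oplus> (\<ominus> \<one>) \<otimes> finsum R (\<lambda>i. B j i \<otimes> (if l = i then t else \<zero>)) {..<r})"
    proof (rule T_add[OF _ T_smult[OF _ Ty]])
      have "T (t \<odot>\<^bsub>M\<^esub> (s \<odot>\<^bsub>M\<^esub> e j)) (\<lambda>l. t \<otimes> B j l)" by (rule T_smult[OF cs(2) B[OF j]])
      then show "T (\<sigma> \<odot>\<^bsub>M\<^esub> e j) (\<lambda>l. t \<otimes> B j l)"
        using cs ej by (simp add: \<sigma>_def smult_assoc1 smult_commute[of s t])
    qed simp
    then have "\<exists>u\<in>?S. u \<odot>\<^bsub>M\<^esub> (\<sigma> \<odot>\<^bsub>M\<^esub> e j \<oplus>\<^bsub>M\<^esub> (\<ominus> \<one>) \<odot>\<^bsub>M\<^esub> ?y) = \<zero>\<^bsub>M\<^esub>"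
    proof (rule T_zero_right)
      fix l assume l: "l < r"
      show "t \<otimes> B j l \<oplus> (\<ominus> \<one>) \<otimes> finsum R (\<lambda>i. B j i \<otimes> (if l = i then t else \<zero>)) {..<r} = \<zero>"
        unfolding delta[OF l] using Bc[OF j l] cs by (simp add: R.l_minus R.m_comm R.r_neg)
    qed
    then obtain u where u: "u \<in> ?S" "u \<odot>\<^bsub>M\<^esub> (\<sigma> \<odot>\<^bsub>M\<^esub> e j \<ominus>\<^bsub>M\<^esub> ?y) = \<zero>\<^bsub>M\<^esub>"
      using yM by (auto simp: smult_l_minus M.minus_eq)
    have uc: "u \<in> carrier R" by (rule Sc[OF u(1)])
    have "?y = finsum M (\<lambda>i. B j i \<odot>\<^bsub>M\<^esub> finsum M (\<lambda>l. C i l \<odot>\<^bsub>M\<^esub> e l) {..<k}) {..<r}"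
      using Bc[OF j] C vM by (intro M.finsum_cong') auto
    also have "\<dots> = finsum M (\<lambda>l. D j l \<odot>\<^bsub>M\<^esub> e l) {..<k}"
      unfolding D_def using Bc[OF j] C(1) e by (intro finsum_smult_finsum) auto
    finally have y: "?y = finsum M (\<lambda>l. D j l \<odot>\<^bsub>M\<^esub> e l) {..<k}" .
    have "finsum M (\<lambda>l. A j l \<odot>\<^bsub>M\<^esub> e l) {..<k} =
       finsum M (\<lambda>l. (if l = j then \<sigma> else \<zero>) \<odot>\<^bsub>M\<^esub> e l) {..<k} \<ominus>\<^bsub>M\<^esub> ?y"
      unfolding A_def y using Dc[OF j] e \<sigma> by (intro finsum_smult_diff) auto
    also have "finsum M (\<lambda>l. (if l = j then \<sigma> else \<zero>) \<odot>\<^bsub>M\<^esub> e l) {..<k} = \<sigma> \<odot>\<^bsub>M\<^esub> e j"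
      using j e \<sigma> by (intro finsum_smult_delta) auto
    finally have "\<sigma> \<odot>\<^bsub>M\<^esub> e j \<ominus>\<^bsub>M\<^esub> ?y = finsum M (\<lambda>l. A j l \<odot>\<^bsub>M\<^esub> e l) {..<k}" by simp
    then have "u \<odot>\<^bsub>M\<^esub> finsum M (\<lambda>l. A j l \<odot>\<^bsub>M\<^esub> e l) {..<k} = \<zero>\<^bsub>M\<^esub>" using u(2) by simp
    moreover have "u \<odot>\<^bsub>M\<^esub> finsum M (\<lambda>l. A j l \<odot>\<^bsub>M\<^esub> e l) {..<k} = finsum M (\<lambda>l. u \<odot>\<^bsub>M\<^esub> (A j l \<odot>\<^bsub>M\<^esub> e l)) {..<k}"
      using uc Ac[OF j] e by (intro finsum_smult_ldistr) auto
    moreover have "\<dots> = finsum M (\<lambda>l. (u \<otimes> A j l) \<odot>\<^bsub>M\<^esub> e l) {..<k}"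
      using uc Ac[OF j] e by (intro M.finsum_cong') (auto simp: smult_assoc1)
    ultimately have "finsum M (\<lambda>l. (u \<otimes> A j l) \<odot>\<^bsub>M\<^esub> e l) {..<k} = \<zero>\<^bsub>M\<^esub>" by simp
    \<comment> \<open>Only u times the j-th row of A is a relation of M. The power u^q is again a
      nonzerodivisor and can be cancelled.\<close>
    then have "(u \<otimes> A j l) [^] q = \<zero>" using uc Ac[OF j] l by (intro nil[of "\<lambda>l. u \<otimes> A j l"]) auto
    then have "u [^] q \<otimes> A j l [^] q = \<zero>" using uc Ac[OF j l] by (simp add: R.nat_pow_distrib)
    then show ?thesis
      using R.nonzerodivisorsD[OF R.nonzerodivisors_pow[OF u(1)]] Ac[OF j l] by simp
  qed
  have aB: "finsum R (\<lambda>j. a j \<otimes> B j l) {..<k} = \<zero>" if l: "l < r" for l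
  proof -
    have "T (finsum M (\<lambda>j. a j \<odot>\<^bsub>M\<^esub> (s \<odot>\<^bsub>M\<^esub> e j)) {..<k}) (\<lambda>l. finsum R (\<lambda>j. a j \<otimes> B j l) {..<k})"
      by (rule T_finsum) (use a(1) B in auto)
    moreover have "finsum M (\<lambda>j. a j \<odot>\<^bsub>M\<^esub> (s \<odot>\<^bsub>M\<^esub> e j)) {..<k} = finsum M (\<lambda>j. s \<odot>\<^bsub>M\<^esub> (a j \<odot>\<^bsub>M\<^esub> e j)) {..<k}"
      using a(1) e cs by (intro M.finsum_cong') (auto simp: smult_commute)
    moreover have "\<dots> = s \<odot>\<^bsub>M\<^esub> finsum M (\<lambda>j. a j \<odot>\<^bsub>M\<^esub> e j) {..<k}"
      using a(1) e cs by (intro finsum_smult_ldistr[symmetric]) auto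
    ultimately have "T \<zero>\<^bsub>M\<^esub> (\<lambda>l. finsum R (\<lambda>j. a j \<otimes> B j l) {..<k})" using a(2) cs by simp
    then show ?thesis using l by (rule T_zero_left)
  qed
  \<comment> \<open>Since D = B C and a B = 0, the part a D vanishes and only the diagonal part
    \<sigma> a remains.\<close>
  have aA: "finsum R (\<lambda>j. A j l \<otimes> a j) {..<k} = \<sigma> \<otimes> a l" if l: "l < k" for l
  proof -
    have "finsum R (\<lambda>j. D j l \<otimes> a j) {..<k} = finsum R (\<lambda>j. a j \<otimes> finsum R (\<lambda>i. B j i \<otimes> C i l) {..<r}) {..<k}"
      unfolding D_def using a(1) Dc[OF _ l, unfolded D_def] by (intro R.finsum_cong') (auto simp: R.m_comm)
    also have "\<dots> = finsum R (\<lambda>i. finsum R (\<lambda>j. a j \<otimes> B j i) {..<k} \<otimes> C i l) {..<r}"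
      using RM.finsum_smult_finsum[of "{..<k}" "{..<r}" a B "\<lambda>i. C i l"] a(1) Bc C(1)[OF _ l] by (simp add: Pi_def)
    also have "\<dots> = finsum R (\<lambda>i. \<zero>) {..<r}"
      using aB C(1)[OF _ l] by (intro R.finsum_cong') auto
    finally have "finsum R (\<lambda>j. D j l \<otimes> a j) {..<k} = \<zero>" by simp
    moreover have "finsum R (\<lambda>j. A j l \<otimes> a j) {..<k} =
        finsum R (\<lambda>j. (if l = j then \<sigma> else \<zero>) \<otimes> a j) {..<k} \<ominus> finsum R (\<lambda>j. D j l \<otimes> a j) {..<k}"
      using RM.finsum_smult_diff[of "\<lambda>j. if l = j then \<sigma> else \<zero>" "{..<k}" "\<lambda>j. D j l" a] a(1) Dc[OF _ l] \<sigma>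
      by (simp add: A_def Pi_def)
    moreover have "finsum R (\<lambda>j. (if l = j then \<sigma> else \<zero>) \<otimes> a j) {..<k} = \<sigma> \<otimes> a l"
      using RM.finsum_smult_delta[of "{..<k}" l \<sigma> a] l a(1) \<sigma> by (simp add: eq_commute[of l] Pi_def)
    ultimately show ?thesis using a(1)[OF l] \<sigma> by (simp add: R.minus_eq)
  qed
  let ?C = "(\<lambda>(j, l). A j l) ` ({..<k} \<times> {..<k})"
  \<comment> \<open>With z a nonzero but annihilated by every entry of A, the equation \<sigma> a =
    a A becomes \<sigma> z a = 0, and \<sigma> is a nonzerodivisor.\<close>
  have "\<exists>z\<in>carrier R. (\<exists>i<k. z \<otimes> a i \<noteq> \<zero>) \<and> (\<forall>c\<in>?C. \<forall>i<k. c \<otimes> (z \<otimes> a i) = \<zero>)"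
    by (rule R.kill_nilpotents[where q = q]) (use Ac A_nil a(1,3) ai in auto)
  then obtain z where z: "z \<in> carrier R" "\<exists>i<k. z \<otimes> a i \<noteq> \<zero>" "\<forall>c\<in>?C. \<forall>i<k. c \<otimes> (z \<otimes> a i) = \<zero>"
    by (elim bexE conjE)
  have "z \<otimes> a l = \<zero>" if l: "l < k" for l
  proof -
    have "z \<otimes> (\<sigma> \<otimes> a l) = finsum R (\<lambda>j. z \<otimes> (A j l \<otimes> a j)) {..<k}"
      unfolding aA[OF l, symmetric] using z(1) a(1) Ac[OF _ l] by (intro R.finsum_rdistr) auto
    also have "\<dots> = finsum R (\<lambda>j. \<zero>) {..<k}"
    proof (rule R.finsum_cong')
      fix j assume "j \<in> {..<k}"
      then have j: "j < k" by simp
      have "A j l \<in> ?C" using j l by auto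
      then have "A j l \<otimes> (z \<otimes> a j) = \<zero>" using z(3) j by blast
      then show "z \<otimes> (A j l \<otimes> a j) = \<zero>" using z(1) a(1)[OF j] Ac[OF j l] by (simp add: R.m_ac)
    qed auto
    finally have "z \<otimes> (\<sigma> \<otimes> a l) = \<zero>" by simp
    then have "\<sigma> \<otimes> (z \<otimes> a l) = \<zero>" using z(1) \<sigma> a(1)[OF l] by (simp add: R.m_lcomm)
    then show ?thesis using R.nonzerodivisorsD[OF \<sigma>(1)] z(1) a(1)[OF l] by simp
  qed
  then show False using z(2) by auto
qed

text \<open>\<open>free_module\<close> asks for a basis as a set, not as a family. Hence e must be
  injective: two equal generators with different indices would give a relation with coefficient 1,
  and 1 \<noteq> 0.\<close>

lemma free_module_trivial_relations:
  fixes R :: "('a, 'b) ring_scheme" (structure) and M :: "('a, 'c) module" and k :: nat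
  assumes module: "module R M" and nontrivial: "\<one> \<noteq> \<zero>"
    and e: "\<And>i. i < k \<Longrightarrow> e i \<in> carrier M"
    and gen: "\<And>x. x \<in> carrier M \<Longrightarrow> \<exists>a. (\<forall>i<k. a i \<in> carrier R) \<and> x = finsum M (\<lambda>i. a i \<odot>\<^bsub>M\<^esub> e i) {..<k}"
    and triv: "\<And>a i. (\<And>i. i < k \<Longrightarrow> a i \<in> carrier R) \<Longrightarrow> finsum M (\<lambda>i. a i \<odot>\<^bsub>M\<^esub> e i) {..<k} = \<zero>\<^bsub>M\<^esub> \<Longrightarrow>
        i < k \<Longrightarrow> a i = \<zero>"
  shows "free_module R M"
proof -
  interpret module R M by (rule module)
  have unique: "a i = b i"
    if a: "\<And>i. i < k \<Longrightarrow> a i \<in> carrier R" and b: "\<And>i. i < k \<Longrightarrow> b i \<in> carrier R"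
      and eq: "finsum M (\<lambda>i. a i \<odot>\<^bsub>M\<^esub> e i) {..<k} = finsum M (\<lambda>i. b i \<odot>\<^bsub>M\<^esub> e i) {..<k}" and i: "i < k" for a b i
  proof -
    have "finsum M (\<lambda>i. b i \<odot>\<^bsub>M\<^esub> e i) {..<k} \<in> carrier M"
      using b e by (intro M.finsum_closed) auto
    then have "finsum M (\<lambda>i. (a i \<ominus> b i) \<odot>\<^bsub>M\<^esub> e i) {..<k} = \<zero>\<^bsub>M\<^esub>"
      using finsum_smult_diff[of a "{..<k}" b e] a b e eq by (simp add: Pi_def M.minus_eq M.r_neg)
    then have "a i \<ominus> b i = \<zero>" using a b i by (intro triv[of "\<lambda>i. a i \<ominus> b i"]) auto
    then show ?thesis using a[OF i] b[OF i] by simp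
  qed
  have delta: "finsum M (\<lambda>l. (if l = i then \<one> else \<zero>) \<odot>\<^bsub>M\<^esub> e l) {..<k} = e i" if i: "i < k" for i
    using finsum_smult_delta[of "{..<k}" i \<one> e] i e by simp
  have inj: "inj_on e {..<k}"
  proof (rule inj_onI)
    fix i j assume ij: "i \<in> {..<k}" "j \<in> {..<k}" "e i = e j"
    then have i: "i < k" and j: "j < k" by simp_all
    have "finsum M (\<lambda>l. (if l = i then \<one> else \<zero>) \<odot>\<^bsub>M\<^esub> e l) {..<k} =
        finsum M (\<lambda>l. (if l = j then \<one> else \<zero>) \<odot>\<^bsub>M\<^esub> e l) {..<k}"
      using delta[OF i] delta[OF j] ij(3) by simp
    then have "(if i = i then \<one> else \<zero>) = (if i = j then \<one> else \<zero>)"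
      by (intro unique[of "\<lambda>l. if l = i then \<one> else \<zero>" "\<lambda>l. if l = j then \<one> else \<zero>" i]) (use i in auto)
    then show "i = j" using nontrivial by (auto split: if_splits)
  qed
  let ?B = "e ` {..<k}"
  have BM: "?B \<subseteq> carrier M" using e by auto
  have sum_eq: "finsum M (\<lambda>b. c b \<odot>\<^bsub>M\<^esub> b) {b \<in> ?B. c b \<noteq> \<zero>} = finsum M (\<lambda>i. c (e i) \<odot>\<^bsub>M\<^esub> e i) {..<k}"
    if c: "c \<in> ?B \<rightarrow>\<^sub>E carrier R" for c
  proof -
    have cR: "c b \<in> carrier R" if "b \<in> ?B" for b using c that by (auto simp: PiE_iff)
    have bM: "b \<in> carrier M" if "b \<in> ?B" for b using BM that by blast
    have "finsum M (\<lambda>b. c b \<odot>\<^bsub>M\<^esub> b) {b \<in> ?B. c b \<noteq> \<zero>} = finsum M (\<lambda>b. c b \<odot>\<^bsub>M\<^esub> b) ?B"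
      using cR bM by (intro M.add.finprod_mono_neutral_cong_left) auto
    also have "\<dots> = finsum M (\<lambda>i. c (e i) \<odot>\<^bsub>M\<^esub> e i) {..<k}"
      using cR bM by (intro M.add.finprod_reindex inj) auto
    finally show ?thesis .
  qed
  have "\<exists>!c. c \<in> ?B \<rightarrow>\<^sub>E carrier R \<and> finite {b \<in> ?B. c b \<noteq> \<zero>} \<and>
     x = finsum M (\<lambda>b. c b \<odot>\<^bsub>M\<^esub> b) {b \<in> ?B. c b \<noteq> \<zero>}" if x: "x \<in> carrier M" for x
  proof (rule ex_ex1I)
    from gen[OF x] obtain a where a: "\<forall>i<k. a i \<in> carrier R" "x = finsum M (\<lambda>i. a i \<odot>\<^bsub>M\<^esub> e i) {..<k}"
      by (elim exE conjE)
    define c where "c = restrict (\<lambda>b. a (inv_into {..<k} e b)) ?B"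
    have ce: "c (e i) = a i" if "i < k" for i
      using that inv_into_f_f[OF inj, of i] by (simp add: c_def)
    have c: "c \<in> ?B \<rightarrow>\<^sub>E carrier R"
    proof (rule PiE_I)
      fix b assume "b \<in> ?B"
      then obtain i where "i < k" "b = e i" by auto
      then show "c b \<in> carrier R" using a(1) ce by simp
    qed (simp add: c_def)
    have "finsum M (\<lambda>i. c (e i) \<odot>\<^bsub>M\<^esub> e i) {..<k} = x"
      unfolding a(2) using a(1) e ce by (intro M.finsum_cong') auto
    then show "\<exists>c. c \<in> ?B \<rightarrow>\<^sub>E carrier R \<and> finite {b \<in> ?B. c b \<noteq> \<zero>} \<and>
       x = finsum M (\<lambda>b. c b \<odot>\<^bsub>M\<^esub> b) {b \<in> ?B. c b \<noteq> \<zero>}"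
      using c sum_eq[OF c] by (intro exI[of _ c]) simp
  next
    fix c d assume c: "c \<in> ?B \<rightarrow>\<^sub>E carrier R \<and> finite {b \<in> ?B. c b \<noteq> \<zero>} \<and>
       x = finsum M (\<lambda>b. c b \<odot>\<^bsub>M\<^esub> b) {b \<in> ?B. c b \<noteq> \<zero>}"
      and d: "d \<in> ?B \<rightarrow>\<^sub>E carrier R \<and> finite {b \<in> ?B. d b \<noteq> \<zero>} \<and>
       x = finsum M (\<lambda>b. d b \<odot>\<^bsub>M\<^esub> b) {b \<in> ?B. d b \<noteq> \<zero>}"
    have eq: "finsum M (\<lambda>i. c (e i) \<odot>\<^bsub>M\<^esub> e i) {..<k} = finsum M (\<lambda>i. d (e i) \<odot>\<^bsub>M\<^esub> e i) {..<k}"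
      using c d sum_eq[of c] sum_eq[of d] by (elim conjE) simp
    have cR: "c (e i) \<in> carrier R" "d (e i) \<in> carrier R" if "i < k" for i
      using c d that by (auto simp: PiE_iff)
    have "c (e i) = d (e i)" if "i < k" for i
      by (rule unique[OF _ _ eq that]) (rule cR, assumption)+
    then have "c b = d b" if "b \<in> ?B" for b using that by auto
    moreover have "c \<in> extensional ?B" "d \<in> extensional ?B" using c d by (simp_all add: PiE_iff)
    ultimately show "c = d" by (intro extensionalityI[of c ?B d])
  qed
  then show ?thesis unfolding free_module_def using BM by (intro exI[of _ ?B]) simp
qed

theorem theorem2p4:
  fixes R :: "('a, 'b) ring_scheme" and m :: "'a set" and M :: "('a, 'c) module"
    and p n :: nat
  assumes "cohen_macaulay_local R m"
    and "krull_dim R > 0"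
    and "ring_char_p R p"
    and "module R M"
    and "finitely_generated R M"
    and "\<exists>r. has_rank R M r"
    and "n \<ge> kappa R m p"
    and "max_cohen_macaulay R m (frobenius_functor R p n M)"
  shows "free_module R M"
proof -
  interpret module R M by (rule assms(4))
  have loc: "local_ring R m" and noeth: "noetherian_ring R"
    using assms(1) by (simp_all add: cohen_macaulay_local_def)
  have mmax: "maximalideal m R" by (rule local_ringD(2)[OF loc])
  have mI: "ideal m R" by (rule local_ringD(3)[OF loc])
  have nontrivial: "\<one>\<^bsub>R\<^esub> \<noteq> \<zero>\<^bsub>R\<^esub>"
  proof
    assume "\<one>\<^bsub>R\<^esub> = \<zero>\<^bsub>R\<^esub>"
    then have "\<one>\<^bsub>R\<^esub> \<in> m" using additive_subgroup.zero_closed[OF ideal.axioms(1)[OF mI]] by simp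
    then show False using ideal.one_imp_carrier[OF mI] maximalideal.I_notcarr[OF mmax] by simp
  qed
  from finitely_generated_lin_span[OF assms(4,5)]
  obtain us where us: "set us \<subseteq> carrier M" "carrier M = lin_span M (carrier R) us" by (elim exE conjE)
  from minimal_generators[OF loc us]
  obtain vs where vs: "set vs \<subseteq> carrier M" "carrier M = lin_span M (carrier R) vs"
    and min: "\<forall>a i. (\<forall>i<length vs. a i \<in> carrier R) \<longrightarrow> finsum M (\<lambda>i. a i \<odot>\<^bsub>M\<^esub> vs ! i) {..<length vs} = \<zero>\<^bsub>M\<^esub> \<longrightarrow>
       i < length vs \<longrightarrow> a i \<in> m" by (elim exE conjE)
  let ?k = "length vs"
  have e: "vs ! i \<in> carrier M" if "i < ?k" for i using vs(1) nth_mem[OF that] by blast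
  have gen: "\<exists>a. (\<forall>i<?k. a i \<in> carrier R) \<and> x = finsum M (\<lambda>i. a i \<odot>\<^bsub>M\<^esub> vs ! i) {..<?k}"
    if "x \<in> carrier M" for x
    by (rule lin_span_finsum[OF vs(1)]) (use that vs(2) in simp)
  have rel: "a i \<in> m" if "\<And>i. i < ?k \<Longrightarrow> a i \<in> carrier R"
    "finsum M (\<lambda>i. a i \<odot>\<^bsub>M\<^esub> vs ! i) {..<?k} = \<zero>\<^bsub>M\<^esub>" "i < ?k" for a i
    using min that by simp
  obtain xs where sop: "system_of_parameters R m xs"
    and pow: "\<And>a. a \<in> m \<Longrightarrow> a [^]\<^bsub>R\<^esub> (p ^ n) \<in> genideal R (set xs)"
    using kappa_system_of_parameters[OF assms(1,2,3,7), of thesis] by simp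
  have xm: "set xs \<subseteq> m" and len: "enat (length xs) = krull_dim R"
    using sop by (simp_all add: system_of_parameters_def)
  have xR: "set xs \<subseteq> carrier R" using xm ideal.Icarr[OF mI] by blast
  have I: "ideal (genideal R (set xs)) R" by (rule R.genideal_ideal[OF xR])
  have "Sup {enat (length ys) | ys. regular_seq R (frobenius_functor R p n M) m ys} = enat (length xs)"
    using assms(8) len by (simp add: max_cohen_macaulay_def depth_def)
  \<comment> \<open>Positive dimension enters here: the supremum defining the depth of F^n(M) is
    then attained, by a regular sequence exactly as long as \<open>xs\<close>.\<close>
  moreover have "length xs > 0" using assms(2) len by (cases xs) (auto simp: zero_enat_def)
  ultimately have "\<exists>ys. regular_seq R (frobenius_functor R p n M) m ys \<and> length ys = length xs"
    by (rule Sup_enat_attained)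
  then obtain ys where ys: "regular_seq R (frobenius_functor R p n M) m ys" "length ys = length xs"
    by (elim exE conjE)
  have nil: "a i [^]\<^bsub>R\<^esub> (p ^ n) = \<zero>\<^bsub>R\<^esub>" if "\<And>i. i < ?k \<Longrightarrow> a i \<in> carrier R"
    "finsum M (\<lambda>i. a i \<odot>\<^bsub>M\<^esub> vs ! i) {..<?k} = \<zero>\<^bsub>M\<^esub>" "i < ?k" for a i
    by (rule frobenius_relation_power_zero[where e = "\<lambda>i. vs ! i" and M = M and m = m and k = ?k
      and I = "genideal R (set xs)" and xs = xs and ys = ys])
      (fact assms(4,3) I pow e gen rel loc noeth xm refl ys that)+
  from assms(6) obtain r \<phi> where
    iso: "module_iso (total_frac_ring R) (loc_module R M) (free_rank_module (total_frac_ring R) r) \<phi>"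
    unfolding has_rank_def by (elim exE)
  have triv: "a i = \<zero>\<^bsub>R\<^esub>" if "\<And>i. i < ?k \<Longrightarrow> a i \<in> carrier R"
    "finsum M (\<lambda>i. a i \<odot>\<^bsub>M\<^esub> vs ! i) {..<?k} = \<zero>\<^bsub>M\<^esub>" "i < ?k" for a i
    by (rule relations_trivial[where e = "\<lambda>i. vs ! i" and k = ?k and q = "p ^ n", OF assms(4) iso])
      (fact e gen nil that)+
  show ?thesis
    by (rule free_module_trivial_relations[where e = "\<lambda>i. vs ! i" and k = ?k, OF assms(4) nontrivial])
      (fact e gen triv)+
qed

end
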